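(* Let $(\Lambda,\le)$ be a directed poset and $(X,\Sigma,\mu)$ a locally standard measure space (indexed by $\Lambda$), and for each $p\in X$ let $\mathcal{D}_p=\varinjlim_{\alpha\in\Lambda}\mathcal{H}_{\alpha,p}$ be a locally Hilbert space. Let $\mathcal{M}_{\mathrm{DEC}}$ and $\mathcal{M}_{\mathrm{DIAG}}$ be the sets of all decomposable, respectively diagonalizable, locally bounded operators on $\int_X^{\oplus_{\mathrm{loc}}}\mathcal{D}_p\,\mathrm{d}\mu(p)$. Then $\mathcal{M}_{\mathrm{DEC}}=(\mathcal{M}_{\mathrm{DIAG}})'$ in each of the following two cases: (1) $\Lambda$ is a countable set; (2) $\mu$ is a counting measure on $X$.
   Context: **Locally Hilbert spaces.** Let $(\Lambda,\le)$ be a directed poset. A family $\mathcal{E}=\{\mathcal{H}_\alpha\}_{\alpha\in\Lambda}$ of Hilbert spaces is a strictly inductive system if $\mathcal{H}_\alpha\subseteq\mathcal{H}_\beta$ and the inclusion is isometric whenever $\alpha\le\beta$. A locally Hilbert space is the inductive limit $\mathcal{D}=\varinjlim_\alpha\mathcal{H}_\alpha=\bigcup_{\alpha}\mathcal{H}_\alpha$ of such a system, with the inner product induced from the $\mathcal{H}_\alpha$. A linear map $T:\mathcal{D}\to\mathcal{D}$ is locally bounded if for every $\alpha$: $T(\mathcal{H}_\alpha)\subseteq\mathcal{H}_\alpha$, $T(\mathcal{H}_\alpha^\perp\cap\mathcal{D})\subseteq\mathcal{H}_\alpha^\perp\cap\mathcal{D}$, and $T|_{\mathcal{H}_\alpha}\in\mathcal{B}(\mathcal{H}_\alpha)$.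 $C^*_{\mathcal{E}}(\mathcal{D})$ denotes the set of locally bounded operators on $\mathcal{D}$. The commutant of $\mathcal{M}\subseteq C^*_{\mathcal{E}}(\mathcal{D})$ is $\mathcal{M}'=\{T\in C^*_{\mathcal{E}}(\mathcal{D}): TS=ST\ \forall S\in\mathcal{M}\}$. **Locally standard measure spaces.** A family $\{(X_\alpha,\Sigma_\alpha)\}_{\alpha\in\Lambda}$ of measurable spaces is a strictly inductive system if, for $\alpha\le\beta$, $X_\alpha\subseteq X_\beta$ and $\Sigma_\alpha=\{E\cap X_\alpha: E\in\Sigma_\beta\}$ (in particular $\Sigma_\alpha\subseteq\Sigma_\beta$). Its inductive limit is $(X,\Sigma)$ with $X=\bigcup_\alpha X_\alpha$, $\Sigma=\{E\subseteq X: E\cap X_\alpha\in\Sigma_\alpha\ \forall\alpha\in\Lambda\}$. A family of finite positive measures $\mu_\alpha$ on $\Sigma_\alpha$ is a projective system of measures if $\mu_\alpha(E)=\mu_\beta(E)$ for $E\in\Sigma_\alpha$, $\alpha\le\beta$. Its projective limit is the measure $\mu$ on $\Sigma$ with $\mu(E)=\lim_\alpha\mu_\alpha(E\cap X_\alpha)$ if this net converges and $\mu(E)=\infty$ otherwise. $(X,\Sigma,\mu)$ is a locally standard measure space if each $(X_\alpha,\Sigma_\alpha,\mu_\alpha)$ is a standard measure space, i.e. its Borel structure is given by a complete separable metric space and $\mu_\alpha$ is a finite positive measure. **Direct integral.** Let $(X,\Sigma,\mu)$ be a locally standard measure space (indexed by $\Lambda$) and for $p\in X$ let $\mathcal{D}_p=\varinjlim_{\alpha\in\Lambda}\mathcal{H}_{\alpha,p}$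 be a locally Hilbert space with $\{\mathcal{H}_{\alpha,p}\}_{\alpha}$ a strictly inductive system of separable Hilbert spaces. The direct integral $\int_X^{\oplus_{\mathrm{loc}}}\mathcal{D}_p\,\mathrm{d}\mu(p)$ comprises functions $u:X\to\bigcup_p\mathcal{D}_p$ with $u(p)\in\mathcal{D}_p$ for all $p$ satisfying: (1) for each $u$ there is $\alpha_u\in\Lambda$ with $\mathrm{supp}(u)=\{p: u(p)\ne0\}\subseteq X_{\alpha_u}$ and $u(p)\in\mathcal{H}_{\alpha_u,p}$ for almost every $p\in X_{\alpha_u}$; (2) for any $u,v$ satisfying (1), $\zeta_{u,v}(p):=\langle u(p),v(p)\rangle_{\mathcal{D}_p}$ is in $L^1(X,\mu)$; (3) if $\{v_q\}_{q\in X}$ is a family with $v_q\in\mathcal{D}_q$ for all $q$ and there is $\alpha$ with $v_q=0$ for $q\in X\setminus X_\alpha$, and if $p\mapsto\langle u(p),v_p\rangle_{\mathcal{D}_p}$ is in $L^1(X,\mu)$ for every $u$ satisfying (1) with $\zeta_{u,u}\in L^1(X,\mu)$, then there is a function $v$ satisfying (1) with $\zeta_{v,v}\in L^1(X,\mu)$ and $v(p)=v_p$ for almost every $p\in X$. Operations are pointwise, functions equal almost everywhere are identified, and $\langle u,v\rangle=\int_X\langle u(p),v(p)\rangle\,\mathrm{d}\mu(p)$. The direct integral is a locally Hilbert space with strictly inductive system $\mathcal{E}=\{\mathcal{H}_\alpha\}_{\alpha\in\Lambda}$, $\mathcal{H}_\alpha=\{u:\mathrm{supp}(u)\subseteq X_\alpha,\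 u(p)\in\mathcal{H}_{\alpha,p}\text{ for a.e. }p\in X_\alpha\}$; locally bounded operators on it, and commutants, are understood with respect to this $\mathcal{E}$. **Decomposable and diagonalizable operators.** A locally bounded operator $T$ on $\int_X^{\oplus_{\mathrm{loc}}}\mathcal{D}_p\,\mathrm{d}\mu(p)$ is decomposable if there is a family of locally bounded operators $T_p:\mathcal{D}_p\to\mathcal{D}_p$, $p\in X$, such that for any $u$, $(Tu)(p)=T_pu(p)$ for almost every $p\in X$. It is diagonalizable if it is decomposable and there is a measurable $f:X\to\mathbb{C}$ such that for any $u$, $(Tu)(p)=f(p)u(p)$ for almost every $p\in X$.
   Formalization: Local boundedness of T_p is required only with respect to those α with p∈X_α; in case (1) each H_α is also assumed to be the classical direct integral of the H_{α,p} over X_α (separable and maximal). The claim is false without these. *)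

theory Defs
  imports "HOL-Analysis.Analysis" "HOL-Algebra.Module"
begin

section \<open>Locally Hilbert spaces\<close>

definition complex_field :: "complex ring" where
  "complex_field = \<lparr>carrier = UNIV, monoid.mult = (*), one = 1, zero = 0, add = (+)\<rparr>"

lemma cring_complex_field: "cring complex_field"
proof (rule cringI)
  show "abelian_group complex_field"
    by (rule abelian_groupI)
       (auto simp: complex_field_def algebra_simps intro: exI[of _ "- x" for x] ab_left_minus)
  show "comm_monoid complex_field"
    by (rule comm_monoidI) (auto simp: complex_field_def)
qed (auto simp: complex_field_def algebra_simps)

text \<open>Vector spaces are modules over \<^const>\<open>complex_field\<close>; as usual for
  \<open>module\<close> records, the fields \<open>mult\<close> and \<open>one\<close> carry no meaning.\<close>

record 'a inner_space = "(complex, 'a) module" +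
  ip :: "'a \<Rightarrow> 'a \<Rightarrow> complex"

locale complex_inner_product_space = Module.module complex_field V
  for V :: "('a, 'b) inner_space_scheme" (structure) +
  assumes ip_add_left: "\<lbrakk>x \<in> carrier V; y \<in> carrier V; z \<in> carrier V\<rbrakk>
      \<Longrightarrow> ip V (x \<oplus> y) z = ip V x z + ip V y z"
    and ip_smult_left: "\<lbrakk>x \<in> carrier V; y \<in> carrier V\<rbrakk> \<Longrightarrow> ip V (a \<odot> x) y = a * ip V x y"
    and ip_commute: "\<lbrakk>x \<in> carrier V; y \<in> carrier V\<rbrakk> \<Longrightarrow> ip V y x = cnj (ip V x y)"
    and ip_nonneg: "x \<in> carrier V \<Longrightarrow> 0 \<le> Re (ip V x x)"
    and ip_definite: "\<lbrakk>x \<in> carrier V; ip V x x = 0\<rbrakk> \<Longrightarrow> x = \<zero>"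

definition ip_norm :: "('a, 'b) inner_space_scheme \<Rightarrow> 'a \<Rightarrow> real" where
  "ip_norm V x = sqrt (Re (ip V x x))"

text \<open>The value 0 outside the carrier only serves to satisfy \<^locale>\<open>Metric_space\<close>, which
  asks for nonnegativity and symmetry on the whole type.\<close>

definition ip_dist :: "('a, 'b) inner_space_scheme \<Rightarrow> 'a \<Rightarrow> 'a \<Rightarrow> real" where
  "ip_dist V x y =
     (if x \<in> carrier V \<and> y \<in> carrier V then ip_norm V (x \<ominus>\<^bsub>V\<^esub> y) else 0)"

definition orth :: "('a, 'b) inner_space_scheme \<Rightarrow> 'a set \<Rightarrow> 'a set" where
  "orth V S = {x \<in> carrier V. \<forall>y\<in>S. ip V x y = 0}"

definition separable_subset :: "('a, 'b) inner_space_scheme \<Rightarrow> 'a set \<Rightarrow> bool" where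
  "separable_subset V S \<longleftrightarrow> separable_space (Metric_space.mtopology S (ip_dist V))"

text \<open>The strictly inductive system \<open>\<H>\<close> is represented inside its inductive limit \<open>V\<close>: all
  \<open>\<H> \<alpha>\<close> carry the restricted operations and inner product of \<open>V\<close>, so that the inclusions
  \<open>\<H> \<alpha> \<subseteq> \<H> \<beta>\<close> are linear isometries.\<close>

definition locally_hilbert_space ::
  "('a, 'b) inner_space_scheme \<Rightarrow> ('i::order \<Rightarrow> 'a set) \<Rightarrow> bool" where
  "locally_hilbert_space V \<H> \<longleftrightarrow>
     complex_inner_product_space V \<and>
     (\<forall>\<alpha>. submodule (\<H> \<alpha>) complex_field V \<and> Metric_space.mcomplete (\<H> \<alpha>) (ip_dist V)) \<and>
     (\<forall>\<alpha> \<beta>. \<alpha> \<le> \<beta> \<longrightarrow> \<H> \<alpha> \<subseteq> \<H> \<beta>) \<and>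
     carrier V = (\<Union>\<alpha>. \<H> \<alpha>)"

text \<open>Operators on \<open>V\<close> are extensional functions, so that they are equal iff they agree on
  \<open>V\<close>. The index set \<open>I\<close> allows a cofinal subsystem with the same inductive limit.\<close>

definition locally_bounded_operators ::
  "('a, 'b) inner_space_scheme \<Rightarrow> 'i set \<Rightarrow> ('i \<Rightarrow> 'a set) \<Rightarrow> ('a \<Rightarrow> 'a) set" where
  "locally_bounded_operators V I \<H> =
     {T \<in> carrier V \<rightarrow>\<^sub>E carrier V.
        (\<forall>x\<in>carrier V. \<forall>y\<in>carrier V. T (x \<oplus>\<^bsub>V\<^esub> y) = T x \<oplus>\<^bsub>V\<^esub> T y) \<and>
        (\<forall>a. \<forall>x\<in>carrier V. T (a \<odot>\<^bsub>V\<^esub> x) = a \<odot>\<^bsub>V\<^esub> T x) \<and>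
        (\<forall>\<alpha>\<in>I. T ` \<H> \<alpha> \<subseteq> \<H> \<alpha> \<and>
               T ` orth V (\<H> \<alpha>) \<subseteq> orth V (\<H> \<alpha>) \<and>
               (\<exists>c. \<forall>x\<in>\<H> \<alpha>. ip_norm V (T x) \<le> c * ip_norm V x))}"

definition commutant ::
  "('a, 'b) inner_space_scheme \<Rightarrow> 'i set \<Rightarrow> ('i \<Rightarrow> 'a set) \<Rightarrow> ('a \<Rightarrow> 'a) set \<Rightarrow> ('a \<Rightarrow> 'a) set" where
  "commutant V I \<H> \<M> =
     {T \<in> locally_bounded_operators V I \<H>. \<forall>S\<in>\<M>. \<forall>x\<in>carrier V. T (S x) = S (T x)}"


section \<open>Locally standard measure spaces\<close>

definition standard_measure_space :: "'x measure \<Rightarrow> bool" where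
  "standard_measure_space \<nu> \<longleftrightarrow>
     finite_measure \<nu> \<and>
     (\<exists>d. Metric_space (space \<nu>) d \<and> Metric_space.mcomplete (space \<nu>) d \<and>
          separable_space (Metric_space.mtopology (space \<nu>) d) \<and>
          sets \<nu> = sigma_sets (space \<nu>) {G. openin (Metric_space.mtopology (space \<nu>) d) G})"

text \<open>\<open>\<nu> \<alpha>\<close> is the measure space \<open>(X\<^sub>\<alpha>, \<Sigma>\<^sub>\<alpha>, \<mu>\<^sub>\<alpha>)\<close> and \<open>\<mu>\<close> the limit \<open>(X, \<Sigma>, \<mu>)\<close>.
  The inclusion of the \<open>\<sigma>\<close>-algebras is a condition of its own, as the trace condition alone
  does not make \<open>X\<^sub>\<alpha>\<close> a member of \<open>\<Sigma>\<^sub>\<beta>\<close>. Over a directed index type, \<^const>\<open>at_top\<close> is the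
  filter of net convergence.\<close>

definition locally_standard_measure_space ::
  "('i::order \<Rightarrow> 'x measure) \<Rightarrow> 'x measure \<Rightarrow> bool" where
  "locally_standard_measure_space \<nu> \<mu> \<longleftrightarrow>
     (\<forall>\<alpha>. standard_measure_space (\<nu> \<alpha>)) \<and>
     (\<forall>\<alpha> \<beta>. \<alpha> \<le> \<beta> \<longrightarrow>
        space (\<nu> \<alpha>) \<subseteq> space (\<nu> \<beta>) \<and>
        sets (\<nu> \<alpha>) = {E \<inter> space (\<nu> \<alpha>) |E. E \<in> sets (\<nu> \<beta>)} \<and>
        sets (\<nu> \<alpha>) \<subseteq> sets (\<nu> \<beta>) \<and>
        (\<forall>E\<in>sets (\<nu> \<alpha>). emeasure (\<nu> \<alpha>) E = emeasure (\<nu> \<beta>) E)) \<and>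
     space \<mu> = (\<Union>\<alpha>. space (\<nu> \<alpha>)) \<and>
     sets \<mu> = {E. E \<subseteq> space \<mu> \<and> (\<forall>\<alpha>. E \<inter> space (\<nu> \<alpha>) \<in> sets (\<nu> \<alpha>))} \<and>
     (\<forall>E\<in>sets \<mu>. emeasure \<mu> E =
        (let m = (\<lambda>\<alpha>. measure (\<nu> \<alpha>) (E \<inter> space (\<nu> \<alpha>)))
         in if \<exists>l. (m \<longlongrightarrow> l) at_top then ennreal (Lim at_top m) else \<infinity>))"


section \<open>Direct integrals\<close>

text \<open>\<open>\<D> p\<close> is the fibre over \<open>p\<close>, with strictly inductive system \<open>\<lambda>\<alpha>. \<H> \<alpha> p\<close>.\<close>

definition supported_at_level ::
  "('i::order \<Rightarrow> 'x measure) \<Rightarrow> 'x measure \<Rightarrow> ('x \<Rightarrow> 'v inner_space) \<Rightarrow> ('i \<Rightarrow> 'x \<Rightarrow> 'v set)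
   \<Rightarrow> 'i \<Rightarrow> ('x \<Rightarrow> 'v) \<Rightarrow> bool" where
  "supported_at_level \<nu> \<mu> \<D> \<H> \<alpha> u \<longleftrightarrow>
     {p \<in> space \<mu>. u p \<noteq> \<zero>\<^bsub>\<D> p\<^esub>} \<subseteq> space (\<nu> \<alpha>) \<and>
     (AE p in \<mu>. p \<in> space (\<nu> \<alpha>) \<longrightarrow> u p \<in> \<H> \<alpha> p)"

definition local_section ::
  "('i::order \<Rightarrow> 'x measure) \<Rightarrow> 'x measure \<Rightarrow> ('x \<Rightarrow> 'v inner_space) \<Rightarrow> ('i \<Rightarrow> 'x \<Rightarrow> 'v set)
   \<Rightarrow> ('x \<Rightarrow> 'v) \<Rightarrow> bool" where
  "local_section \<nu> \<mu> \<D> \<H> u \<longleftrightarrow>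
     u \<in> (\<Pi>\<^sub>E p\<in>space \<mu>. carrier (\<D> p)) \<and> (\<exists>\<alpha>. supported_at_level \<nu> \<mu> \<D> \<H> \<alpha> u)"

text \<open>As for classical direct integrals, conditions (2) and (3) do not determine a space of
  functions: they are properties of a given set \<open>U\<close> of sections. Since functions that are
  equal almost everywhere are identified, \<open>U\<close> is closed under changes on null sets (second
  clause), and membership in \<open>L\<^sup>1(X, \<mu>)\<close> is integrability for the completion of \<open>\<mu>\<close>, i.e.
  equality almost everywhere with a \<open>\<mu>\<close>-integrable function.\<close>

definition is_direct_integral ::
  "('i::order \<Rightarrow> 'x measure) \<Rightarrow> 'x measure \<Rightarrow> ('x \<Rightarrow> 'v inner_space) \<Rightarrow> ('i \<Rightarrow> 'x \<Rightarrow> 'v set)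
   \<Rightarrow> ('x \<Rightarrow> 'v) set \<Rightarrow> bool" where
  "is_direct_integral \<nu> \<mu> \<D> \<H> U \<longleftrightarrow>
     (\<forall>u\<in>U. local_section \<nu> \<mu> \<D> \<H> u) \<and>
     (\<forall>u\<in>U. \<forall>v. local_section \<nu> \<mu> \<D> \<H> v \<and> (AE p in \<mu>. v p = u p) \<longrightarrow> v \<in> U) \<and>
     (\<forall>u\<in>U. \<forall>v\<in>U. integrable (completion \<mu>) (\<lambda>p. ip (\<D> p) (u p) (v p))) \<and>
     (\<forall>v \<in> (\<Pi>\<^sub>E p\<in>space \<mu>. carrier (\<D> p)).
        (\<exists>\<alpha>. \<forall>q\<in>space \<mu> - space (\<nu> \<alpha>). v q = \<zero>\<^bsub>\<D> q\<^esub>) \<and>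
        (\<forall>u\<in>U. integrable (completion \<mu>) (\<lambda>p. ip (\<D> p) (u p) (v p)))
        \<longrightarrow> (\<exists>w\<in>U. AE p in \<mu>. w p = v p))"

definition ae_rel :: "'x measure \<Rightarrow> ('x \<Rightarrow> 'v) set \<Rightarrow> (('x \<Rightarrow> 'v) \<times> ('x \<Rightarrow> 'v)) set" where
  "ae_rel \<mu> U = {(u, v). u \<in> U \<and> v \<in> U \<and> (AE p in \<mu>. u p = v p)}"

definition ae_class :: "'x measure \<Rightarrow> ('x \<Rightarrow> 'v) set \<Rightarrow> ('x \<Rightarrow> 'v) \<Rightarrow> ('x \<Rightarrow> 'v) set" where
  "ae_class \<mu> U u = ae_rel \<mu> U `` {u}"

definition direct_integral ::
  "'x measure \<Rightarrow> ('x \<Rightarrow> 'v inner_space) \<Rightarrow> ('x \<Rightarrow> 'v) set \<Rightarrow> ('x \<Rightarrow> 'v) set inner_space" where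
  "direct_integral \<mu> \<D> U =
     \<lparr>carrier = U // ae_rel \<mu> U,
      monoid.mult = undefined, one = undefined,
      zero = ae_class \<mu> U (\<lambda>p\<in>space \<mu>. \<zero>\<^bsub>\<D> p\<^esub>),
      add = (\<lambda>A B. ae_class \<mu> U
               (\<lambda>p\<in>space \<mu>. (SOME u. u \<in> A) p \<oplus>\<^bsub>\<D> p\<^esub> (SOME v. v \<in> B) p)),
      smult = (\<lambda>a A. ae_class \<mu> U (\<lambda>p\<in>space \<mu>. a \<odot>\<^bsub>\<D> p\<^esub> (SOME u. u \<in> A) p)),
      ip = (\<lambda>A B. \<integral>p. ip (\<D> p) ((SOME u. u \<in> A) p) ((SOME v. v \<in> B) p) \<partial>completion \<mu>)\<rparr>"

definition direct_integral_level ::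
  "('i::order \<Rightarrow> 'x measure) \<Rightarrow> 'x measure \<Rightarrow> ('x \<Rightarrow> 'v inner_space) \<Rightarrow> ('i \<Rightarrow> 'x \<Rightarrow> 'v set)
   \<Rightarrow> ('x \<Rightarrow> 'v) set \<Rightarrow> 'i \<Rightarrow> ('x \<Rightarrow> 'v) set set" where
  "direct_integral_level \<nu> \<mu> \<D> \<H> U \<alpha> =
     {ae_class \<mu> U u |u. u \<in> U \<and> supported_at_level \<nu> \<mu> \<D> \<H> \<alpha> u}"

text \<open>The Hilbert space at level \<open>\<alpha>\<close> is the direct integral of \<open>(\<H> \<alpha> p)\<close>, \<open>p \<in> X\<^sub>\<alpha>\<close>, over
  \<open>(X\<^sub>\<alpha>, \<Sigma>\<^sub>\<alpha>, \<mu>\<^sub>\<alpha>)\<close> in the classical sense (Kadison-Ringrose, Definition 14.1.1): it is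
  separable, and it contains every section of \<open>(\<H> \<alpha> p)\<close> that has integrable inner products
  with all of its members. Integrability of the inner products of the members themselves is
  part of \<^const>\<open>is_direct_integral\<close>.\<close>

definition level_is_classical_direct_integral ::
  "('i::order \<Rightarrow> 'x measure) \<Rightarrow> 'x measure \<Rightarrow> ('x \<Rightarrow> 'v inner_space) \<Rightarrow> ('i \<Rightarrow> 'x \<Rightarrow> 'v set)
   \<Rightarrow> ('x \<Rightarrow> 'v) set \<Rightarrow> 'i \<Rightarrow> bool" where
  "level_is_classical_direct_integral \<nu> \<mu> \<D> \<H> U \<alpha> \<longleftrightarrow>
     separable_subset (direct_integral \<mu> \<D> U) (direct_integral_level \<nu> \<mu> \<D> \<H> U \<alpha>) \<and>
     (\<forall>v \<in> (\<Pi>\<^sub>E p\<in>space (\<nu> \<alpha>). \<H> \<alpha> p).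
        (\<forall>u\<in>U. supported_at_level \<nu> \<mu> \<D> \<H> \<alpha> u \<longrightarrow>
           integrable (completion (\<nu> \<alpha>)) (\<lambda>p. ip (\<D> p) (u p) (v p)))
        \<longrightarrow> (\<exists>w\<in>U. supported_at_level \<nu> \<mu> \<D> \<H> \<alpha> w \<and> (AE p in \<nu> \<alpha>. w p = v p)))"


section \<open>Decomposable and diagonalizable operators\<close>

text \<open>Only the spaces \<open>\<H> \<alpha> p\<close> with \<open>p \<in> X\<^sub>\<alpha>\<close> enter the direct integral. Accordingly, local
  boundedness in the fibre over \<open>p\<close> refers to the indices \<open>\<alpha>\<close> with \<open>p \<in> X\<^sub>\<alpha>\<close>; these form a
  cofinal set, so the inductive limit is still \<open>\<D> p\<close>.\<close>

definition decomposable_operators ::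
  "('i::order \<Rightarrow> 'x measure) \<Rightarrow> 'x measure \<Rightarrow> ('x \<Rightarrow> 'v inner_space) \<Rightarrow> ('i \<Rightarrow> 'x \<Rightarrow> 'v set)
   \<Rightarrow> ('x \<Rightarrow> 'v) set \<Rightarrow> (('x \<Rightarrow> 'v) set \<Rightarrow> ('x \<Rightarrow> 'v) set) set" where
  "decomposable_operators \<nu> \<mu> \<D> \<H> U =
     {T \<in> locally_bounded_operators (direct_integral \<mu> \<D> U) UNIV
            (direct_integral_level \<nu> \<mu> \<D> \<H> U).
        \<exists>Tp. (\<forall>p\<in>space \<mu>. Tp p \<in> locally_bounded_operators (\<D> p)
                              {\<alpha>. p \<in> space (\<nu> \<alpha>)} (\<lambda>\<alpha>. \<H> \<alpha> p)) \<and>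
             (\<forall>u\<in>U. \<forall>v\<in>T (ae_class \<mu> U u). AE p in \<mu>. v p = Tp p (u p))}"

definition diagonalizable_operators ::
  "('i::order \<Rightarrow> 'x measure) \<Rightarrow> 'x measure \<Rightarrow> ('x \<Rightarrow> 'v inner_space) \<Rightarrow> ('i \<Rightarrow> 'x \<Rightarrow> 'v set)
   \<Rightarrow> ('x \<Rightarrow> 'v) set \<Rightarrow> (('x \<Rightarrow> 'v) set \<Rightarrow> ('x \<Rightarrow> 'v) set) set" where
  "diagonalizable_operators \<nu> \<mu> \<D> \<H> U =
     {T \<in> decomposable_operators \<nu> \<mu> \<D> \<H> U.
        \<exists>f \<in> borel_measurable \<mu>. \<forall>u\<in>U. \<forall>v\<in>T (ae_class \<mu> U u).
          AE p in \<mu>. v p = f p \<odot>\<^bsub>\<D> p\<^esub> u p}"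

end

theory Submission
  imports Defs
begin

text \<open>
  A decomposable operator acts fibrewise, so it commutes with every diagonalizable one. Conversely,
  let \<open>T\<close> commute with the diagonalizable operators; only the cut-offs \<open>u \<mapsto> \<chi>\<^sub>E u\<close> are used.
  If \<open>\<mu>\<close> is the counting measure, the cut-offs to single points split \<open>T\<close> into its fibre operators.

  If \<open>\<Lambda>\<close> is countable, applying the norm bound of \<open>T\<close> at level \<open>\<alpha>\<close> to all cut-offs of \<open>u\<close> gives the
  pointwise estimate \<open>\<parallel>(T u)(p)\<parallel> \<le> c\<^sub>\<alpha> \<parallel>u(p)\<parallel>\<close> almost everywhere. A countable dense family of sections
  at level \<open>\<alpha>\<close> has, for almost every \<open>p\<close>, values dense in \<open>\<H>\<^sub>\<alpha>\<^sub>,\<^sub>p\<close>: a field of vectors orthogonal to the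
  family is itself a section (no measurability has to be checked, by the maximality of the direct
  integral) and is orthogonal to all sections, itself included. By the estimate, \<open>s(p) \<mapsto> (T s)(p)\<close>
  extends to a bounded operator on \<open>\<H>\<^sub>\<alpha>\<^sub>,\<^sub>p\<close>, and the extensions for the countably many levels agree. The
  same maximality shows that the fibrewise projections onto \<open>\<H>\<^sub>\<alpha>\<^sub>,\<^sub>p\<close> map sections to sections, which
  transfers the invariance of orthogonal complements from \<open>T\<close> to its fibre operators.
\<close>

section \<open>Inner product spaces with explicit carrier\<close>

text \<open>The obstacle is null sets. A relation between sections holds outside a null set that
  depends on the sections, scalars and level involved, while a fibre operator must be linear,
  bounded and compatible with orthogonal complements at every point, for all vectors and all levels
  at once. In the countable case the fibre operator is therefore pinned down by countably many
  relations: countable dense families, a countable dense set of scalars, countably many levels. All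
  other vectors are reached by norm limits, and the zero operator is put on the remaining null set.
  For the counting measure null sets are empty.

  Norm limits need completeness, which each \<open>\<H> \<alpha> p\<close> has but their union in
  general lacks. Closures, projections and extensions are therefore formed inside one level. The
  complement of \<open>\<H> \<alpha> p\<close> in \<open>\<D> p\<close> reaches into all higher
  levels; it is approximated by dense values from which their projections onto
  \<open>\<H> \<alpha> p\<close> are subtracted, again a countable family.\<close>

lemma complex_field_simps [simp]:
  "carrier complex_field = UNIV" "monoid.mult complex_field = (*)" "one complex_field = 1"
  "zero complex_field = 0" "add complex_field = (+)"
  by (simp_all add: complex_field_def)

context complex_inner_product_space
begin

lemma smult_carrier [simp, intro]: "x \<in> carrier V \<Longrightarrow> a \<odot> x \<in> carrier V"
  by (rule smult_closed) auto

lemma ip_add_right: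
  assumes "x \<in> carrier V" "y \<in> carrier V" "z \<in> carrier V"
  shows "ip V z (x \<oplus> y) = ip V z x + ip V z y"
  using assms by (metis M.add.m_closed complex_cnj_add ip_add_left ip_commute)

lemma ip_smult_right:
  "\<lbrakk>x \<in> carrier V; y \<in> carrier V\<rbrakk> \<Longrightarrow> ip V x (a \<odot> y) = cnj a * ip V x y"
  by (metis complex_cnj_mult ip_commute ip_smult_left smult_carrier)

lemma smult_zero_left: "x \<in> carrier V \<Longrightarrow> 0 \<odot> x = \<zero>"
  using smult_l_null[of x] by simp

lemma ip_zero_left [simp]: "x \<in> carrier V \<Longrightarrow> ip V \<zero> x = 0"
  using ip_smult_left[of \<zero> x 0] smult_zero_left[of \<zero>] by simp

lemma ip_zero_right [simp]: "x \<in> carrier V \<Longrightarrow> ip V x \<zero> = 0"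
  using ip_commute[of \<zero> x] by simp

lemma ip_uminus_left: "\<lbrakk>x \<in> carrier V; y \<in> carrier V\<rbrakk> \<Longrightarrow> ip V (\<ominus> x) y = - ip V x y"
  using ip_add_left[of x "\<ominus> x" y] by (simp add: M.r_neg eq_neg_iff_add_eq_0 add.commute)

lemma ip_uminus_right: "\<lbrakk>x \<in> carrier V; y \<in> carrier V\<rbrakk> \<Longrightarrow> ip V y (\<ominus> x) = - ip V y x"
  using ip_add_right[of x "\<ominus> x" y] by (simp add: M.r_neg eq_neg_iff_add_eq_0 add.commute)

lemma ip_diff_left:
  "\<lbrakk>x \<in> carrier V; y \<in> carrier V; z \<in> carrier V\<rbrakk> \<Longrightarrow> ip V (x \<ominus> y) z = ip V x z - ip V y z"
  by (simp add: M.minus_eq ip_add_left ip_uminus_left)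

lemma ip_diff_right:
  "\<lbrakk>x \<in> carrier V; y \<in> carrier V; z \<in> carrier V\<rbrakk> \<Longrightarrow> ip V z (x \<ominus> y) = ip V z x - ip V z y"
  by (simp add: M.minus_eq ip_add_right ip_uminus_right)

lemmas ip_simps = ip_add_left ip_add_right ip_smult_left ip_smult_right ip_uminus_left
  ip_uminus_right ip_diff_left ip_diff_right

lemma diff_eq_zero_iff: "\<lbrakk>x \<in> carrier V; y \<in> carrier V\<rbrakk> \<Longrightarrow> x \<ominus> y = \<zero> \<longleftrightarrow> x = y"
  by (metis M.add.inv_closed M.minus_eq M.minus_equality M.minus_minus M.r_neg M.a_comm)

text \<open>Vector identities are proved by pairing both sides with an arbitrary vector.\<close>

lemma ip_eqI:
  assumes "x \<in> carrier V" "y \<in> carrier V" "\<And>z. z \<in> carrier V \<Longrightarrow> ip V x z = ip V y z"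
  shows "x = y"
proof -
  have "ip V (x \<ominus> y) (x \<ominus> y) = 0"
    using assms by (simp add: ip_diff_left)
  then have "x \<ominus> y = \<zero>" using assms by (intro ip_definite) auto
  then show ?thesis using assms by (simp add: diff_eq_zero_iff)
qed

section \<open>Norm, inner product estimate and triangle inequality\<close>

lemma ip_norm_nonneg [simp]: "x \<in> carrier V \<Longrightarrow> 0 \<le> ip_norm V x"
  by (simp add: ip_norm_def ip_nonneg)

lemma ip_norm_sq: "x \<in> carrier V \<Longrightarrow> (ip_norm V x)\<^sup>2 = Re (ip V x x)"
  by (simp add: ip_norm_def ip_nonneg)

lemma ip_self: "x \<in> carrier V \<Longrightarrow> ip V x x = of_real ((ip_norm V x)\<^sup>2)"
  using ip_commute[of x x] by (auto simp: complex_eq_iff ip_norm_sq)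

lemma ip_norm_zero [simp]: "ip_norm V \<zero> = 0"
  by (simp add: ip_norm_def)

lemma ip_norm_eq_zero: "x \<in> carrier V \<Longrightarrow> ip_norm V x = 0 \<longleftrightarrow> x = \<zero>"
  using ip_definite[of x] ip_self[of x] by auto

lemma ip_norm_smult: "x \<in> carrier V \<Longrightarrow> ip_norm V (a \<odot> x) = cmod a * ip_norm V x"
proof -
  assume x: "x \<in> carrier V"
  have "ip V (a \<odot> x) (a \<odot> x) = (a * cnj a) * ip V x x"
    using x by (simp add: ip_simps)
  also have "\<dots> = of_real ((cmod a * ip_norm V x)\<^sup>2)"
    using x by (simp add: ip_self power_mult_distrib flip: complex_norm_square)
  finally have "(ip_norm V (a \<odot> x))\<^sup>2 = (cmod a * ip_norm V x)\<^sup>2"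
    using x by (simp add: ip_norm_sq)
  then show ?thesis using x by (simp add: power2_eq_iff_nonneg)
qed

lemma ip_norm_add_sq:
  "\<lbrakk>x \<in> carrier V; y \<in> carrier V\<rbrakk> \<Longrightarrow>
    (ip_norm V (x \<oplus> y))\<^sup>2 = (ip_norm V x)\<^sup>2 + 2 * Re (ip V x y) + (ip_norm V y)\<^sup>2"
  using ip_commute[of x y] by (simp add: ip_norm_sq ip_simps)

lemma ip_norm_diff_sq:
  "\<lbrakk>x \<in> carrier V; y \<in> carrier V\<rbrakk> \<Longrightarrow>
    (ip_norm V (x \<ominus> y))\<^sup>2 = (ip_norm V x)\<^sup>2 - 2 * Re (ip V x y) + (ip_norm V y)\<^sup>2"
  using ip_commute[of x y] by (simp add: ip_norm_sq ip_simps)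

lemma ip_norm_minus_commute:
  assumes "x \<in> carrier V" "y \<in> carrier V"
  shows "ip_norm V (x \<ominus> y) = ip_norm V (y \<ominus> x)"
  using assms by (simp add: ip_norm_def ip_simps)

text \<open>The squared norm of \<open>|y| x - |x| y\<close> is nonnegative and expands to
  \<open>2 |x| |y| (|x| |y| - Re <x, y>)\<close>. The real part is all that the triangle inequality
  uses.\<close>

lemma Re_ip_le: 
  assumes "x \<in> carrier V" "y \<in> carrier V"
  shows "Re (ip V x y) \<le> ip_norm V x * ip_norm V y"
proof (cases "x = \<zero> \<or> y = \<zero>")
  case True
  then show ?thesis using assms by auto
next
  case False
  let ?a = "ip_norm V x" and ?b = "ip_norm V y"
  have pos: "?a > 0" "?b > 0"
    using False assms ip_norm_eq_zero ip_norm_nonneg by (metis less_eq_real_def)+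
  have "0 \<le> (ip_norm V ((of_real ?b \<odot> x) \<ominus> (of_real ?a \<odot> y)))\<^sup>2" by simp
  also have "\<dots> = 2 * (?a * ?b) * (?a * ?b - Re (ip V x y))"
    using assms by (subst ip_norm_diff_sq) (auto simp: ip_norm_smult ip_simps algebra_simps power2_eq_square)
  finally have "0 \<le> ?a * ?b - Re (ip V x y)"
    using mult_pos_pos[OF pos] by (auto simp: zero_le_mult_iff not_le)
  then show ?thesis by simp
qed

lemma ip_norm_triangle:
  assumes "x \<in> carrier V" "y \<in> carrier V"
  shows "ip_norm V (x \<oplus> y) \<le> ip_norm V x + ip_norm V y"
proof (rule power2_le_imp_le)
  show "(ip_norm V (x \<oplus> y))\<^sup>2 \<le> (ip_norm V x + ip_norm V y)\<^sup>2"
    using Re_ip_le[OF assms] assms by (simp add: ip_norm_add_sq power2_sum)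
qed (use assms in simp)

lemma ip_norm_diff_triangle:
  assumes "x \<in> carrier V" "y \<in> carrier V" "z \<in> carrier V"
  shows "ip_norm V (x \<ominus> z) \<le> ip_norm V (x \<ominus> y) + ip_norm V (y \<ominus> z)"
proof -
  have "x \<ominus> z = (x \<ominus> y) \<oplus> (y \<ominus> z)"
    using assms by (intro ip_eqI) (auto simp: ip_simps)
  then show ?thesis using ip_norm_triangle assms by simp
qed

text \<open>Serves to show that discarding an orthogonal component does not increase a
  distance.\<close>

lemma ip_norm_pythagoras_le:
  assumes "x \<in> carrier V" "y \<in> carrier V" "ip V x y = 0"
  shows "ip_norm V x \<le> ip_norm V (x \<oplus> y)"
  by (rule power2_le_imp_le) (use assms in \<open>auto simp: ip_norm_add_sq\<close>)

section \<open>Complete subspaces and orthogonal projections\<close>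

lemma Metric_space_ip_dist: "S \<subseteq> carrier V \<Longrightarrow> Metric_space S (ip_dist V)"
proof
  fix x y z
  assume S: "S \<subseteq> carrier V"
  show "0 \<le> ip_dist V x y" by (auto simp: ip_dist_def)
  show "ip_dist V x y = ip_dist V y x" by (auto simp: ip_dist_def ip_norm_minus_commute)
  show "ip_dist V x y = 0 \<longleftrightarrow> x = y" if "x \<in> S" "y \<in> S"
    using that S by (auto simp: ip_dist_def ip_norm_eq_zero diff_eq_zero_iff subset_iff)
  show "ip_dist V x z \<le> ip_dist V x y + ip_dist V y z" if "x \<in> S" "y \<in> S" "z \<in> S"
    using that S ip_norm_diff_triangle by (auto simp: ip_dist_def subset_iff)
qed

text \<open>Completeness is demanded of \<open>C\<close> itself, through norm-Cauchy sequences: the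
  ambient space is only an inner product space, where a closed subset need not be complete.\<close>

definition closed_subspace :: "'a set \<Rightarrow> bool" where
  "closed_subspace C \<longleftrightarrow> C \<subseteq> carrier V \<and> \<zero> \<in> C \<and>
     (\<forall>x\<in>C. \<forall>y\<in>C. x \<oplus> y \<in> C) \<and> (\<forall>a. \<forall>x\<in>C. a \<odot> x \<in> C) \<and>
     (\<forall>\<sigma>. (\<forall>n. \<sigma> n \<in> C) \<and> (\<forall>\<epsilon>>0. \<exists>N. \<forall>m\<ge>N. \<forall>n\<ge>N. ip_norm V (\<sigma> m \<ominus> \<sigma> n) < \<epsilon>) \<longrightarrow>
        (\<exists>x\<in>C. (\<lambda>n. ip_norm V (\<sigma> n \<ominus> x)) \<longlonglongrightarrow> 0))"

lemma closed_subspaceD: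
  assumes "closed_subspace C"
  shows "x \<in> C \<Longrightarrow> x \<in> carrier V" "\<zero> \<in> C" "x \<in> C \<Longrightarrow> y \<in> C \<Longrightarrow> x \<oplus> y \<in> C" "x \<in> C \<Longrightarrow> a \<odot> x \<in> C"
    "\<lbrakk>\<And>n. \<sigma> n \<in> C; \<And>\<epsilon>. \<epsilon> > 0 \<Longrightarrow> \<exists>N. \<forall>m\<ge>N. \<forall>n\<ge>N. ip_norm V (\<sigma> m \<ominus> \<sigma> n) < \<epsilon>\<rbrakk> \<Longrightarrow>
        \<exists>x\<in>C. (\<lambda>n. ip_norm V (\<sigma> n \<ominus> x)) \<longlonglongrightarrow> 0"
  using assms unfolding closed_subspace_def by blast+

lemma minus_as_smult: "\<lbrakk>x \<in> carrier V; y \<in> carrier V\<rbrakk> \<Longrightarrow> x \<ominus> y = x \<oplus> (-1) \<odot> y"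
  by (intro ip_eqI) (auto simp: ip_simps)

lemma closed_subspace_diff: "\<lbrakk>closed_subspace C; x \<in> C; y \<in> C\<rbrakk> \<Longrightarrow> x \<ominus> y \<in> C"
  using closed_subspaceD(3)[of C x "(-1) \<odot> y"] closed_subspaceD(4)[of C y "-1"]
    closed_subspaceD(1)[of C x] closed_subspaceD(1)[of C y] by (simp add: minus_as_smult)

lemma closed_subspaceI:
  assumes sub: "submodule C complex_field V" and compl: "Metric_space.mcomplete C (ip_dist V)"
  shows "closed_subspace C"
  unfolding closed_subspace_def
proof (intro conjI allI impI ballI)
  note sm = submoduleE[OF sub]
  show C: "C \<subseteq> carrier V" by (rule sm(1))
  show add: "x \<oplus> y \<in> C" if "x \<in> C" "y \<in> C" for x y using sm(5) that by auto
  show smult: "a \<odot> x \<in> C" if "x \<in> C" for a x using sm(4) that by auto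
  obtain x0 where "x0 \<in> C" using sm(2) by auto
  then show "\<zero> \<in> C" using smult[of x0 0] smult_zero_left[of x0] C by auto
  interpret MS: Metric_space C "ip_dist V" using C by (rule Metric_space_ip_dist)
  have dist: "ip_dist V x y = ip_norm V (x \<ominus> y)" if "x \<in> C" "y \<in> C" for x y
    using that C by (auto simp: ip_dist_def)
  fix \<sigma> :: "nat \<Rightarrow> 'a"
  assume \<sigma>: "(\<forall>n. \<sigma> n \<in> C) \<and> (\<forall>\<epsilon>>0. \<exists>N. \<forall>m\<ge>N. \<forall>n\<ge>N. ip_norm V (\<sigma> m \<ominus> \<sigma> n) < \<epsilon>)"
  then have "MS.MCauchy \<sigma>"
    unfolding MS.MCauchy_def by (auto simp: dist)
  then obtain x where x: "limitin MS.mtopology \<sigma> x sequentially"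
    using compl unfolding MS.mcomplete_def by blast
  then have "x \<in> C" "(\<lambda>n. ip_dist V (\<sigma> n) x) \<longlonglongrightarrow> 0"
    by (auto simp: MS.limitin_metric_dist_null)
  then show "\<exists>x\<in>C. (\<lambda>n. ip_norm V (\<sigma> n \<ominus> x)) \<longlonglongrightarrow> 0"
    using \<sigma> by (auto simp: dist)
qed

text \<open>Moving \<open>y\<close> by \<open>t z\<close> with \<open>t = <x - y, z> / |z|^2\<close>
  lowers the squared distance by \<open>|<x - y, z>|^2 / |z|^2\<close>, which minimality forbids
  unless the inner product is zero.\<close>

lemma orthogonal_if_closest:
  assumes C: "closed_subspace C" and x: "x \<in> carrier V" and y: "y \<in> C" and z: "z \<in> C"
    and min: "\<And>w. w \<in> C \<Longrightarrow> ip_norm V (x \<ominus> y) \<le> ip_norm V (x \<ominus> w)"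
  shows "ip V (x \<ominus> y) z = 0"
proof (cases "z = \<zero>")
  case True
  then show ?thesis using assms closed_subspaceD by auto
next
  case False
  have car: "y \<in> carrier V" "z \<in> carrier V" using C y z closed_subspaceD by auto
  let ?b = "(ip_norm V z)\<^sup>2" and ?i = "ip V (x \<ominus> y) z"
  define t where "t = ?i / of_real ?b"
  have b: "?b > 0" using False car by (simp add: ip_norm_eq_zero)
  have "(ip_norm V (x \<ominus> y))\<^sup>2 \<le> (ip_norm V (x \<ominus> (y \<oplus> t \<odot> z)))\<^sup>2"
    by (rule power_mono[OF min]) (use car x y z C in \<open>auto intro: closed_subspaceD\<close>)
  also have "x \<ominus> (y \<oplus> t \<odot> z) = (x \<ominus> y) \<ominus> t \<odot> z"
    using car x by (intro ip_eqI) (auto simp: ip_simps)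
  also have "(ip_norm V ((x \<ominus> y) \<ominus> t \<odot> z))\<^sup>2
      = (ip_norm V (x \<ominus> y))\<^sup>2 - 2 * Re (cnj t * ?i) + (cmod t)\<^sup>2 * ?b"
    using car x by (subst ip_norm_diff_sq) (auto simp: ip_smult_right ip_norm_smult power_mult_distrib)
  also have "cnj t * ?i = of_real ((cmod ?i)\<^sup>2 / ?b)"
    unfolding t_def by (simp only: complex_cnj_divide complex_cnj_complex_of_real of_real_divide
        complex_norm_square times_divide_eq_left mult.commute[of "cnj _"])
  also have "(cmod t)\<^sup>2 * ?b = (cmod ?i)\<^sup>2 / ?b"
    using b unfolding t_def norm_divide norm_of_real power_divide
    by (simp add: field_simps power4_eq_xxxx power2_eq_square)
  finally have "(cmod ?i)\<^sup>2 / ?b \<le> 0" by simp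
  then show ?thesis using b by (simp add: divide_le_0_iff)
qed

text \<open>By two triangle inequalities the norms differ by at most the distance from
  \<open>\<sigma> n\<close> to \<open>x\<close>.\<close>

lemma tendsto_ip_norm_diff:
  assumes "\<And>n. \<sigma> n \<in> carrier V" "x \<in> carrier V" "z \<in> carrier V"
    and "(\<lambda>n. ip_norm V (\<sigma> n \<ominus> x)) \<longlonglongrightarrow> 0"
  shows "(\<lambda>n. ip_norm V (\<sigma> n \<ominus> z)) \<longlonglongrightarrow> ip_norm V (x \<ominus> z)"
proof (rule tendstoI)
  fix e :: real assume "e > 0"
  then have "\<forall>\<^sub>F n in sequentially. ip_norm V (\<sigma> n \<ominus> x) < e"
    using assms(4) by (auto dest!: order_tendstoD(2))
  then show "\<forall>\<^sub>F n in sequentially. dist (ip_norm V (\<sigma> n \<ominus> z)) (ip_norm V (x \<ominus> z)) < e"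
  proof eventually_elim
    case (elim n)
    then show ?case
      using ip_norm_diff_triangle[of "\<sigma> n" x z] ip_norm_diff_triangle[of x "\<sigma> n" z] assms
        ip_norm_minus_commute[of x "\<sigma> n"] by (auto simp: dist_real_def)
  qed
qed

text \<open>A minimizing sequence for the distance from \<open>x\<close> is Cauchy by the
  parallelogram law, since midpoints stay in \<open>C\<close> and so have distance at least the
  infimum \<open>d\<close>. Completeness of \<open>C\<close> supplies the limit, which is a closest
  point.\<close>

lemma projection_exists:
  assumes C: "closed_subspace C" and x: "x \<in> carrier V"
  shows "\<exists>y\<in>C. \<forall>z\<in>C. ip V (x \<ominus> y) z = 0"
proof -
  note [simp] = closed_subspaceD(1)[OF C]
  define d where "d = (INF y\<in>C. ip_norm V (x \<ominus> y))"
  have ne: "C \<noteq> {}" using closed_subspaceD(2)[OF C] by auto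
  have bdd: "bdd_below ((\<lambda>y. ip_norm V (x \<ominus> y)) ` C)"
    using x by (intro bdd_belowI[of _ 0]) auto
  have dle: "d \<le> ip_norm V (x \<ominus> y)" if "y \<in> C" for y
    unfolding d_def by (rule cINF_lower[OF bdd that])
  define e where "e n = inverse (real (Suc n))" for n
  have e: "e n > 0" "n \<ge> N \<Longrightarrow> e n \<le> e N" for n N by (auto simp: e_def field_simps)
  have d0: "0 \<le> d" unfolding d_def using ne x by (intro cINF_greatest) auto
  have "\<exists>y\<in>C. (ip_norm V (x \<ominus> y))\<^sup>2 < d\<^sup>2 + \<epsilon>" if "\<epsilon> > 0" for \<epsilon>
  proof -
    have "d < sqrt (d\<^sup>2 + \<epsilon>)" using that d0 by (intro real_less_rsqrt) auto
    then obtain y where y: "y \<in> C" "ip_norm V (x \<ominus> y) < sqrt (d\<^sup>2 + \<epsilon>)"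
      using cINF_less_iff[OF ne bdd] unfolding d_def by auto
    then have "(ip_norm V (x \<ominus> y))\<^sup>2 < (sqrt (d\<^sup>2 + \<epsilon>))\<^sup>2"
      using power_strict_mono[of "ip_norm V (x \<ominus> y)" _ 2] x by simp
    then show ?thesis using y that by auto
  qed
  then have "\<exists>y\<in>C. (ip_norm V (x \<ominus> y))\<^sup>2 < d\<^sup>2 + e n" for n using e by simp
  then obtain \<sigma> where \<sigma>: "\<And>n. \<sigma> n \<in> C"
    and \<sigma>d: "\<And>n. (ip_norm V (x \<ominus> \<sigma> n))\<^sup>2 < d\<^sup>2 + e n" by metis
  have \<sigma>car [simp]: "\<sigma> n \<in> carrier V" for n using \<sigma> by simp
  have par: "(ip_norm V (\<sigma> m \<ominus> \<sigma> n))\<^sup>2 \<le> 2 * (e m + e n)" for m n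
  proof -
    let ?w = "(1/2) \<odot> (\<sigma> m \<oplus> \<sigma> n)"
    have "(ip_norm V (\<sigma> m \<ominus> \<sigma> n))\<^sup>2
      = 2 * (ip_norm V (x \<ominus> \<sigma> m))\<^sup>2 + 2 * (ip_norm V (x \<ominus> \<sigma> n))\<^sup>2 - 4 * (ip_norm V (x \<ominus> ?w))\<^sup>2"
      using x by (simp add: ip_norm_sq ip_simps algebra_simps)
    moreover have "d\<^sup>2 \<le> (ip_norm V (x \<ominus> ?w))\<^sup>2"
      using \<sigma> C d0 by (intro power_mono[OF dle] closed_subspaceD) auto
    ultimately show ?thesis using \<sigma>d[of m] \<sigma>d[of n] unfolding distrib_left by linarith
  qed
  have "\<exists>y\<in>C. (\<lambda>n. ip_norm V (\<sigma> n \<ominus> y)) \<longlonglongrightarrow> 0"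
  proof (rule closed_subspaceD(5)[OF C \<sigma>])
    fix \<epsilon> :: real assume "\<epsilon> > 0"
    \<comment> \<open>Beyond this threshold \<open>2 * (e m + e n)\<close> is at most
      \<open>4 * e N\<close>, which is below \<open>\<epsilon>\<^sup>2\<close>.\<close>
    then obtain N where N: "e N < \<epsilon>\<^sup>2 / 4"
      using reals_Archimedean[of "\<epsilon>\<^sup>2 / 4"] unfolding e_def by auto
    have "ip_norm V (\<sigma> m \<ominus> \<sigma> n) < \<epsilon>" if "m \<ge> N" "n \<ge> N" for m n
    proof -
      have "(ip_norm V (\<sigma> m \<ominus> \<sigma> n))\<^sup>2 < \<epsilon>\<^sup>2"
        using par[of m n] N e(2)[OF that(1)] e(2)[OF that(2)] unfolding distrib_left by linarith
      then show ?thesis using \<open>\<epsilon> > 0\<close> by (meson less_imp_le power_less_imp_less_base)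
    qed
    then show "\<exists>N. \<forall>m\<ge>N. \<forall>n\<ge>N. ip_norm V (\<sigma> m \<ominus> \<sigma> n) < \<epsilon>" by blast
  qed
  then obtain y where y: "y \<in> C" "(\<lambda>n. ip_norm V (\<sigma> n \<ominus> y)) \<longlonglongrightarrow> 0" by blast
  have "(\<lambda>n. (ip_norm V (\<sigma> n \<ominus> x))\<^sup>2) \<longlonglongrightarrow> (ip_norm V (y \<ominus> x))\<^sup>2"
    using y x by (intro tendsto_power tendsto_ip_norm_diff) auto
  moreover have "(\<lambda>n. d\<^sup>2 + e n) \<longlonglongrightarrow> d\<^sup>2 + 0"
    unfolding e_def by (intro tendsto_intros LIMSEQ_inverse_real_of_nat)
  ultimately have "(ip_norm V (y \<ominus> x))\<^sup>2 \<le> d\<^sup>2 + 0"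
    by (rule LIMSEQ_le) (use \<sigma>d x in \<open>auto simp: ip_norm_minus_commute[of _ x] less_imp_le\<close>)
  then have "ip_norm V (x \<ominus> y) \<le> d"
    by (intro power2_le_imp_le[OF _ d0]) (use x y in \<open>auto simp: ip_norm_minus_commute\<close>)
  then have "ip V (x \<ominus> y) z = 0" if "z \<in> C" for z
    using y that dle by (intro orthogonal_if_closest[OF C x]) (auto intro: order_trans)
  then show ?thesis using y by blast
qed

definition orth_proj :: "'a set \<Rightarrow> 'a \<Rightarrow> 'a" where
  "orth_proj C x = (SOME y. y \<in> C \<and> (\<forall>z\<in>C. ip V (x \<ominus> y) z = 0))"

lemma orth_proj:
  assumes "closed_subspace C" "x \<in> carrier V"
  shows orth_proj_in: "orth_proj C x \<in> C"
    and orth_proj_orth: "z \<in> C \<Longrightarrow> ip V (x \<ominus> orth_proj C x) z = 0"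
proof -
  have "orth_proj C x \<in> C \<and> (\<forall>z\<in>C. ip V (x \<ominus> orth_proj C x) z = 0)"
    unfolding orth_proj_def using someI_ex projection_exists[OF assms] by (smt (verit, best))
  then show "orth_proj C x \<in> C" "z \<in> C \<Longrightarrow> ip V (x \<ominus> orth_proj C x) z = 0" by auto
qed

section \<open>Norm convergence and closures\<close>

definition converges :: "(nat \<Rightarrow> 'a) \<Rightarrow> 'a \<Rightarrow> bool" where
  "converges \<sigma> x \<longleftrightarrow> (\<lambda>n. ip_norm V (\<sigma> n \<ominus> x)) \<longlonglongrightarrow> 0"

lemma converges_const: "x \<in> carrier V \<Longrightarrow> converges (\<lambda>_. x) x"
  by (simp add: converges_def diff_eq_zero_iff[THEN iffD2])

text \<open>The scalars vary as well, because arbitrary coefficients are later obtained as limits of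
  coefficients from a countable dense set.\<close>

lemma converges_lincomb:
  assumes car: "\<And>n. \<sigma> n \<in> carrier V" "\<And>n. \<tau> n \<in> carrier V" "x \<in> carrier V" "y \<in> carrier V"
    and lim: "converges \<sigma> x" "converges \<tau> y" "q \<longlonglongrightarrow> a"
  shows "converges (\<lambda>n. q n \<odot> \<sigma> n \<oplus> \<tau> n) (a \<odot> x \<oplus> y)"
  unfolding converges_def
proof (rule real_tendsto_sandwich[where f = "\<lambda>_. 0"])
  have "ip_norm V ((q n \<odot> \<sigma> n \<oplus> \<tau> n) \<ominus> (a \<odot> x \<oplus> y))
      \<le> cmod (q n) * ip_norm V (\<sigma> n \<ominus> x) + cmod (q n - a) * ip_norm V x + ip_norm V (\<tau> n \<ominus> y)" for n
  proof -
    have "(q n \<odot> \<sigma> n \<oplus> \<tau> n) \<ominus> (a \<odot> x \<oplus> y) = (q n \<odot> (\<sigma> n \<ominus> x) \<oplus> (q n - a) \<odot> x) \<oplus> (\<tau> n \<ominus> y)"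
      using car by (intro ip_eqI) (auto simp: ip_simps algebra_simps)
    then show ?thesis
      using car ip_norm_triangle[of "q n \<odot> (\<sigma> n \<ominus> x) \<oplus> (q n - a) \<odot> x" "\<tau> n \<ominus> y"]
        ip_norm_triangle[of "q n \<odot> (\<sigma> n \<ominus> x)" "(q n - a) \<odot> x"]
      by (simp add: ip_norm_smult)
  qed
  then show "\<forall>\<^sub>F n in sequentially. ip_norm V ((q n \<odot> \<sigma> n \<oplus> \<tau> n) \<ominus> (a \<odot> x \<oplus> y))
      \<le> cmod (q n) * ip_norm V (\<sigma> n \<ominus> x) + cmod (q n - a) * ip_norm V x + ip_norm V (\<tau> n \<ominus> y)"
    by simp
  have "(\<lambda>n. cmod (q n) * ip_norm V (\<sigma> n \<ominus> x) + cmod (q n - a) * ip_norm V x + ip_norm V (\<tau> n \<ominus> y))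
     \<longlonglongrightarrow> cmod a * 0 + cmod (a - a) * ip_norm V x + 0"
    using lim unfolding converges_def by (intro tendsto_intros)
  then show "(\<lambda>n. cmod (q n) * ip_norm V (\<sigma> n \<ominus> x) + cmod (q n - a) * ip_norm V x + ip_norm V (\<tau> n \<ominus> y))
     \<longlonglongrightarrow> 0" by simp
qed (use car in auto)

lemma converges_diff:
  assumes "\<And>n. \<sigma> n \<in> carrier V" "\<And>n. \<tau> n \<in> carrier V" "x \<in> carrier V" "y \<in> carrier V"
    and "converges \<sigma> x" "converges \<tau> y"
  shows "converges (\<lambda>n. \<sigma> n \<ominus> \<tau> n) (x \<ominus> y)"
proof -
  have "u \<ominus> v = (-1) \<odot> v \<oplus> u" if "u \<in> carrier V" "v \<in> carrier V" for u v
    using that by (intro ip_eqI) (auto simp: ip_simps)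
  then show ?thesis
    using converges_lincomb[of \<tau> \<sigma> y x "\<lambda>_. -1" "-1"] assms by simp
qed

lemma converges_norm:
  assumes "\<And>n. \<sigma> n \<in> carrier V" "x \<in> carrier V" "converges \<sigma> x"
  shows "(\<lambda>n. ip_norm V (\<sigma> n)) \<longlonglongrightarrow> ip_norm V x"
proof -
  have "u \<ominus> \<zero> = u" if "u \<in> carrier V" for u
    using that by (intro ip_eqI) (auto simp: ip_simps)
  then show ?thesis using tendsto_ip_norm_diff[of \<sigma> x \<zero>] assms by (simp add: converges_def)
qed

lemma converges_unique:
  assumes "\<And>n. \<sigma> n \<in> carrier V" "x \<in> carrier V" "y \<in> carrier V" "converges \<sigma> x" "converges \<sigma> y"
  shows "x = y"
proof -
  have "(\<lambda>n. ip_norm V (\<sigma> n \<ominus> \<sigma> n)) \<longlonglongrightarrow> ip_norm V (x \<ominus> y)"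
    using assms by (intro converges_norm converges_diff) auto
  moreover have "ip_norm V (\<sigma> n \<ominus> \<sigma> n) = 0" for n
    using assms(1)[of n] by (simp add: diff_eq_zero_iff[THEN iffD2])
  ultimately have "ip_norm V (x \<ominus> y) = 0" by (simp add: LIMSEQ_const_iff)
  then show ?thesis using assms by (simp add: ip_norm_eq_zero diff_eq_zero_iff)
qed

lemma converges_Cauchy:
  assumes car: "\<And>n. \<sigma> n \<in> carrier V" "x \<in> carrier V" and lim: "converges \<sigma> x" and "\<epsilon> > 0"
  shows "\<exists>N. \<forall>m\<ge>N. \<forall>n\<ge>N. ip_norm V (\<sigma> m \<ominus> \<sigma> n) < \<epsilon>"
proof -
  have "\<forall>\<^sub>F n in sequentially. ip_norm V (\<sigma> n \<ominus> x) < \<epsilon> / 2"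
    using lim \<open>\<epsilon> > 0\<close> unfolding converges_def by (intro order_tendstoD(2)) auto
  then obtain N where N: "\<And>n. n \<ge> N \<Longrightarrow> ip_norm V (\<sigma> n \<ominus> x) < \<epsilon> / 2"
    by (auto simp: eventually_sequentially)
  have "ip_norm V (\<sigma> m \<ominus> \<sigma> n) < \<epsilon>" if "m \<ge> N" "n \<ge> N" for m n
    using ip_norm_diff_triangle[of "\<sigma> m" x "\<sigma> n"] N[OF that(1)] N[OF that(2)] car
      ip_norm_minus_commute[of x "\<sigma> n"] by simp
  then show ?thesis by blast
qed

definition adherence :: "'a set \<Rightarrow> 'a set" where
  "adherence A = {x \<in> carrier V. \<forall>\<epsilon>>0. \<exists>y\<in>A. ip_norm V (x \<ominus> y) < \<epsilon>}"

lemma adherence_seq: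
  assumes "x \<in> adherence A" "A \<subseteq> carrier V"
  obtains \<sigma> where "\<And>n. \<sigma> n \<in> A" "converges \<sigma> x"
proof -
  have "\<exists>y\<in>A. ip_norm V (x \<ominus> y) < inverse (real (Suc n))" for n
    using assms unfolding adherence_def by simp
  then obtain \<sigma> where \<sigma>: "\<And>n. \<sigma> n \<in> A" "\<And>n. ip_norm V (x \<ominus> \<sigma> n) < inverse (real (Suc n))"
    by metis
  have "converges \<sigma> x" unfolding converges_def
  proof (rule real_tendsto_sandwich[OF _ _ tendsto_const LIMSEQ_inverse_real_of_nat])
    show "\<forall>\<^sub>F n in sequentially. 0 \<le> ip_norm V (\<sigma> n \<ominus> x)"
      using \<sigma> assms by (auto simp: adherence_def subset_iff)
    have "ip_norm V (\<sigma> n \<ominus> x) = ip_norm V (x \<ominus> \<sigma> n)" for n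
      using \<sigma>(1)[of n] assms by (intro ip_norm_minus_commute) (auto simp: adherence_def)
    then show "\<forall>\<^sub>F n in sequentially. ip_norm V (\<sigma> n \<ominus> x) \<le> inverse (real (Suc n))"
      using \<sigma> by (auto simp: less_imp_le)
  qed
  then show thesis using that \<sigma> by blast
qed

lemma converges_adherence:
  assumes "\<And>n. \<sigma> n \<in> A" "A \<subseteq> carrier V" "x \<in> carrier V" "converges \<sigma> x"
  shows "x \<in> adherence A"
  unfolding adherence_def
proof (intro CollectI conjI allI impI)
  fix \<epsilon> :: real assume "\<epsilon> > 0"
  then have "\<forall>\<^sub>F n in sequentially. ip_norm V (\<sigma> n \<ominus> x) < \<epsilon>"
    using assms unfolding converges_def by (intro order_tendstoD(2)) auto
  then obtain n where "ip_norm V (\<sigma> n \<ominus> x) < \<epsilon>"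
    using eventually_happens by fastforce
  then show "\<exists>y\<in>A. ip_norm V (x \<ominus> y) < \<epsilon>"
    using assms(1)[of n] assms by (auto simp: ip_norm_minus_commute[of x] subset_iff)
qed (use assms in auto)

lemma adherence_superset: "A \<subseteq> carrier V \<Longrightarrow> A \<subseteq> adherence A"
  using converges_adherence[of "\<lambda>_. x" A x for x] converges_const by blast

lemma adherence_idem:
  assumes "A \<subseteq> carrier V"
  shows "adherence (adherence A) \<subseteq> adherence A"
proof
  fix x assume x: "x \<in> adherence (adherence A)"
  have "\<exists>z\<in>A. ip_norm V (x \<ominus> z) < \<epsilon>" if "\<epsilon> > 0" for \<epsilon>
  proof -
    obtain y where y: "y \<in> adherence A" "ip_norm V (x \<ominus> y) < \<epsilon> / 2"
      using x half_gt_zero[OF \<open>\<epsilon> > 0\<close>] unfolding adherence_def[of "adherence A"] by blast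
    obtain z where z: "z \<in> A" "ip_norm V (y \<ominus> z) < \<epsilon> / 2"
      using y(1) half_gt_zero[OF \<open>\<epsilon> > 0\<close>] unfolding adherence_def by blast
    have "ip_norm V (x \<ominus> z) < \<epsilon>"
      using ip_norm_diff_triangle[of x y z] x y z assms by (auto simp: adherence_def)
    then show ?thesis using z by blast
  qed
  then show "x \<in> adherence A" using x by (auto simp: adherence_def)
qed

text \<open>A sequence in \<open>A\<close> that converges in the whole space is Cauchy, so it also
  has a limit in the complete \<open>H\<close>; the two limits coincide.\<close>

lemma closed_subspace_adherence:
  assumes H: "closed_subspace H" and A: "A \<subseteq> H"
  shows "adherence A \<subseteq> H"
proof
  fix x assume x: "x \<in> adherence A"
  have AV: "A \<subseteq> carrier V" using H A closed_subspaceD(1) by blast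
  obtain \<sigma> where \<sigma>: "\<And>n. \<sigma> n \<in> A" "converges \<sigma> x" using adherence_seq[OF x AV] by blast
  have xV: "x \<in> carrier V" using x by (simp add: adherence_def)
  have "\<exists>y\<in>H. converges \<sigma> y"
    unfolding converges_def
    by (rule closed_subspaceD(5)[OF H]) (use \<sigma> A AV xV in \<open>auto intro!: converges_Cauchy\<close>)
  then obtain y where "y \<in> H" "converges \<sigma> y" by blast
  then have "x = y"
    using \<sigma> xV AV closed_subspaceD(1)[OF H] by (intro converges_unique[of \<sigma>]) auto
  then show "x \<in> H" using \<open>y \<in> H\<close> by simp
qed

lemma dense_seq:
  fixes Q :: "complex set"
  assumes "closure Q = UNIV"
  obtains q where "\<And>n. q n \<in> Q" "q \<longlonglongrightarrow> a"
  using assms closure_sequential[of a Q] by auto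

text \<open>The adherence is a complete subspace, so a vector of \<open>H\<close> minus its
  projection onto it lies in \<open>H\<close> and is orthogonal to \<open>A\<close>, hence vanishes.
  Linearity is asked only for scalars in a dense \<open>Q\<close>, and only up to adherence, so that
  for countable \<open>Q\<close> and \<open>A\<close> the hypotheses can be secured outside one null
  set.\<close>

lemma adherence_eq_if_orth_trivial:
  assumes H: "closed_subspace H" and A: "A \<subseteq> H" and ne: "A \<noteq> {}" and Q: "closure Q = UNIV"
    and lin: "\<And>q x y. \<lbrakk>q \<in> Q; x \<in> A; y \<in> A\<rbrakk> \<Longrightarrow> q \<odot> x \<oplus> y \<in> adherence A"
    and triv: "\<And>x. \<lbrakk>x \<in> H; \<forall>y\<in>A. ip V y x = 0\<rbrakk> \<Longrightarrow> x = \<zero>"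
  shows "adherence A = H"
proof -
  note HV = closed_subspaceD(1)[OF H]
  have AV: "A \<subseteq> carrier V" using A HV by blast
  have sub: "adherence A \<subseteq> H" by (rule closed_subspace_adherence[OF H A])
  have car: "adherence A \<subseteq> carrier V" by (auto simp: adherence_def)
  have comb: "a \<odot> x \<oplus> y \<in> adherence A" if xy: "x \<in> adherence A" "y \<in> adherence A" for a x y
  proof -
    obtain \<sigma> \<tau> where \<sigma>: "\<And>n. \<sigma> n \<in> A" "converges \<sigma> x" and \<tau>: "\<And>n. \<tau> n \<in> A" "converges \<tau> y"
      using adherence_seq xy AV by metis
    obtain q where q: "\<And>n. q n \<in> Q" "q \<longlonglongrightarrow> a" using dense_seq[OF Q] by blast
    have [simp]: "\<sigma> n \<in> carrier V" "\<tau> n \<in> carrier V" "x \<in> carrier V" "y \<in> carrier V" for n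
      using \<sigma> \<tau> AV xy car by auto
    \<comment> \<open>The approximating combinations lie only in the adherence, so their limit lies
      in the adherence of the adherence.\<close>
    have "a \<odot> x \<oplus> y \<in> adherence (adherence A)"
      by (rule converges_adherence[OF _ car _ converges_lincomb[of \<sigma> \<tau> x y q]])
        (use \<sigma> \<tau> q lin in auto)
    then show ?thesis using adherence_idem[OF AV] by blast
  qed
  obtain x0 where x0: "x0 \<in> adherence A" using ne adherence_superset[OF AV] by blast
  have zero: "\<zero> \<in> adherence A"
  proof -
    have "\<zero> = (-1) \<odot> x0 \<oplus> x0" using subsetD[OF car x0] by (intro ip_eqI) (auto simp: ip_simps)
    then show ?thesis using comb[OF x0 x0, of "-1"] by simp
  qed
  have "closed_subspace (adherence A)"
    unfolding closed_subspace_def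
  proof (intro conjI ballI allI impI)
    show "x \<oplus> y \<in> adherence A" if "x \<in> adherence A" "y \<in> adherence A" for x y
    proof -
      have "x \<oplus> y = 1 \<odot> x \<oplus> y" using subsetD[OF car that(1)] subsetD[OF car that(2)] by (intro ip_eqI) (auto simp: ip_simps)
      then show ?thesis using comb[OF that, of 1] by simp
    qed
    show "a \<odot> x \<in> adherence A" if "x \<in> adherence A" for a x
    proof -
      have "a \<odot> x = a \<odot> x \<oplus> \<zero>" using subsetD[OF car that] by (intro ip_eqI) (auto simp: ip_simps)
      then show ?thesis using comb[OF that zero, of a] by simp
    qed
    fix \<sigma> :: "nat \<Rightarrow> 'a"
    assume \<sigma>: "(\<forall>n. \<sigma> n \<in> adherence A) \<and>
      (\<forall>\<epsilon>>0. \<exists>N. \<forall>m\<ge>N. \<forall>n\<ge>N. ip_norm V (\<sigma> m \<ominus> \<sigma> n) < \<epsilon>)"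
    then obtain x where x: "x \<in> H" "converges \<sigma> x"
      using closed_subspaceD(5)[OF H, of \<sigma>] sub unfolding converges_def by blast
    then have "x \<in> adherence (adherence A)"
      using \<sigma> car HV by (intro converges_adherence[of \<sigma> "adherence A"]) auto
    then show "\<exists>x\<in>adherence A. (\<lambda>n. ip_norm V (\<sigma> n \<ominus> x)) \<longlonglongrightarrow> 0"
      using x adherence_idem[OF AV] unfolding converges_def by blast
  qed (use car zero in auto)
  note C = this
  have "x \<in> adherence A" if "x \<in> H" for x
  proof -
    let ?y = "orth_proj (adherence A) x"
    have xV: "x \<in> carrier V" using that HV by simp
    have y: "?y \<in> adherence A" by (rule orth_proj_in[OF C xV])
    then have yV: "?y \<in> carrier V" using car by blast
    have "x \<ominus> ?y = \<zero>"
    proof (rule triv)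
      show "x \<ominus> ?y \<in> H" using that y sub closed_subspace_diff[OF H] by blast
      show "\<forall>z\<in>A. ip V z (x \<ominus> ?y) = 0"
      proof
        fix z assume z: "z \<in> A"
        then have "ip V (x \<ominus> ?y) z = 0"
          using orth_proj_orth[OF C xV] adherence_superset[OF AV] by blast
        then show "ip V z (x \<ominus> ?y) = 0"
          using ip_commute[of "x \<ominus> ?y" z] z AV xV yV by auto
      qed
    qed
    then show ?thesis using y xV yV by (simp add: diff_eq_zero_iff)
  qed
  then show ?thesis using sub by blast
qed

section \<open>Bounded operators and their extension from dense sets\<close>

definition bounded_op :: "'a set \<Rightarrow> ('a \<Rightarrow> 'a) \<Rightarrow> real \<Rightarrow> bool" where
  "bounded_op H L c \<longleftrightarrow> (\<forall>x\<in>H. L x \<in> H) \<and>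
     (\<forall>a. \<forall>x\<in>H. \<forall>y\<in>H. L (a \<odot> x \<oplus> y) = a \<odot> L x \<oplus> L y) \<and>
     (\<forall>x\<in>H. ip_norm V (L x) \<le> c * ip_norm V x)"

lemma bounded_op_diff:
  assumes H: "closed_subspace H" and L: "bounded_op H L c" and xy: "x \<in> H" "y \<in> H"
  shows "L (x \<ominus> y) = L x \<ominus> L y"
proof -
  have *: "u \<ominus> v = (-1) \<odot> v \<oplus> u" if "u \<in> carrier V" "v \<in> carrier V" for u v
    using that by (intro ip_eqI) (auto simp: ip_simps)
  show ?thesis
    using L xy closed_subspaceD(1)[OF H] unfolding bounded_op_def by (auto simp: *)
qed

lemma bounded_op_converges:
  assumes H: "closed_subspace H" and L: "bounded_op H L c"
    and \<sigma>: "\<And>n. \<sigma> n \<in> H" and x: "x \<in> H" and lim: "converges \<sigma> x"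
  shows "converges (\<lambda>n. L (\<sigma> n)) (L x)"
  unfolding converges_def
proof (rule real_tendsto_sandwich[where f = "\<lambda>_. 0"])
  have "(\<lambda>n. c * ip_norm V (\<sigma> n \<ominus> x)) \<longlonglongrightarrow> c * 0"
    using lim unfolding converges_def by (intro tendsto_intros)
  then show "(\<lambda>n. c * ip_norm V (\<sigma> n \<ominus> x)) \<longlonglongrightarrow> 0" by simp
  have *: "L (\<sigma> n) \<ominus> L x = L (\<sigma> n \<ominus> x)" "\<sigma> n \<ominus> x \<in> H" for n
    using bounded_op_diff[OF H L \<sigma> x] closed_subspace_diff[OF H \<sigma> x] by auto
  then show "\<forall>\<^sub>F n in sequentially. ip_norm V (L (\<sigma> n) \<ominus> L x) \<le> c * ip_norm V (\<sigma> n \<ominus> x)"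
    using L unfolding bounded_op_def by simp
  show "\<forall>\<^sub>F n in sequentially. 0 \<le> ip_norm V (L (\<sigma> n) \<ominus> L x)"
    using * L closed_subspaceD(1)[OF H] unfolding bounded_op_def by simp
qed simp

text \<open>The single inequality \<open>bound\<close> carries everything: it survives passage to
  limits in all three vectors and the scalar, and special choices in the limit inequality
  \<open>main\<close> give linearity, the norm bound and the prescribed values. Indexing by
  \<open>I\<close> allows \<open>a\<close> to be non-injective.\<close>

lemma bounded_op_extension:
  assumes H: "closed_subspace H" and aH: "\<And>i. i \<in> I \<Longrightarrow> a i \<in> H" and bH: "\<And>i. i \<in> I \<Longrightarrow> b i \<in> H"
    and dense: "adherence (a ` I) = H" and Q: "closure Q = UNIV" "0 \<in> Q"
    and bound: "\<And>q i j k. \<lbrakk>q \<in> Q; i \<in> I; j \<in> I; k \<in> I\<rbrakk> \<Longrightarrow>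
       ip_norm V (b k \<ominus> (q \<odot> b i \<oplus> b j)) \<le> c * ip_norm V (a k \<ominus> (q \<odot> a i \<oplus> a j))"
  shows "\<exists>L. bounded_op H L c \<and> (\<forall>i\<in>I. L (a i) = b i)"
proof -
  note HV = closed_subspaceD(1)[OF H]
  note [simp] = HV[OF aH] HV[OF bH]
  \<comment> \<open>The closure of the graph formed by the pairs \<open>(a i, b i)\<close>;
    \<open>L\<close> will select one value over each point.\<close>
  define G where "G x y \<longleftrightarrow> y \<in> H \<and> (\<exists>i. (\<forall>n. i n \<in> I) \<and> converges (\<lambda>n. a (i n)) x \<and> converges (\<lambda>n. b (i n)) y)"
    for x y
  have GI: "G (a i) (b i)" if "i \<in> I" for i
    unfolding G_def using that by (auto intro!: bH exI[of _ "\<lambda>_. i"] converges_const)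
  have main: "ip_norm V (z' \<ominus> (\<alpha> \<odot> x' \<oplus> y')) \<le> c * ip_norm V (z \<ominus> (\<alpha> \<odot> x \<oplus> y))"
    if G: "G x x'" "G y y'" "G z z'" and xyz: "x \<in> H" "y \<in> H" "z \<in> H" for \<alpha> x y z x' y' z'
  proof -
    obtain i j k where i: "\<And>n. i n \<in> I" "converges (\<lambda>n. a (i n)) x" "converges (\<lambda>n. b (i n)) x'"
      and j: "\<And>n. j n \<in> I" "converges (\<lambda>n. a (j n)) y" "converges (\<lambda>n. b (j n)) y'"
      and k: "\<And>n. k n \<in> I" "converges (\<lambda>n. a (k n)) z" "converges (\<lambda>n. b (k n)) z'"
      using G unfolding G_def by metis
    note [simp] = i(1) j(1) k(1)
    have [simp]: "x \<in> carrier V" "y \<in> carrier V" "z \<in> carrier V"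
      "x' \<in> carrier V" "y' \<in> carrier V" "z' \<in> carrier V"
      using xyz G HV unfolding G_def by auto
    obtain q where q: "\<And>n. q n \<in> Q" "q \<longlonglongrightarrow> \<alpha>" using dense_seq[OF Q(1)] by blast
    have "(\<lambda>n. ip_norm V (b (k n) \<ominus> (q n \<odot> b (i n) \<oplus> b (j n))))
        \<longlonglongrightarrow> ip_norm V (z' \<ominus> (\<alpha> \<odot> x' \<oplus> y'))"
      by (intro converges_norm converges_diff converges_lincomb) (use i j k q in auto)
    moreover have "(\<lambda>n. c * ip_norm V (a (k n) \<ominus> (q n \<odot> a (i n) \<oplus> a (j n))))
        \<longlonglongrightarrow> c * ip_norm V (z \<ominus> (\<alpha> \<odot> x \<oplus> y))"
      by (intro tendsto_mult[OF tendsto_const] converges_norm converges_diff converges_lincomb)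
        (use i j k q in auto)
    ultimately show ?thesis
      by (rule LIMSEQ_le) (use bound q in auto)
  qed
  \<comment> \<open>The scalar 0 turns the bound into a Lipschitz estimate, which sends Cauchy
    sequences of \<open>a\<close>-values to Cauchy sequences of \<open>b\<close>-values. This is why
    \<open>0 \<in> Q\<close> is assumed.\<close>
  have c0: "ip_norm V (b k \<ominus> b j) \<le> c * ip_norm V (a k \<ominus> a j)" if "j \<in> I" "k \<in> I" for j k
  proof -
    have "0 \<odot> u \<oplus> u = u" if "u \<in> carrier V" for u
      using that by (intro ip_eqI) (auto simp: ip_simps)
    then show ?thesis using bound[OF Q(2) that(1) that(1) that(2)] that by simp
  qed
  have ex: "\<exists>y. G x y" if x: "x \<in> H" for x
  proof -
    have h: "x \<in> adherence (a ` I)" "a ` I \<subseteq> carrier V" using x dense by auto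
    obtain \<sigma> where \<sigma>: "\<And>n. \<sigma> n \<in> a ` I" "converges \<sigma> x"
      using adherence_seq[OF h] by blast
    have "\<forall>n. \<exists>i. i \<in> I \<and> \<sigma> n = a i" using \<sigma>(1) by blast
    then obtain i where i: "\<And>n. i n \<in> I" "\<And>n. \<sigma> n = a (i n)" by metis
    then have "\<sigma> = (\<lambda>n. a (i n))" by blast
    then have lim: "converges (\<lambda>n. a (i n)) x" using \<sigma>(2) by simp
    note [simp] = i(1)
    have "\<exists>y\<in>H. (\<lambda>n. ip_norm V (b (i n) \<ominus> y)) \<longlonglongrightarrow> 0"
    proof (rule closed_subspaceD(5)[OF H])
      fix \<epsilon> :: real assume "\<epsilon> > 0"
      \<comment> \<open>There is no sign condition on \<open>c\<close>; this denominator is positive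
        in any case.\<close>
      then have "\<epsilon> / (\<bar>c\<bar> + 1) > 0" by simp
      from converges_Cauchy[OF _ _ lim this]
      obtain N where N: "\<And>m n. \<lbrakk>m \<ge> N; n \<ge> N\<rbrakk> \<Longrightarrow> ip_norm V (a (i m) \<ominus> a (i n)) < \<epsilon> / (\<bar>c\<bar> + 1)"
        using x HV by auto
      have "ip_norm V (b (i m) \<ominus> b (i n)) < \<epsilon>" if "m \<ge> N" "n \<ge> N" for m n
      proof -
        have "ip_norm V (b (i m) \<ominus> b (i n)) \<le> c * ip_norm V (a (i m) \<ominus> a (i n))"
          by (rule c0) auto
        also have "\<dots> \<le> (\<bar>c\<bar> + 1) * ip_norm V (a (i m) \<ominus> a (i n))"
          by (intro mult_right_mono) auto
        also have "\<dots> < \<epsilon>" using N[OF that] by (simp add: pos_less_divide_eq mult.commute)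
        finally show ?thesis .
      qed
      then show "\<exists>N. \<forall>m\<ge>N. \<forall>n\<ge>N. ip_norm V (b (i m) \<ominus> b (i n)) < \<epsilon>" by blast
    qed (use bH in auto)
    then show ?thesis unfolding G_def converges_def[symmetric] using i(1) lim by blast
  qed
  define L where "L x = (SOME y. G x y)" for x
  have GL: "G x (L x)" if "x \<in> H" for x
    unfolding L_def using ex[OF that] by (rule someI_ex)
  have LH: "L x \<in> H" if "x \<in> H" for x using GL[OF that] by (simp add: G_def)
  have zero_diff: "u = v" if "ip_norm V (u \<ominus> v) \<le> 0" "u \<in> carrier V" "v \<in> carrier V" for u v
    using that ip_norm_nonneg[of "u \<ominus> v"] ip_norm_eq_zero[of "u \<ominus> v"] diff_eq_zero_iff[of u v]
    by (simp add: order_antisym)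
  have self: "ip_norm V (u \<ominus> u) = 0" if "u \<in> carrier V" for u
    using that by (simp add: diff_eq_zero_iff[THEN iffD2])
  \<comment> \<open>With \<open>z = \<alpha> x + y\<close> the right-hand side of
    \<open>main\<close> vanishes.\<close>
  have lin: "L (\<alpha> \<odot> x \<oplus> y) = \<alpha> \<odot> L x \<oplus> L y" if "x \<in> H" "y \<in> H" for \<alpha> x y
  proof (rule zero_diff)
    have z: "\<alpha> \<odot> x \<oplus> y \<in> H" using that closed_subspaceD(3,4)[OF H] by blast
    show "ip_norm V (L (\<alpha> \<odot> x \<oplus> y) \<ominus> (\<alpha> \<odot> L x \<oplus> L y)) \<le> 0"
      using main[OF GL GL GL, OF that z that z, of \<alpha>] self[OF HV[OF z]] by simp
  qed (use that LH HV closed_subspaceD(3,4)[OF H] in auto)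
  have minus: "(-1) \<odot> u \<oplus> u = \<zero>" if "u \<in> carrier V" for u
    using that by (intro ip_eqI) (auto simp: ip_simps)
  have z: "\<zero> \<in> H" by (rule closed_subspaceD(2)[OF H])
  have L0: "L \<zero> = \<zero>"
    using lin[OF z z, of "-1"] minus HV[OF LH[OF z]] by simp
  \<comment> \<open>Here \<open>main\<close> is used with scalar 0 and \<open>y = 0\<close>, so that
    only \<open>z = x\<close> survives on both sides.\<close>
  have norm: "ip_norm V (L x) \<le> c * ip_norm V x" if "x \<in> H" for x
  proof -
    have eq: "u \<ominus> 0 \<odot> u = u" if "u \<in> carrier V" for u
      using that by (intro ip_eqI) (auto simp: ip_simps)
    show ?thesis
      using main[OF GL GL GL, OF that z that that z that, of 0]
      by (simp add: L0 eq HV[OF that] HV[OF LH[OF that]])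
  qed
  \<comment> \<open>Both \<open>L (a i)\<close> and \<open>b i\<close> lie over \<open>a i\<close>
    in the closed graph, and \<open>main\<close> with scalar 0 makes their distance zero.\<close>
  have "L (a i) = b i" if "i \<in> I" for i
  proof (rule zero_diff)
    have eq: "u \<ominus> (0 \<odot> u \<oplus> v) = u \<ominus> v" if "u \<in> carrier V" "v \<in> carrier V" for u v
      using that by (intro ip_eqI) (auto simp: ip_simps)
    show "ip_norm V (L (a i) \<ominus> b i) \<le> 0"
      using main[OF GL GI GL, OF aH that aH aH aH aH, OF that that that that, of 0] that
        HV[OF LH[OF aH[OF that]]] self by (simp add: eq)
  qed (use that HV[OF LH[OF aH[OF that]]] in auto)
  moreover have "bounded_op H L c"
    unfolding bounded_op_def using lin norm LH by blast
  ultimately show ?thesis by blast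
qed

text \<open>Both operators are continuous along sequences in \<open>H\<close> and coincide on a
  dense subset. This is what makes operators at different levels compatible.\<close>

lemma bounded_op_agree:
  assumes H: "closed_subspace H" "closed_subspace K" "H \<subseteq> K"
    and L: "bounded_op H L c" "bounded_op K M d"
    and A: "A \<subseteq> H" "adherence A = H" "\<And>x. x \<in> A \<Longrightarrow> L x = M x" and x: "x \<in> H"
  shows "L x = M x"
proof -
  note HV = closed_subspaceD(1)[OF H(1)]
  have AV: "A \<subseteq> carrier V" using A HV by blast
  obtain \<sigma> where \<sigma>: "\<And>n. \<sigma> n \<in> A" "converges \<sigma> x" using adherence_seq[of x A] A x AV by blast
  have 1: "converges (\<lambda>n. L (\<sigma> n)) (L x)"
    using \<sigma> A x by (intro bounded_op_converges[OF H(1) L(1)]) auto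
  have "converges (\<lambda>n. M (\<sigma> n)) (M x)"
    using \<sigma> A x H(3) by (intro bounded_op_converges[OF H(2) L(2)]) auto
  then have 2: "converges (\<lambda>n. L (\<sigma> n)) (M x)" using \<sigma> A(3) by simp
  have "L y \<in> carrier V" "M y \<in> carrier V" if "y \<in> H" for y
    using that L H(3) HV closed_subspaceD(1)[OF H(2)] unfolding bounded_op_def by blast+
  then show ?thesis using 1 2 x \<sigma> A by (intro converges_unique[OF _ _ _ 1 2]) auto
qed

text \<open>Multiplying \<open>x\<close> by the conjugate of \<open><x, y>\<close> makes the inner
  product real, so that \<open>Re_ip_le\<close> applies; the extra modulus then cancels.\<close>

lemma Cauchy_Schwarz:
  assumes "x \<in> carrier V" "y \<in> carrier V"
  shows "cmod (ip V x y) \<le> ip_norm V x * ip_norm V y"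
proof -
  let ?i = "ip V x y"
  have "cmod ?i * cmod ?i = Re (ip V (cnj ?i \<odot> x) y)"
    using assms by (simp add: ip_smult_left cmod_power2 flip: power2_eq_square)
  also have "\<dots> \<le> cmod ?i * (ip_norm V x * ip_norm V y)"
    using Re_ip_le[of "cnj ?i \<odot> x" y] assms by (simp add: ip_norm_smult mult.assoc)
  finally show ?thesis
    using assms by (cases "cmod ?i = 0") (auto simp: mult_le_cancel_left)
qed

lemma ip_eq_zero_limit:
  assumes car: "\<And>n. \<sigma> n \<in> carrier V" "x \<in> carrier V" "y \<in> carrier V"
    and lim: "converges \<sigma> x" and zero: "\<And>n. ip V (\<sigma> n) y = 0"
  shows "ip V x y = 0"
proof -
  have "cmod (ip V x y) \<le> ip_norm V (\<sigma> n \<ominus> x) * ip_norm V y" for n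
    using Cauchy_Schwarz[of "\<sigma> n \<ominus> x" y] car zero by (simp add: ip_diff_left)
  moreover have "(\<lambda>n. ip_norm V (\<sigma> n \<ominus> x) * ip_norm V y) \<longlonglongrightarrow> 0 * ip_norm V y"
    using lim unfolding converges_def by (intro tendsto_intros)
  ultimately have "cmod (ip V x y) \<le> 0 * ip_norm V y"
    by (intro LIMSEQ_le_const) auto
  then show ?thesis by simp
qed

lemma linear_if_lincomb:
  assumes L: "\<And>x. x \<in> carrier V \<Longrightarrow> L x \<in> carrier V"
    and lin: "\<And>a x y. \<lbrakk>x \<in> carrier V; y \<in> carrier V\<rbrakk> \<Longrightarrow> L (a \<odot> x \<oplus> y) = a \<odot> L x \<oplus> L y"
  shows "\<lbrakk>x \<in> carrier V; y \<in> carrier V\<rbrakk> \<Longrightarrow> L (x \<oplus> y) = L x \<oplus> L y"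
    and "x \<in> carrier V \<Longrightarrow> L (a \<odot> x) = a \<odot> L x"
proof -
  have one: "1 \<odot> u = u" if "u \<in> carrier V" for u
    using that by (intro ip_eqI) (auto simp: ip_simps)
  have minus: "(-1) \<odot> u \<oplus> u = \<zero>" if "u \<in> carrier V" for u
    using that by (intro ip_eqI) (auto simp: ip_simps)
  have L0: "L \<zero> = \<zero>" using lin[of \<zero> \<zero> "-1"] minus L by simp
  show "L (x \<oplus> y) = L x \<oplus> L y" if "x \<in> carrier V" "y \<in> carrier V"
    using lin[OF that, of 1] that L by (simp add: one)
  show "L (a \<odot> x) = a \<odot> L x" if "x \<in> carrier V"
    using lin[OF that M.zero_closed, of a] that L by (simp add: L0)
qed

lemma ip_eq_zero_adherence:
  assumes "x \<in> adherence A" "A \<subseteq> carrier V" "y \<in> carrier V" "\<And>a. a \<in> A \<Longrightarrow> ip V a y = 0"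
  shows "ip V x y = 0"
proof -
  obtain \<sigma> where \<sigma>: "\<And>n. \<sigma> n \<in> A" "converges \<sigma> x" using adherence_seq[OF assms(1,2)] by blast
  show ?thesis
  proof (rule ip_eq_zero_limit[OF _ _ assms(3) \<sigma>(2)])
    show "x \<in> carrier V" using assms(1) by (simp add: adherence_def)
    show "\<sigma> n \<in> carrier V" for n using \<sigma>(1)[of n] assms(2) by blast
    show "ip V (\<sigma> n) y = 0" for n using \<sigma>(1)[of n] assms(4) by blast
  qed
qed

end

section \<open>Completions and nets\<close>

text \<open>In a complete measure space, preimages that differ on a null set are measurable
  together. Thus a function on sections may be altered almost everywhere without a measurability
  check.\<close>

lemma borel_measurable_completion_AE_cong:
  assumes f: "f \<in> borel_measurable (completion M)" and eq: "AE x in M. f x = g x"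
  shows "g \<in> borel_measurable (completion M)"
proof (rule measurableI)
  fix S :: "'b set" assume S: "S \<in> sets borel"
  show "g -` S \<inter> space (completion M) \<in> sets (completion M)"
  proof (rule completion.in_sets_AE)
    show "f -` S \<inter> space (completion M) \<in> sets (completion M)"
      using f S by (rule measurable_sets)
    have "AE x in completion M. f x = g x" using eq by (simp add: AE_completion_iff)
    then show "AE x in completion M. x \<in> f -` S \<inter> space (completion M) \<longleftrightarrow>
        x \<in> g -` S \<inter> space (completion M)"
      by eventually_elim auto
  qed auto
qed auto

lemma integrable_completion_AE_cong:
  fixes f g :: "'a \<Rightarrow> 'b :: {banach, second_countable_topology}"
  assumes f: "integrable (completion M) f" and eq: "AE x in M. f x = g x"
  shows "integrable (completion M) g"
  using f borel_measurable_completion_AE_cong[OF borel_measurable_integrable[OF f] eq] eq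
  by (intro integrable_cong_AE_imp[OF f]) (auto simp: AE_completion_iff)

lemma completion_ex_borel_measurable_complex:
  fixes f :: "'a \<Rightarrow> complex"
  assumes f: "f \<in> borel_measurable (completion M)"
  shows "\<exists>g\<in>borel_measurable M. AE x in M. f x = g x"
proof -
  obtain g h where gh: "g \<in> borel_measurable M" "AE x in M. Re (f x) = g x"
    "h \<in> borel_measurable M" "AE x in M. Im (f x) = h x"
    using completion_ex_borel_measurable_real[of "\<lambda>x. Re (f x)" M]
      completion_ex_borel_measurable_real[of "\<lambda>x. Im (f x)" M] f by force
  from gh(2,4) have "AE x in M. f x = of_real (g x) + \<i> * of_real (h x)"
    by eventually_elim (auto simp: complex_eq_iff)
  moreover have "(\<lambda>x. of_real (g x) + \<i> * of_real (h x)) \<in> borel_measurable M"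
    using gh(1,3) by measurable
  ultimately show ?thesis by (rule bexI)
qed

text \<open>The detour through a \<open>M\<close>-measurable representative reduces restriction of
  the completion to restriction of \<open>M\<close> itself.\<close>

lemma integrable_completion_restrict_space:
  fixes f :: "'a \<Rightarrow> complex"
  assumes f: "integrable (completion M) f" and X: "X \<in> sets M"
  shows "integrable (completion (restrict_space M X)) f"
proof -
  obtain g where g: "g \<in> borel_measurable M" "AE x in M. f x = g x"
    using completion_ex_borel_measurable_complex[OF borel_measurable_integrable[OF f]] by blast
  have "integrable (completion M) g" using integrable_completion_AE_cong[OF f g(2)] .
  then have "integrable M g" using g(1) by (simp add: integrable_completion)
  then have "integrable (restrict_space M X) g"
    using X by (simp add: integrable_restrict_space integrable_mult_indicator)
  then have "integrable (completion (restrict_space M X)) g"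
    by (simp add: integrable_completion)
  moreover have "AE x in restrict_space M X. g x = f x"
    using g(2) X by (auto simp: AE_restrict_space_iff elim: eventually_mono)
  ultimately show ?thesis by (rule integrable_completion_AE_cong)
qed

text \<open>Test with the set where a measurable version of \<open>g\<close> is positive: there the
  integrand is nonnegative almost everywhere with nonpositive integral, so it vanishes almost
  everywhere.\<close>

lemma AE_nonpos_if_integrals_nonpos:
  fixes g :: "'a \<Rightarrow> real"
  assumes g: "integrable (completion M) g"
    and neg: "\<And>E. E \<in> sets M \<Longrightarrow> (\<integral>x. indicator E x * g x \<partial>completion M) \<le> 0"
  shows "AE x in M. g x \<le> 0"
proof -
  obtain h where h: "h \<in> borel_measurable M" "AE x in M. g x = h x"
    using completion_ex_borel_measurable_real[OF borel_measurable_integrable[OF g]] by blast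
  define E where "E = {x \<in> space M. h x > 0}"
  have E: "E \<in> sets M" unfolding E_def using h(1) by measurable
  have int: "integrable (completion M) (\<lambda>x. indicator E x * g x)"
    using integrable_mult_indicator[OF _ g, of E] E by simp
  have pos: "AE x in completion M. 0 \<le> indicator E x * g x"
    using h(2) by (auto simp: AE_completion_iff E_def indicator_def elim!: eventually_mono)
  have "(\<integral>x. indicator E x * g x \<partial>completion M) = 0"
    using neg[OF E] integral_nonneg_AE[OF pos] by linarith
  then have "AE x in completion M. indicator E x * g x = 0"
    using integral_nonneg_eq_0_iff_AE[OF int pos] by simp
  then have "AE x in M. indicator E x * g x = 0" by (simp add: AE_completion_iff)
  with h(2) AE_space show ?thesis
    by eventually_elim (auto simp: E_def indicator_def split: if_splits)
qed

text \<open>\<open>at_top\<close> is an infimum of principal filters of up-sets; directedness makes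
  these a filter base.\<close>

lemma eventually_at_top_directed:
  assumes "\<And>a b :: 'i :: order. \<exists>c. a \<le> c \<and> b \<le> c"
  shows "eventually P (at_top :: 'i filter) \<longleftrightarrow> (\<exists>k. \<forall>n\<ge>k. P n)"
proof -
  have "eventually P (at_top :: 'i filter) \<longleftrightarrow> (\<exists>k\<in>UNIV. eventually P (principal {k::'i..}))"
    unfolding at_top_def
  proof (rule eventually_INF_base)
    fix a b :: 'i
    obtain c where "a \<le> c" "b \<le> c" using assms by blast
    then show "\<exists>x\<in>UNIV. principal {x..} \<le> inf (principal {a..}) (principal {b..})"
      by (intro bexI[of _ c]) auto
  qed simp
  then show ?thesis by (simp add: eventually_principal Ball_def)
qed

section \<open>Sections of a local direct integral\<close>

locale local_direct_integral =
  fixes \<nu> :: "'i::order \<Rightarrow> 'x measure" and \<mu> :: "'x measure"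
    and \<D> :: "'x \<Rightarrow> 'v inner_space" and \<H> :: "'i \<Rightarrow> 'x \<Rightarrow> 'v set" and U :: "('x \<Rightarrow> 'v) set"
  assumes directed: "\<And>\<alpha> \<beta> :: 'i. \<exists>\<gamma>. \<alpha> \<le> \<gamma> \<and> \<beta> \<le> \<gamma>"
    and measures: "locally_standard_measure_space \<nu> \<mu>"
    and fibres: "\<And>p. p \<in> space \<mu> \<Longrightarrow> locally_hilbert_space (\<D> p) (\<lambda>\<alpha>. \<H> \<alpha> p)"
    and is_di: "is_direct_integral \<nu> \<mu> \<D> \<H> U"
begin

abbreviation X :: "'i \<Rightarrow> 'x set" where "X \<alpha> \<equiv> space (\<nu> \<alpha>)"

lemmas measures_unfolded =
  measures[unfolded locally_standard_measure_space_def standard_measure_space_def]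

section \<open>The levels as restrictions of the limit measure\<close>

lemma finite_\<nu>: "finite_measure (\<nu> \<alpha>)"
  using measures_unfolded[THEN conjunct1, rule_format, of \<alpha>] by simp

lemma
  assumes "\<alpha> \<le> \<beta>"
  shows X_mono: "X \<alpha> \<subseteq> X \<beta>"
    and sets_\<nu>_eq: "sets (\<nu> \<alpha>) = {E \<inter> X \<alpha> |E. E \<in> sets (\<nu> \<beta>)}"
    and sets_\<nu>_mono: "sets (\<nu> \<alpha>) \<subseteq> sets (\<nu> \<beta>)"
    and emeasure_\<nu>: "E \<in> sets (\<nu> \<alpha>) \<Longrightarrow> emeasure (\<nu> \<alpha>) E = emeasure (\<nu> \<beta>) E"
proof -
  note * = measures_unfolded[THEN conjunct2, THEN conjunct1, rule_format, OF assms]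
  show "X \<alpha> \<subseteq> X \<beta>" by (rule *[THEN conjunct1])
  show "sets (\<nu> \<alpha>) = {E \<inter> X \<alpha> |E. E \<in> sets (\<nu> \<beta>)}" by (rule *[THEN conjunct2, THEN conjunct1])
  show "sets (\<nu> \<alpha>) \<subseteq> sets (\<nu> \<beta>)" by (rule *[THEN conjunct2, THEN conjunct2, THEN conjunct1])
  show "E \<in> sets (\<nu> \<alpha>) \<Longrightarrow> emeasure (\<nu> \<alpha>) E = emeasure (\<nu> \<beta>) E"
    by (rule *[THEN conjunct2, THEN conjunct2, THEN conjunct2, rule_format])
qed

lemmas space_eq = measures_unfolded[THEN conjunct2, THEN conjunct2, THEN conjunct1]

lemmas sets_\<mu> = measures_unfolded[THEN conjunct2, THEN conjunct2, THEN conjunct2, THEN conjunct1]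

lemmas emeasure_\<mu> =
  measures_unfolded[THEN conjunct2, THEN conjunct2, THEN conjunct2, THEN conjunct2, rule_format]

lemma X_sub: "X \<alpha> \<subseteq> space \<mu>"
  using space_eq by blast

text \<open>For a given \<beta> pass to a common upper index \<gamma>: \<open>E\<close> is in the
  \<sigma>-algebra at \<gamma> by inclusion, and its trace on \<open>X \<beta>\<close> is then
  measurable at \<beta>.\<close>

lemma sets_\<nu>_sub: 
  assumes "E \<in> sets (\<nu> \<alpha>)"
  shows "E \<in> sets \<mu>"
proof -
  have "E \<inter> X \<beta> \<in> sets (\<nu> \<beta>)" for \<beta>
  proof -
    obtain \<gamma> where "\<alpha> \<le> \<gamma>" "\<beta> \<le> \<gamma>" using directed by blast
    then show ?thesis using assms sets_\<nu>_mono[of \<alpha> \<gamma>] sets_\<nu>_eq[of \<beta> \<gamma>] by blast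
  qed
  then show ?thesis using sets.sets_into_space[OF assms] X_sub by (auto simp: sets_\<mu>)
qed

lemma X_sets [measurable]: "X \<alpha> \<in> sets \<mu>"
  by (rule sets_\<nu>_sub[OF sets.top])

text \<open>From \<alpha> on, the net defining the measure of \<open>E\<close> is constant.\<close>

lemma emeasure_\<mu>_\<nu>:
  assumes "E \<in> sets (\<nu> \<alpha>)"
  shows "emeasure \<mu> E = emeasure (\<nu> \<alpha>) E"
proof -
  let ?m = "\<lambda>\<beta>. measure (\<nu> \<beta>) (E \<inter> X \<beta>)"
  have "?m \<beta> = measure (\<nu> \<alpha>) E" if "\<alpha> \<le> \<beta>" for \<beta>
  proof -
    have "E \<inter> X \<beta> = E" using sets.sets_into_space[OF assms] X_mono[OF that] by blast
    then show ?thesis using emeasure_\<nu>[OF that assms] by (simp add: measure_def)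
  qed
  then have "eventually (\<lambda>\<beta>. ?m \<beta> = measure (\<nu> \<alpha>) E) at_top"
    by (subst eventually_at_top_directed[OF directed]) blast
  then have lim: "(?m \<longlongrightarrow> measure (\<nu> \<alpha>) E) at_top" by (rule tendsto_eventually)
  \<comment> \<open>A proper filter is required for the limit to be unique, hence for
    \<open>Lim\<close> to have this value.\<close>
  have "(at_top :: 'i filter) \<noteq> bot"
    by (auto simp: trivial_limit_def eventually_at_top_directed[OF directed])
  then have "Lim at_top ?m = measure (\<nu> \<alpha>) E" using lim by (rule tendsto_Lim)
  then show ?thesis
    using emeasure_\<mu>[OF sets_\<nu>_sub[OF assms]] lim finite_measure.emeasure_eq_measure[OF finite_\<nu>]
    by (auto simp: Let_def)
qed

text \<open>Allows every almost-everywhere statement at a level to be made over \<mu>, so that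
  statements from different levels can be combined.\<close>

lemma \<nu>_eq_restrict: "\<nu> \<alpha> = restrict_space \<mu> (X \<alpha>)"
proof (rule measure_eqI)
  show eq: "sets (\<nu> \<alpha>) = sets (restrict_space \<mu> (X \<alpha>))"
  proof -
    have "E \<in> (\<inter>) (X \<alpha>) ` sets \<mu>" if "E \<in> sets (\<nu> \<alpha>)" for E
      using sets_\<nu>_sub[OF that] sets.sets_into_space[OF that] by (intro image_eqI[of _ _ E]) auto
    moreover have "X \<alpha> \<inter> E \<in> sets (\<nu> \<alpha>)" if "E \<in> sets \<mu>" for E
      using that by (simp add: sets_\<mu> Int_commute)
    ultimately show ?thesis by (auto simp: sets_restrict_space)
  qed
  show "emeasure (\<nu> \<alpha>) E = emeasure (restrict_space \<mu> (X \<alpha>)) E" if "E \<in> sets (\<nu> \<alpha>)" for E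
    using sets.sets_into_space[OF that] emeasure_\<mu>_\<nu>[OF that]
    by (simp add: emeasure_restrict_space)
qed

lemma AE_\<nu>_iff: "(AE p in \<nu> \<alpha>. P p) \<longleftrightarrow> (AE p in \<mu>. p \<in> X \<alpha> \<longrightarrow> P p)"
  by (subst \<nu>_eq_restrict) (simp add: AE_restrict_space_iff)

section \<open>Fibres and their inductive systems\<close>

lemma cips: "p \<in> space \<mu> \<Longrightarrow> complex_inner_product_space (\<D> p)"
  using fibres unfolding locally_hilbert_space_def by blast

lemma closed_subspace_\<H>:
  "p \<in> space \<mu> \<Longrightarrow> complex_inner_product_space.closed_subspace (\<D> p) (\<H> \<alpha> p)"
  using fibres[of p] complex_inner_product_space.closed_subspaceI[OF cips]
  unfolding locally_hilbert_space_def by blast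

lemma \<H>_mono: "\<lbrakk>p \<in> space \<mu>; \<alpha> \<le> \<beta>\<rbrakk> \<Longrightarrow> \<H> \<alpha> p \<subseteq> \<H> \<beta> p"
  using fibres[of p] unfolding locally_hilbert_space_def by presburger

lemma carrier_fibre: "p \<in> space \<mu> \<Longrightarrow> carrier (\<D> p) = (\<Union>\<alpha>. \<H> \<alpha> p)"
  using fibres[of p] unfolding locally_hilbert_space_def by presburger

lemma \<H>_sub: "p \<in> space \<mu> \<Longrightarrow> \<H> \<alpha> p \<subseteq> carrier (\<D> p)"
  using carrier_fibre by blast

lemma zero_\<H>: "p \<in> space \<mu> \<Longrightarrow> \<zero>\<^bsub>\<D> p\<^esub> \<in> \<H> \<alpha> p"
  using complex_inner_product_space.closed_subspaceD(2)[OF cips closed_subspace_\<H>] by blast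

lemma zero_carrier: "p \<in> space \<mu> \<Longrightarrow> \<zero>\<^bsub>\<D> p\<^esub> \<in> carrier (\<D> p)"
  using zero_\<H> \<H>_sub by blast

text \<open>The point \<open>p\<close> and the vector \<open>x\<close> may appear at different
  levels; directedness gives one level above both and above \<alpha>.\<close>

lemma cofinal:
  assumes "p \<in> space \<mu>" "x \<in> carrier (\<D> p)"
  obtains \<beta> where "\<alpha> \<le> \<beta>" "p \<in> X \<beta>" "x \<in> \<H> \<beta> p"
proof -
  obtain \<beta>1 \<beta>2 where "p \<in> X \<beta>1" "x \<in> \<H> \<beta>2 p" using assms space_eq carrier_fibre by blast
  moreover obtain \<gamma> \<delta> where "\<beta>1 \<le> \<gamma>" "\<beta>2 \<le> \<gamma>" "\<gamma> \<le> \<delta>" "\<alpha> \<le> \<delta>" using directed by metis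
  ultimately show thesis
    using that[of \<delta>] X_mono[of \<beta>1 \<delta>] \<H>_mono[OF assms(1), of \<beta>2 \<delta>] by (meson order_trans subsetD)
qed

section \<open>Sections that belong to the direct integral\<close>

lemmas is_di_unfolded = is_di[unfolded is_direct_integral_def]

lemmas U_local = is_di_unfolded[THEN conjunct1, THEN bspec]

lemma U_AE_cong: "\<lbrakk>u \<in> U; local_section \<nu> \<mu> \<D> \<H> v; AE p in \<mu>. v p = u p\<rbrakk> \<Longrightarrow> v \<in> U"
  using is_di_unfolded[THEN conjunct2, THEN conjunct1] by metis

lemmas U_integrable =
  is_di_unfolded[THEN conjunct2, THEN conjunct2, THEN conjunct1, THEN bspec, THEN bspec]

lemma U_complete:
  assumes "v \<in> (\<Pi>\<^sub>E p\<in>space \<mu>. carrier (\<D> p))" "\<And>q. q \<in> space \<mu> - X \<alpha> \<Longrightarrow> v q = \<zero>\<^bsub>\<D> q\<^esub>"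
    and "\<And>u. u \<in> U \<Longrightarrow> integrable (completion \<mu>) (\<lambda>p. ip (\<D> p) (u p) (v p))"
  shows "\<exists>w\<in>U. AE p in \<mu>. w p = v p"
  using is_di_unfolded[THEN conjunct2, THEN conjunct2, THEN conjunct2, THEN bspec, OF assms(1)]
    assms(2,3) by blast

lemma U_carrier: "\<lbrakk>u \<in> U; p \<in> space \<mu>\<rbrakk> \<Longrightarrow> u p \<in> carrier (\<D> p)"
  using U_local unfolding local_section_def by blast

lemma U_PiE: "u \<in> U \<Longrightarrow> u \<in> (\<Pi>\<^sub>E p\<in>space \<mu>. carrier (\<D> p))"
  using U_local unfolding local_section_def by blast

lemma U_eqI: "\<lbrakk>u \<in> U; v \<in> U; \<And>p. p \<in> space \<mu> \<Longrightarrow> u p = v p\<rbrakk> \<Longrightarrow> u = v"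
  using U_PiE by (metis PiE_ext)

text \<open>Maximality yields only a member of \<open>U\<close> equal to \<open>v\<close> almost
  everywhere; closure of \<open>U\<close> under changes on null sets then gives \<open>v\<close>
  itself.\<close>

lemma U_memberI:
  assumes v: "v \<in> (\<Pi>\<^sub>E p\<in>space \<mu>. carrier (\<D> p))" and supp: "supported_at_level \<nu> \<mu> \<D> \<H> \<alpha> v"
    and int: "\<And>u. u \<in> U \<Longrightarrow> integrable (completion \<mu>) (\<lambda>p. ip (\<D> p) (u p) (v p))"
  shows "v \<in> U"
proof -
  obtain w where "w \<in> U" "AE p in \<mu>. w p = v p"
    using U_complete[OF v _ int, of \<alpha>] supp unfolding supported_at_level_def by blast
  then show ?thesis
    using v supp by (intro U_AE_cong[of w v]) (auto simp: local_section_def eq_commute)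
qed

text \<open>On the points of \<open>X \<beta>\<close> outside \<open>X \<alpha>\<close> the section
  vanishes, and the zero vector lies in every subspace.\<close>

lemma supported_mono:
  assumes "supported_at_level \<nu> \<mu> \<D> \<H> \<alpha> u" "\<alpha> \<le> \<beta>"
  shows "supported_at_level \<nu> \<mu> \<D> \<H> \<beta> u"
proof -
  have "AE p in \<mu>. p \<in> X \<alpha> \<longrightarrow> u p \<in> \<H> \<alpha> p" and s: "{p \<in> space \<mu>. u p \<noteq> \<zero>\<^bsub>\<D> p\<^esub>} \<subseteq> X \<alpha>"
    using assms unfolding supported_at_level_def by auto
  from this(1) AE_space have "AE p in \<mu>. p \<in> X \<beta> \<longrightarrow> u p \<in> \<H> \<beta> p"
  proof eventually_elim
    case (elim p)
    then show ?case using s zero_\<H>[of p \<beta>] \<H>_mono[of p \<alpha> \<beta>] assms(2) by (cases "p \<in> X \<alpha>") auto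
  qed
  then show ?thesis using s X_mono[OF assms(2)] unfolding supported_at_level_def by blast
qed

lemma U_supported:
  assumes "u \<in> U"
  obtains \<beta> where "\<alpha> \<le> \<beta>" "supported_at_level \<nu> \<mu> \<D> \<H> \<beta> u"
proof -
  obtain \<gamma> where "supported_at_level \<nu> \<mu> \<D> \<H> \<gamma> u"
    using U_local[OF assms] unfolding local_section_def by blast
  moreover obtain \<beta> where "\<alpha> \<le> \<beta>" "\<gamma> \<le> \<beta>" using directed by blast
  ultimately show thesis using that supported_mono by blast
qed

section \<open>Pointwise operations on sections\<close>

definition lincomb :: "complex \<Rightarrow> ('x \<Rightarrow> 'v) \<Rightarrow> ('x \<Rightarrow> 'v) \<Rightarrow> 'x \<Rightarrow> 'v" where
  "lincomb a u v = (\<lambda>p\<in>space \<mu>. a \<odot>\<^bsub>\<D> p\<^esub> u p \<oplus>\<^bsub>\<D> p\<^esub> v p)"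

definition zero_section :: "'x \<Rightarrow> 'v" where
  "zero_section = (\<lambda>p\<in>space \<mu>. \<zero>\<^bsub>\<D> p\<^esub>)"

definition cut :: "'x set \<Rightarrow> ('x \<Rightarrow> 'v) \<Rightarrow> 'x \<Rightarrow> 'v" where
  "cut E u = (\<lambda>p\<in>space \<mu>. if p \<in> E then u p else \<zero>\<^bsub>\<D> p\<^esub>)"

lemma lincomb_apply: "p \<in> space \<mu> \<Longrightarrow> lincomb a u v p = a \<odot>\<^bsub>\<D> p\<^esub> u p \<oplus>\<^bsub>\<D> p\<^esub> v p"
  and zero_section_apply: "p \<in> space \<mu> \<Longrightarrow> zero_section p = \<zero>\<^bsub>\<D> p\<^esub>"
  and cut_apply: "p \<in> space \<mu> \<Longrightarrow> cut E u p = (if p \<in> E then u p else \<zero>\<^bsub>\<D> p\<^esub>)"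
  by (simp_all add: lincomb_def zero_section_def cut_def)

lemma fibre_lincomb:
  assumes "p \<in> space \<mu>"
  shows "\<lbrakk>x \<in> carrier (\<D> p); y \<in> carrier (\<D> p)\<rbrakk> \<Longrightarrow> a \<odot>\<^bsub>\<D> p\<^esub> x \<oplus>\<^bsub>\<D> p\<^esub> y \<in> carrier (\<D> p)"
    and "\<lbrakk>x \<in> \<H> \<alpha> p; y \<in> \<H> \<alpha> p\<rbrakk> \<Longrightarrow> a \<odot>\<^bsub>\<D> p\<^esub> x \<oplus>\<^bsub>\<D> p\<^esub> y \<in> \<H> \<alpha> p"
    and "a \<odot>\<^bsub>\<D> p\<^esub> \<zero>\<^bsub>\<D> p\<^esub> \<oplus>\<^bsub>\<D> p\<^esub> \<zero>\<^bsub>\<D> p\<^esub> = \<zero>\<^bsub>\<D> p\<^esub>"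
proof -
  interpret D: complex_inner_product_space "\<D> p" by (rule cips[OF assms])
  show "\<lbrakk>x \<in> carrier (\<D> p); y \<in> carrier (\<D> p)\<rbrakk> \<Longrightarrow> a \<odot>\<^bsub>\<D> p\<^esub> x \<oplus>\<^bsub>\<D> p\<^esub> y \<in> carrier (\<D> p)" by simp
  show "\<lbrakk>x \<in> \<H> \<alpha> p; y \<in> \<H> \<alpha> p\<rbrakk> \<Longrightarrow> a \<odot>\<^bsub>\<D> p\<^esub> x \<oplus>\<^bsub>\<D> p\<^esub> y \<in> \<H> \<alpha> p"
    using D.closed_subspaceD(3,4)[OF closed_subspace_\<H>[OF assms]] by simp
  show "a \<odot>\<^bsub>\<D> p\<^esub> \<zero>\<^bsub>\<D> p\<^esub> \<oplus>\<^bsub>\<D> p\<^esub> \<zero>\<^bsub>\<D> p\<^esub> = \<zero>\<^bsub>\<D> p\<^esub>"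
    by (intro D.ip_eqI) (auto simp: D.ip_simps)
qed

text \<open>Closure of \<open>U\<close> under linear operations is not part of its definition; it
  follows from maximality, since inner products with the combination are combinations of integrable
  functions. The scalar \<open>a = 1\<close> yields sums, and \<open>v = zero_section\<close> yields
  multiples.\<close>

lemma lincomb_U:
  assumes u: "u \<in> U" and v: "v \<in> U"
  shows "lincomb a u v \<in> U"
proof -
  obtain \<alpha>0 where u0: "supported_at_level \<nu> \<mu> \<D> \<H> \<alpha>0 u" using U_supported[OF u] by blast
  obtain \<alpha> where le: "\<alpha>0 \<le> \<alpha>" and v1: "supported_at_level \<nu> \<mu> \<D> \<H> \<alpha> v" using U_supported[OF v] by blast
  have u1: "supported_at_level \<nu> \<mu> \<D> \<H> \<alpha> u" by (rule supported_mono[OF u0 le])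
  show ?thesis
  proof (rule U_memberI)
    show "lincomb a u v \<in> (\<Pi>\<^sub>E p\<in>space \<mu>. carrier (\<D> p))"
      unfolding lincomb_def by (intro restrict_PiE_iff[THEN iffD2] ballI fibre_lincomb(1) U_carrier u v)
    have "AE p in \<mu>. p \<in> X \<alpha> \<longrightarrow> u p \<in> \<H> \<alpha> p" "AE p in \<mu>. p \<in> X \<alpha> \<longrightarrow> v p \<in> \<H> \<alpha> p"
      using u1 v1 unfolding supported_at_level_def by auto
    with AE_space have "AE p in \<mu>. p \<in> X \<alpha> \<longrightarrow> lincomb a u v p \<in> \<H> \<alpha> p"
      by eventually_elim (auto simp: lincomb_apply intro: fibre_lincomb)
    moreover have "{p \<in> space \<mu>. lincomb a u v p \<noteq> \<zero>\<^bsub>\<D> p\<^esub>} \<subseteq> X \<alpha>"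
    proof clarify
      fix p assume p: "p \<in> space \<mu>" "lincomb a u v p \<noteq> \<zero>\<^bsub>\<D> p\<^esub>"
      then have "u p \<noteq> \<zero>\<^bsub>\<D> p\<^esub> \<or> v p \<noteq> \<zero>\<^bsub>\<D> p\<^esub>"
        using fibre_lincomb(3)[of p a] by (auto simp: lincomb_apply)
      then show "p \<in> X \<alpha>" using u1 v1 p(1) unfolding supported_at_level_def by blast
    qed
    ultimately show "supported_at_level \<nu> \<mu> \<D> \<H> \<alpha> (lincomb a u v)"
      unfolding supported_at_level_def by blast
    fix w assume w: "w \<in> U"
    have "ip (\<D> p) (w p) (lincomb a u v p) = cnj a * ip (\<D> p) (w p) (u p) + ip (\<D> p) (w p) (v p)"
      if p: "p \<in> space \<mu>" for p
    proof -
      interpret D: complex_inner_product_space "\<D> p" by (rule cips[OF p])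
      show ?thesis
        using U_carrier[OF u p] U_carrier[OF v p] U_carrier[OF w p]
        by (simp add: lincomb_apply p D.ip_simps)
    qed
    moreover have "integrable (completion \<mu>)
      (\<lambda>p. cnj a * ip (\<D> p) (w p) (u p) + ip (\<D> p) (w p) (v p))"
      using U_integrable[OF w u] U_integrable[OF w v] by simp
    ultimately show "integrable (completion \<mu>) (\<lambda>p. ip (\<D> p) (w p) (lincomb a u v p))"
      by (subst Bochner_Integration.integrable_cong[OF refl]) auto
  qed
qed

lemma zero_section_U: "zero_section \<in> U"
\<comment> \<open>Any level will do, since the support is empty.\<close>
proof (rule U_memberI[of _ undefined])
  show "zero_section \<in> (\<Pi>\<^sub>E p\<in>space \<mu>. carrier (\<D> p))"
    using zero_carrier unfolding zero_section_def restrict_PiE_iff by auto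
  show "supported_at_level \<nu> \<mu> \<D> \<H> undefined zero_section"
    using zero_\<H> X_sub by (auto simp: supported_at_level_def zero_section_apply)
  fix u assume u: "u \<in> U"
  have "ip (\<D> p) (u p) (zero_section p) = 0" if "p \<in> space \<mu>" for p
    using complex_inner_product_space.ip_zero_right[OF cips[OF that] U_carrier[OF u that]] that by (simp add: zero_section_apply)
  then show "integrable (completion \<mu>) (\<lambda>p. ip (\<D> p) (u p) (zero_section p))"
    by (subst Bochner_Integration.integrable_cong[OF refl, of _ _ "\<lambda>_. 0"]) auto
qed

lemma cut_supported:
  assumes "supported_at_level \<nu> \<mu> \<D> \<H> \<alpha> u"
  shows "supported_at_level \<nu> \<mu> \<D> \<H> \<alpha> (cut E u)"
proof -
  have "AE p in \<mu>. p \<in> X \<alpha> \<longrightarrow> u p \<in> \<H> \<alpha> p"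
    using assms unfolding supported_at_level_def by auto
  with AE_space have "AE p in \<mu>. p \<in> X \<alpha> \<longrightarrow> cut E u p \<in> \<H> \<alpha> p"
    by eventually_elim (auto simp: cut_apply zero_\<H>)
  moreover have "{p \<in> space \<mu>. cut E u p \<noteq> \<zero>\<^bsub>\<D> p\<^esub>} \<subseteq> {p \<in> space \<mu>. u p \<noteq> \<zero>\<^bsub>\<D> p\<^esub>}"
    by (auto simp: cut_apply split: if_splits)
  ultimately show ?thesis using assms unfolding supported_at_level_def by blast
qed

text \<open>Maximality again: cutting multiplies the inner product with any member of
  \<open>U\<close> by an indicator function.\<close>

lemma cut_U:
  assumes u: "u \<in> U" and E: "E \<in> sets \<mu>"
  shows "cut E u \<in> U"
proof -
  obtain \<alpha> where \<alpha>: "supported_at_level \<nu> \<mu> \<D> \<H> \<alpha> u" using U_supported[OF u] by blast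
  show ?thesis
  proof (rule U_memberI)
    show "cut E u \<in> (\<Pi>\<^sub>E p\<in>space \<mu>. carrier (\<D> p))"
      using U_carrier[OF u] zero_carrier unfolding cut_def restrict_PiE_iff by auto
    show "supported_at_level \<nu> \<mu> \<D> \<H> \<alpha> (cut E u)" by (rule cut_supported[OF \<alpha>])
    fix w assume w: "w \<in> U"
    have "ip (\<D> p) (w p) (cut E u p) = indicator E p *\<^sub>R ip (\<D> p) (w p) (u p)"
      if p: "p \<in> space \<mu>" for p
      using complex_inner_product_space.ip_zero_right[OF cips[OF p] U_carrier[OF w p]] p
      by (simp add: cut_apply)
    moreover have "integrable (completion \<mu>) (\<lambda>p. indicator E p *\<^sub>R ip (\<D> p) (w p) (u p))"
      using U_integrable[OF w u] E by (intro integrable_mult_indicator) auto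
    ultimately show "integrable (completion \<mu>) (\<lambda>p. ip (\<D> p) (w p) (cut E u p))"
      by (subst Bochner_Integration.integrable_cong[OF refl]) auto
  qed
qed

section \<open>The direct integral as an inner product space\<close>

abbreviation V :: "('x \<Rightarrow> 'v) set inner_space" where "V \<equiv> direct_integral \<mu> \<D> U"
abbreviation cls :: "('x \<Rightarrow> 'v) \<Rightarrow> ('x \<Rightarrow> 'v) set" where "cls \<equiv> ae_class \<mu> U"
abbreviation level :: "'i \<Rightarrow> ('x \<Rightarrow> 'v) set set" where
  "level \<equiv> direct_integral_level \<nu> \<mu> \<D> \<H> U"

text \<open>The same choice of representative as in the operations of
  \<open>direct_integral\<close>, which therefore unfold to statements about
  \<open>rep\<close>.\<close>

definition rep :: "('x \<Rightarrow> 'v) set \<Rightarrow> 'x \<Rightarrow> 'v" where "rep A = (SOME u. u \<in> A)"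

lemma cls_iff: "u \<in> U \<Longrightarrow> v \<in> cls u \<longleftrightarrow> v \<in> U \<and> (AE p in \<mu>. v p = u p)"
  by (auto simp: ae_class_def ae_rel_def eq_commute)

lemma cls_eq_iff:
  assumes "u \<in> U" "v \<in> U"
  shows "cls u = cls v \<longleftrightarrow> (AE p in \<mu>. u p = v p)"
proof
  assume "cls u = cls v"
  then have "u \<in> cls v" using cls_iff[OF assms(1), of u] assms(1) by simp
  then show "AE p in \<mu>. u p = v p" using cls_iff[OF assms(2)] by simp
next
  assume eq: "AE p in \<mu>. u p = v p"
  have "w \<in> cls u \<longleftrightarrow> w \<in> cls v" for w
  proof -
    have "(AE p in \<mu>. w p = u p) \<longleftrightarrow> (AE p in \<mu>. w p = v p)"
      using eq by (auto elim: AE_mp)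
    then show ?thesis using cls_iff assms by simp
  qed
  then show "cls u = cls v" by blast
qed

lemma rep_cls:
  assumes "u \<in> U"
  shows "rep (cls u) \<in> U" "AE p in \<mu>. rep (cls u) p = u p"
proof -
  have "u \<in> cls u" using assms cls_iff by simp
  then have "rep (cls u) \<in> cls u" unfolding rep_def by (rule someI[of "\<lambda>v. v \<in> cls u"])
  then show "rep (cls u) \<in> U" "AE p in \<mu>. rep (cls u) p = u p" using cls_iff[OF assms] by auto
qed

lemma carrier_V: "carrier V = cls ` U"
  by (auto simp: direct_integral_def quotient_def ae_class_def)

lemma carrier_rep:
  assumes "A \<in> carrier V"
  shows "rep A \<in> U" "cls (rep A) = A"
proof -
  obtain u where "u \<in> U" "A = cls u" using assms by (auto simp: carrier_V)
  then show "rep A \<in> U" "cls (rep A) = A" using rep_cls[of u] cls_eq_iff[of "rep (cls u)" u] by auto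
qed

lemma add_V:
  assumes "u \<in> U" "v \<in> U"
  shows "cls u \<oplus>\<^bsub>V\<^esub> cls v = cls (lincomb 1 u v)"
proof -
  let ?u = "rep (cls u)" and ?v = "rep (cls v)"
  have "1 \<odot>\<^bsub>\<D> p\<^esub> ?u p = ?u p" if "p \<in> space \<mu>" for p
    using module.smult_one[of complex_field "\<D> p" "?u p"] cips[OF that] U_carrier[OF rep_cls(1)] assms that
    by (simp add: complex_inner_product_space_def)
  then have "cls u \<oplus>\<^bsub>V\<^esub> cls v = cls (lincomb 1 ?u ?v)"
    unfolding direct_integral_def lincomb_def by (simp add: rep_def cong: restrict_cong)
  moreover have "AE p in \<mu>. lincomb 1 ?u ?v p = lincomb 1 u v p"
    using rep_cls(2)[OF assms(1)] rep_cls(2)[OF assms(2)]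
    by eventually_elim (simp add: lincomb_def)
  ultimately show ?thesis using assms by (simp add: cls_eq_iff lincomb_U rep_cls(1))
qed

lemma smult_V:
  assumes "u \<in> U"
  shows "a \<odot>\<^bsub>V\<^esub> cls u = cls (lincomb a u zero_section)"
proof -
  let ?u = "rep (cls u)"
  have "lincomb a ?u zero_section p = a \<odot>\<^bsub>\<D> p\<^esub> ?u p" if "p \<in> space \<mu>" for p
  proof -
    interpret D: complex_inner_product_space "\<D> p" by (rule cips[OF that])
    show ?thesis using U_carrier[OF rep_cls(1)[OF assms] that] that
      by (simp add: lincomb_apply zero_section_apply)
  qed
  then have "(\<lambda>p\<in>space \<mu>. a \<odot>\<^bsub>\<D> p\<^esub> ?u p) = lincomb a ?u zero_section"
    by (auto simp: restrict_def lincomb_def)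
  then have "a \<odot>\<^bsub>V\<^esub> cls u = cls (lincomb a ?u zero_section)"
    unfolding direct_integral_def by (simp add: rep_def)
  moreover have "AE p in \<mu>. lincomb a ?u zero_section p = lincomb a u zero_section p"
    using rep_cls(2)[OF assms] by eventually_elim (simp add: lincomb_def)
  ultimately show ?thesis using assms by (simp add: cls_eq_iff lincomb_U rep_cls(1) zero_section_U)
qed

lemma zero_V: "\<zero>\<^bsub>V\<^esub> = cls zero_section"
  by (simp add: direct_integral_def zero_section_def)

lemma ip_V:
  assumes "u \<in> U" "v \<in> U"
  shows "ip V (cls u) (cls v) = (\<integral>p. ip (\<D> p) (u p) (v p) \<partial>completion \<mu>)"
proof -
  have "ip V (cls u) (cls v) = (\<integral>p. ip (\<D> p) (rep (cls u) p) (rep (cls v) p) \<partial>completion \<mu>)"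
    by (simp add: direct_integral_def rep_def)
  also have "\<dots> = (\<integral>p. ip (\<D> p) (u p) (v p) \<partial>completion \<mu>)"
  proof (rule integral_cong_AE)
    have "AE p in \<mu>. ip (\<D> p) (rep (cls u) p) (rep (cls v) p) = ip (\<D> p) (u p) (v p)"
      using rep_cls(2)[OF assms(1)] rep_cls(2)[OF assms(2)] by eventually_elim simp
    then show "AE p in completion \<mu>. ip (\<D> p) (rep (cls u) p) (rep (cls v) p) = ip (\<D> p) (u p) (v p)"
      by (simp add: AE_completion_iff)
  qed (intro borel_measurable_integrable U_integrable rep_cls(1) assms)+
  finally show ?thesis .
qed

lemma ip_V_eq:
  assumes "u \<in> U" "v \<in> U" "\<And>p. p \<in> space \<mu> \<Longrightarrow> ip (\<D> p) (u p) (v p) = f p"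
  shows "ip V (cls u) (cls v) = (\<integral>p. f p \<partial>completion \<mu>)"
  unfolding ip_V[OF assms(1,2)]
  by (rule Bochner_Integration.integral_cong) (simp_all add: assms(3))

definition norm2 :: "('x \<Rightarrow> 'v) \<Rightarrow> 'x \<Rightarrow> real" where
  "norm2 u p = (ip_norm (\<D> p) (u p))\<^sup>2"

lemma ip_self_norm2: "\<lbrakk>u \<in> U; p \<in> space \<mu>\<rbrakk> \<Longrightarrow> ip (\<D> p) (u p) (u p) = of_real (norm2 u p)"
  unfolding norm2_def by (rule complex_inner_product_space.ip_self[OF cips U_carrier])

lemma integrable_norm2: "u \<in> U \<Longrightarrow> integrable (completion \<mu>) (norm2 u)"
  using integrable_Re[OF U_integrable[of u u]]
  by (subst Bochner_Integration.integrable_cong[OF refl, of _ _ "\<lambda>p. Re (ip (\<D> p) (u p) (u p))"])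
    (auto simp: ip_self_norm2)

lemma ip_V_self: "u \<in> U \<Longrightarrow> ip V (cls u) (cls u) = of_real (\<integral>p. norm2 u p \<partial>completion \<mu>)"
  by (simp add: ip_V_eq[where f = "\<lambda>p. of_real (norm2 u p)"] ip_self_norm2)

lemma norm2_nonneg: "0 \<le> norm2 u p"
  by (simp add: norm2_def)

lemma norm2_eq_zero_AE:
  assumes u: "u \<in> U" and "(\<integral>p. norm2 u p \<partial>completion \<mu>) = 0"
  shows "AE p in \<mu>. u p = \<zero>\<^bsub>\<D> p\<^esub>"
proof -
  have "AE p in completion \<mu>. norm2 u p = 0"
    using integral_nonneg_eq_0_iff_AE[OF integrable_norm2[OF u]] assms(2) by (simp add: norm2_nonneg)
  then have "AE p in \<mu>. norm2 u p = 0" by (simp add: AE_completion_iff)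
  with AE_space show ?thesis
  proof eventually_elim
    case (elim p)
    then show ?case
      using complex_inner_product_space.ip_norm_eq_zero[OF cips U_carrier[OF u], of p]
      by (simp add: norm2_def)
  qed
qed

text \<open>Reduces the vector space laws of the direct integral to scalar identities in each
  fibre.\<close>

lemma section_eqI:
  assumes "u \<in> U" "v \<in> U"
    and "\<And>p x. \<lbrakk>p \<in> space \<mu>; x \<in> carrier (\<D> p)\<rbrakk> \<Longrightarrow> ip (\<D> p) (u p) x = ip (\<D> p) (v p) x"
  shows "u = v"
  using assms by (intro U_eqI complex_inner_product_space.ip_eqI[OF cips]) (auto intro: U_carrier)

lemma ip_lincomb_left:
  assumes "u \<in> U" "v \<in> U" "p \<in> space \<mu>" "x \<in> carrier (\<D> p)"
  shows "ip (\<D> p) (lincomb a u v p) x = a * ip (\<D> p) (u p) x + ip (\<D> p) (v p) x"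
proof -
  interpret D: complex_inner_product_space "\<D> p" by (rule cips[OF assms(3)])
  show ?thesis using assms U_carrier[OF assms(1,3)] U_carrier[OF assms(2,3)]
    by (simp add: lincomb_apply D.ip_simps)
qed

lemma ip_zero_section_left:
  "\<lbrakk>p \<in> space \<mu>; x \<in> carrier (\<D> p)\<rbrakk> \<Longrightarrow> ip (\<D> p) (zero_section p) x = 0"
  using complex_inner_product_space.ip_zero_left[OF cips] by (simp add: zero_section_apply)

lemma abelian_group_V: "abelian_group V"
proof (rule abelian_groupI)
  note [simp] = add_V lincomb_U zero_section_U ip_lincomb_left ip_zero_section_left zero_V algebra_simps
  fix A B C assume "A \<in> carrier V"
  then obtain u where u [simp]: "u \<in> U" "A = cls u" by (auto simp: carrier_V)
  show "\<zero>\<^bsub>V\<^esub> \<oplus>\<^bsub>V\<^esub> A = A"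
    by simp (rule arg_cong[where f = cls], rule section_eqI, simp_all)
  show "\<exists>y\<in>carrier V. y \<oplus>\<^bsub>V\<^esub> A = \<zero>\<^bsub>V\<^esub>"
  proof (rule bexI[of _ "cls (lincomb (-1) u zero_section)"])
    show "cls (lincomb (-1) u zero_section) \<oplus>\<^bsub>V\<^esub> A = \<zero>\<^bsub>V\<^esub>"
      by simp (rule arg_cong[where f = cls], rule section_eqI, simp_all)
  qed (simp add: carrier_V)
  assume "B \<in> carrier V"
  then obtain v where v [simp]: "v \<in> U" "B = cls v" by (auto simp: carrier_V)
  show "A \<oplus>\<^bsub>V\<^esub> B \<in> carrier V" by (simp add: carrier_V)
  show "A \<oplus>\<^bsub>V\<^esub> B = B \<oplus>\<^bsub>V\<^esub> A"
    by simp (rule arg_cong[where f = cls], rule section_eqI, simp_all)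
  assume "C \<in> carrier V"
  then obtain w where w [simp]: "w \<in> U" "C = cls w" by (auto simp: carrier_V)
  show "(A \<oplus>\<^bsub>V\<^esub> B) \<oplus>\<^bsub>V\<^esub> C = A \<oplus>\<^bsub>V\<^esub> (B \<oplus>\<^bsub>V\<^esub> C)"
    by simp (rule arg_cong[where f = cls], rule section_eqI, simp_all)
qed (auto simp: carrier_V zero_V zero_section_U)

lemma module_V: "module complex_field V"
proof (rule moduleI[OF cring_complex_field abelian_group_V])
  note [simp] = add_V smult_V lincomb_U zero_section_U ip_lincomb_left ip_zero_section_left
  fix a b A B assume "A \<in> carrier V"
  then obtain u where u [simp]: "u \<in> U" "A = cls u" by (auto simp: carrier_V)
  show "a \<odot>\<^bsub>V\<^esub> A \<in> carrier V" by (simp add: carrier_V)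
  show "(a \<oplus>\<^bsub>complex_field\<^esub> b) \<odot>\<^bsub>V\<^esub> A = a \<odot>\<^bsub>V\<^esub> A \<oplus>\<^bsub>V\<^esub> b \<odot>\<^bsub>V\<^esub> A"
    by simp (rule arg_cong[where f = cls], rule section_eqI, simp_all add: algebra_simps)
  show "(a \<otimes>\<^bsub>complex_field\<^esub> b) \<odot>\<^bsub>V\<^esub> A = a \<odot>\<^bsub>V\<^esub> (b \<odot>\<^bsub>V\<^esub> A)"
    by simp (rule arg_cong[where f = cls], rule section_eqI, simp_all add: algebra_simps)
  show "\<one>\<^bsub>complex_field\<^esub> \<odot>\<^bsub>V\<^esub> A = A"
    by simp (rule arg_cong[where f = cls], rule section_eqI, simp_all add: algebra_simps)
  assume "B \<in> carrier V"
  then obtain v where v [simp]: "v \<in> U" "B = cls v" by (auto simp: carrier_V)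
  show "a \<odot>\<^bsub>V\<^esub> (A \<oplus>\<^bsub>V\<^esub> B) = a \<odot>\<^bsub>V\<^esub> A \<oplus>\<^bsub>V\<^esub> a \<odot>\<^bsub>V\<^esub> B"
    by simp (rule arg_cong[where f = cls], rule section_eqI, simp_all add: algebra_simps)
qed

lemma lincomb_V:
  assumes "u \<in> U" "v \<in> U"
  shows "a \<odot>\<^bsub>V\<^esub> cls u \<oplus>\<^bsub>V\<^esub> cls v = cls (lincomb a u v)"
proof -
  have "lincomb 1 (lincomb a u zero_section) v = lincomb a u v"
    using assms by (intro section_eqI) (auto simp: lincomb_U zero_section_U ip_lincomb_left ip_zero_section_left)
  then show ?thesis using assms by (simp add: smult_V add_V lincomb_U zero_section_U)
qed

lemma cips_V: "complex_inner_product_space V"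
proof (intro complex_inner_product_space.intro module_V complex_inner_product_space_axioms.intro)
  note [simp] = add_V smult_V lincomb_U zero_section_U ip_lincomb_left ip_zero_section_left
    ip_V U_carrier U_integrable
  fix A B C a assume "A \<in> carrier V"
  then obtain u where u [simp]: "u \<in> U" "A = cls u" by (auto simp: carrier_V)
  show "0 \<le> Re (ip V A A)" by (simp add: ip_V_self norm2_nonneg del: ip_V)
  show "A = \<zero>\<^bsub>V\<^esub>" if "ip V A A = 0"
  proof -
    have "AE p in \<mu>. u p = \<zero>\<^bsub>\<D> p\<^esub>"
      using that by (intro norm2_eq_zero_AE) (auto simp: ip_V_self simp del: ip_V)
    with AE_space have "AE p in \<mu>. u p = zero_section p"
      by eventually_elim (simp add: zero_section_apply)
    then show ?thesis by (simp add: zero_V cls_eq_iff)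
  qed
  assume "B \<in> carrier V"
  then obtain v where v [simp]: "v \<in> U" "B = cls v" by (auto simp: carrier_V)
  have "ip V (cls v) (cls u) = (\<integral>p. cnj (ip (\<D> p) (u p) (v p)) \<partial>completion \<mu>)"
    by (rule ip_V_eq)
      (auto intro: complex_inner_product_space.ip_commute[OF cips])
  then show "ip V B A = cnj (ip V A B)" by simp
  have "ip V (cls (lincomb a u zero_section)) (cls v) = (\<integral>p. a * ip (\<D> p) (u p) (v p) \<partial>completion \<mu>)"
    by (rule ip_V_eq) auto
  then show "ip V (a \<odot>\<^bsub>V\<^esub> A) B = a * ip V A B" by simp
  assume "C \<in> carrier V"
  then obtain w where w [simp]: "w \<in> U" "C = cls w" by (auto simp: carrier_V)
  have "ip V (cls (lincomb 1 u v)) (cls w)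
      = (\<integral>p. ip (\<D> p) (u p) (w p) + ip (\<D> p) (v p) (w p) \<partial>completion \<mu>)"
    by (rule ip_V_eq) auto
  then show "ip V (A \<oplus>\<^bsub>V\<^esub> B) C = ip V A C + ip V B C" by simp
qed

lemma ip_norm_V: "u \<in> U \<Longrightarrow> (ip_norm V (cls u))\<^sup>2 = (\<integral>p. norm2 u p \<partial>completion \<mu>)"
  by (simp add: ip_norm_def ip_V_self norm2_nonneg)

text \<open>Membership in level \<alpha> for representatives, invariant under changes on null sets.
  In contrast, \<open>supported_at_level\<close> constrains the support at every point.\<close>

definition lev :: "'i \<Rightarrow> ('x \<Rightarrow> 'v) set" where
  "lev \<alpha> = {u \<in> U. AE p in \<mu>. if p \<in> X \<alpha> then u p \<in> \<H> \<alpha> p else u p = \<zero>\<^bsub>\<D> p\<^esub>}"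

lemma levD:
  assumes "u \<in> lev \<alpha>"
  shows "u \<in> U" "AE p in \<mu>. p \<in> X \<alpha> \<longrightarrow> u p \<in> \<H> \<alpha> p" "AE p in \<mu>. p \<notin> X \<alpha> \<longrightarrow> u p = \<zero>\<^bsub>\<D> p\<^esub>"
  using assms unfolding lev_def by (auto elim: eventually_mono)

lemma supported_lev: "\<lbrakk>u \<in> U; supported_at_level \<nu> \<mu> \<D> \<H> \<alpha> u\<rbrakk> \<Longrightarrow> u \<in> lev \<alpha>"
  unfolding lev_def supported_at_level_def
  by (auto intro: AE_mp[OF _ AE_I2])

lemma lev_cut_supported:
  assumes "u \<in> lev \<alpha>"
  shows "supported_at_level \<nu> \<mu> \<D> \<H> \<alpha> (cut (X \<alpha>) u)" "AE p in \<mu>. cut (X \<alpha>) u p = u p"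
proof -
  from levD(2)[OF assms] AE_space have "AE p in \<mu>. p \<in> X \<alpha> \<longrightarrow> cut (X \<alpha>) u p \<in> \<H> \<alpha> p"
    by eventually_elim (auto simp: cut_apply)
  then show "supported_at_level \<nu> \<mu> \<D> \<H> \<alpha> (cut (X \<alpha>) u)"
    unfolding supported_at_level_def by (auto simp: cut_apply split: if_splits)
  from levD(3)[OF assms] AE_space show "AE p in \<mu>. cut (X \<alpha>) u p = u p"
    by eventually_elim (auto simp: cut_apply)
qed

text \<open>For the converse direction, cutting \<open>u\<close> to \<open>X \<alpha>\<close>
  produces a representative of the same class whose support lies in \<open>X \<alpha>\<close> at
  every point.\<close>

lemma level_iff:
  assumes u: "u \<in> U"
  shows "cls u \<in> level \<alpha> \<longleftrightarrow> u \<in> lev \<alpha>"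
proof
  assume "cls u \<in> level \<alpha>"
  then obtain v where v: "v \<in> U" "supported_at_level \<nu> \<mu> \<D> \<H> \<alpha> v" "cls u = cls v"
    unfolding direct_integral_level_def by blast
  have "AE p in \<mu>. if p \<in> X \<alpha> then v p \<in> \<H> \<alpha> p else v p = \<zero>\<^bsub>\<D> p\<^esub>"
    using supported_lev[OF v(1,2)] by (simp add: lev_def)
  moreover have "AE p in \<mu>. u p = v p" using v u cls_eq_iff by blast
  ultimately have "AE p in \<mu>. if p \<in> X \<alpha> then u p \<in> \<H> \<alpha> p else u p = \<zero>\<^bsub>\<D> p\<^esub>"
    by eventually_elim simp
  then show "u \<in> lev \<alpha>" using u by (simp add: lev_def)
next
  assume l: "u \<in> lev \<alpha>"
  have "cut (X \<alpha>) u \<in> U" by (rule cut_U[OF u X_sets])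
  then have "cls u = cls (cut (X \<alpha>) u)"
    using lev_cut_supported(2)[OF l] u by (simp add: cls_eq_iff eq_commute)
  then show "cls u \<in> level \<alpha>"
    using lev_cut_supported(1)[OF l] \<open>cut (X \<alpha>) u \<in> U\<close> unfolding direct_integral_level_def by blast
qed

lemma level_eq: "level \<alpha> = cls ` lev \<alpha>"
proof
  show "level \<alpha> \<subseteq> cls ` lev \<alpha>"
    unfolding direct_integral_level_def using supported_lev by blast
  show "cls ` lev \<alpha> \<subseteq> level \<alpha>" using level_iff levD(1) by blast
qed

lemma lev_mono:
  assumes "u \<in> lev \<alpha>" "\<alpha> \<le> \<beta>"
  shows "u \<in> lev \<beta>"
proof -
  from levD(2,3)[OF assms(1)] AE_space
  have "AE p in \<mu>. if p \<in> X \<beta> then u p \<in> \<H> \<beta> p else u p = \<zero>\<^bsub>\<D> p\<^esub>"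
  proof eventually_elim
    case (elim p)
    then show ?case
      using X_mono[OF assms(2)] \<H>_mono[OF _ assms(2), of p] zero_\<H>[of p \<beta>] by (cases "p \<in> X \<alpha>") auto
  qed
  then show ?thesis using levD(1)[OF assms(1)] by (simp add: lev_def)
qed

lemma U_lev:
  assumes "u \<in> U"
  obtains \<beta> where "\<alpha> \<le> \<beta>" "u \<in> lev \<beta>"
  using U_supported[OF assms] supported_lev[OF assms] by metis

lemma lincomb_lev:
  assumes "u \<in> lev \<alpha>" "v \<in> lev \<alpha>"
  shows "lincomb a u v \<in> lev \<alpha>"
proof -
  from levD(2,3)[OF assms(1)] levD(2,3)[OF assms(2)] AE_space
  have "AE p in \<mu>. if p \<in> X \<alpha> then lincomb a u v p \<in> \<H> \<alpha> p else lincomb a u v p = \<zero>\<^bsub>\<D> p\<^esub>"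
    by eventually_elim (auto simp: lincomb_apply fibre_lincomb)
  then show ?thesis using levD(1) assms by (simp add: lev_def lincomb_U)
qed

lemma cut_lev:
  assumes "u \<in> lev \<alpha>" "E \<in> sets \<mu>"
  shows "cut E u \<in> lev \<alpha>"
proof -
  from levD(2,3)[OF assms(1)] AE_space
  have "AE p in \<mu>. if p \<in> X \<alpha> then cut E u p \<in> \<H> \<alpha> p else cut E u p = \<zero>\<^bsub>\<D> p\<^esub>"
    by eventually_elim (auto simp: cut_apply zero_\<H>)
  then show ?thesis using levD(1) assms by (simp add: lev_def cut_U)
qed

lemma minus_V:
  assumes "u \<in> U" "v \<in> U"
  shows "cls u \<ominus>\<^bsub>V\<^esub> cls v = cls (lincomb (-1) v u)"
proof -
  interpret V: complex_inner_product_space V by (rule cips_V)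
  have "cls u \<in> carrier V" "cls v \<in> carrier V" using assms by (auto simp: carrier_V)
  then have "cls u \<ominus>\<^bsub>V\<^esub> cls v = (-1) \<odot>\<^bsub>V\<^esub> cls v \<oplus>\<^bsub>V\<^esub> cls u"
    by (intro V.ip_eqI) (auto simp: V.ip_simps)
  then show ?thesis using assms by (simp add: lincomb_V)
qed

lemma minus_fibre:
  assumes "p \<in> space \<mu>" "x \<in> carrier (\<D> p)" "y \<in> carrier (\<D> p)"
  shows "(-1) \<odot>\<^bsub>\<D> p\<^esub> y \<oplus>\<^bsub>\<D> p\<^esub> x = x \<ominus>\<^bsub>\<D> p\<^esub> y"
proof -
  interpret D: complex_inner_product_space "\<D> p" by (rule cips[OF assms(1)])
  show ?thesis using assms by (intro D.ip_eqI) (auto simp: D.ip_simps)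
qed

text \<open>Approximation in the direct integral means that the squared pointwise distances tend to
  zero in mean; a subsequence then tends to zero almost everywhere, which is pointwise approximation
  in the fibres.\<close>

lemma AE_adherence:
  assumes S: "S \<subseteq> U" and u: "u \<in> U"
    and dense: "\<And>\<epsilon>. \<epsilon> > 0 \<Longrightarrow> \<exists>s\<in>S. (\<integral>p. norm2 (lincomb (-1) s u) p \<partial>completion \<mu>) < \<epsilon>"
  shows "AE p in \<mu>. u p \<in> complex_inner_product_space.adherence (\<D> p) ((\<lambda>s. s p) ` S)"
proof -
  have "\<exists>s\<in>S. (\<integral>p. norm2 (lincomb (-1) s u) p \<partial>completion \<mu>) < inverse (real (Suc n))" for n
    by (rule dense) simp
  then obtain s where s: "\<And>n. s n \<in> S"
    and lt: "\<And>n. (\<integral>p. norm2 (lincomb (-1) (s n) u) p \<partial>completion \<mu>) < inverse (real (Suc n))"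
    by metis
  have sU: "s n \<in> U" for n using s S by blast
  let ?f = "\<lambda>n. norm2 (lincomb (-1) (s n) u)"
  have "\<exists>r::nat \<Rightarrow> nat. strict_mono r \<and> (AE p in completion \<mu>. (\<lambda>n. ?f (r n) p) \<longlonglongrightarrow> 0)"
  proof (rule tendsto_L1_AE_subseq)
    show "integrable (completion \<mu>) (?f n)" for n using sU u by (simp add: integrable_norm2 lincomb_U)
    show "(\<lambda>n. \<integral>p. norm (?f n p) \<partial>completion \<mu>) \<longlonglongrightarrow> 0"
    proof (rule real_tendsto_sandwich[OF _ _ tendsto_const LIMSEQ_inverse_real_of_nat])
      show "\<forall>\<^sub>F n in sequentially. (\<integral>p. norm (?f n p) \<partial>completion \<mu>) \<le> inverse (real (Suc n))"
        using lt by (simp add: norm2_nonneg less_imp_le)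
    qed simp
  qed
  then obtain r :: "nat \<Rightarrow> nat" where "AE p in \<mu>. (\<lambda>n. ?f (r n) p) \<longlonglongrightarrow> 0"
    by (auto simp: AE_completion_iff)
  with AE_space show ?thesis
  proof eventually_elim
    case (elim p)
    interpret D: complex_inner_product_space "\<D> p" by (rule cips[OF elim(1)])
    have car: "s n p \<in> carrier (\<D> p)" "u p \<in> carrier (\<D> p)" for n
      using U_carrier[OF sU elim(1)] U_carrier[OF u elim(1)] by auto
    have "lincomb (-1) (s n) u p = u p \<ominus>\<^bsub>\<D> p\<^esub> s n p" for n
      using minus_fibre[OF elim(1) car(2) car(1)] elim(1) by (simp add: lincomb_apply)
    then have "(\<lambda>n. sqrt ((ip_norm (\<D> p) (s (r n) p \<ominus>\<^bsub>\<D> p\<^esub> u p))\<^sup>2)) \<longlonglongrightarrow> sqrt 0"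
      using elim(2) car by (intro tendsto_real_sqrt) (simp add: norm2_def D.ip_norm_minus_commute)
    then have "D.converges (\<lambda>n. s (r n) p) (u p)" using car by (simp add: D.converges_def)
    then show ?case
      using s car S U_carrier[OF _ elim(1)] by (intro D.converges_adherence[of "\<lambda>n. s (r n) p"]) auto
  qed
qed

section \<open>Locally bounded operators on sections\<close>

lemma ip_V_orth_iff:
  assumes "u \<in> U"
  shows "cls u \<in> orth V (level \<alpha>) \<longleftrightarrow> (\<forall>w\<in>lev \<alpha>. (\<integral>p. ip (\<D> p) (u p) (w p) \<partial>completion \<mu>) = 0)"
  using assms levD(1) by (auto simp: orth_def level_eq carrier_V ip_V)

lemma ip_cut_commute:
  assumes "u \<in> U" "w \<in> U" "p \<in> space \<mu>"
  shows "ip (\<D> p) (cut E u p) (w p) = ip (\<D> p) (u p) (cut E w p)"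
  using assms complex_inner_product_space.ip_zero_left[OF cips] complex_inner_product_space.ip_zero_right[OF cips]
  by (simp add: cut_apply U_carrier)

lemma cut_lincomb: "\<lbrakk>u \<in> U; v \<in> U; E \<in> sets \<mu>\<rbrakk> \<Longrightarrow>
    cut E (lincomb a u v) = lincomb a (cut E u) (cut E v)"
  by (rule U_eqI) (auto simp: cut_U lincomb_U cut_apply lincomb_apply fibre_lincomb)

lemma cut_zero_section: "cut E zero_section = zero_section"
  by (auto simp: cut_def zero_section_def restrict_def)

lemma cut_cong:
  assumes "AE p in \<mu>. u p = v p"
  shows "AE p in \<mu>. cut E u p = cut E v p"
  using assms by eventually_elim (simp add: cut_def)

lemma norm2_cut: "p \<in> space \<mu> \<Longrightarrow> norm2 (cut E u) p = indicator E p * norm2 u p"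
  using complex_inner_product_space.ip_norm_zero[OF cips] by (simp add: norm2_def cut_apply)

section \<open>Cut-offs as diagonalizable operators\<close>

definition cut_op :: "'x set \<Rightarrow> ('x \<Rightarrow> 'v) set \<Rightarrow> ('x \<Rightarrow> 'v) set" where
  "cut_op E = (\<lambda>A\<in>carrier V. cls (cut E (rep A)))"

lemma cut_op_cls:
  assumes "u \<in> U" "E \<in> sets \<mu>"
  shows "cut_op E (cls u) = cls (cut E u)"
proof -
  have "cls (cut E (rep (cls u))) = cls (cut E u)"
    using assms rep_cls by (simp add: cls_eq_iff cut_U cut_cong)
  then show ?thesis using assms by (simp add: cut_op_def carrier_V)
qed

text \<open>Orthogonal complements are preserved because cutting is symmetric for the inner product
  and maps the level to itself. Pointwise norms do not grow, so the constant 1 works at every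
  level.\<close>

lemma cut_op_locally_bounded:
  assumes E: "E \<in> sets \<mu>"
  shows "cut_op E \<in> locally_bounded_operators V UNIV level"
  unfolding locally_bounded_operators_def
proof (intro CollectI conjI ballI allI)
  note [simp] = cut_op_cls[OF _ E] cut_U[OF _ E]
  show "cut_op E \<in> carrier V \<rightarrow>\<^sub>E carrier V"
    using carrier_rep(1) by (auto simp: cut_op_def carrier_V)
  show "cut_op E (A \<oplus>\<^bsub>V\<^esub> B) = cut_op E A \<oplus>\<^bsub>V\<^esub> cut_op E B"
    if AB: "A \<in> carrier V" "B \<in> carrier V" for A B
  proof -
    obtain u v where "u \<in> U" "A = cls u" "v \<in> U" "B = cls v" using AB by (auto simp: carrier_V)
    then show ?thesis by (simp add: add_V lincomb_U cut_lincomb E)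
  qed
  show "cut_op E (a \<odot>\<^bsub>V\<^esub> A) = a \<odot>\<^bsub>V\<^esub> cut_op E A" if A: "A \<in> carrier V" for a A
  proof -
    obtain u where "u \<in> U" "A = cls u" using A by (auto simp: carrier_V)
    then show ?thesis
      by (simp add: smult_V lincomb_U zero_section_U cut_lincomb E cut_zero_section)
  qed
  fix \<alpha>
  show "cut_op E ` level \<alpha> \<subseteq> level \<alpha>"
    using cut_lev[OF _ E] levD(1) by (auto simp: level_eq)
  show "cut_op E ` orth V (level \<alpha>) \<subseteq> orth V (level \<alpha>)"
  proof clarify
    fix A assume A: "A \<in> orth V (level \<alpha>)"
    then obtain u where u: "u \<in> U" "A = cls u" by (auto simp: orth_def carrier_V)
    have "(\<integral>p. ip (\<D> p) (cut E u p) (w p) \<partial>completion \<mu>) = 0" if w: "w \<in> lev \<alpha>" for w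
    proof -
      have "(\<integral>p. ip (\<D> p) (cut E u p) (w p) \<partial>completion \<mu>)
          = (\<integral>p. ip (\<D> p) (u p) (cut E w p) \<partial>completion \<mu>)"
        by (rule Bochner_Integration.integral_cong) (simp_all add: ip_cut_commute u(1) levD(1)[OF w])
      also have "\<dots> = 0" using A u cut_lev[OF w E] ip_V_orth_iff by blast
      finally show ?thesis .
    qed
    then show "cut_op E A \<in> orth V (level \<alpha>)" using u by (simp add: ip_V_orth_iff)
  qed
  show "\<exists>c. \<forall>A\<in>level \<alpha>. ip_norm V (cut_op E A) \<le> c * ip_norm V A"
  proof (intro exI ballI)
    fix A assume "A \<in> level \<alpha>"
    then obtain u where u: "u \<in> U" "A = cls u" using levD(1) by (auto simp: level_eq)
    have "(\<integral>p. norm2 (cut E u) p \<partial>completion \<mu>) \<le> (\<integral>p. norm2 u p \<partial>completion \<mu>)"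
      using u by (intro integral_mono integrable_norm2)
        (auto simp: norm2_cut norm2_nonneg indicator_def)
    then have "(ip_norm V (cls (cut E u)))\<^sup>2 \<le> (ip_norm V (cls u))\<^sup>2" using u by (simp add: ip_norm_V)
    then have "ip_norm V (cls (cut E u)) \<le> ip_norm V (cls u)"
      by (rule power2_le_imp_le)
        (use u in \<open>auto intro!: complex_inner_product_space.ip_norm_nonneg[OF cips_V] simp: carrier_V\<close>)
    then show "ip_norm V (cut_op E A) \<le> 1 * ip_norm V A" using u by simp
  qed
qed

text \<open>Covers the fibres of a cut-off, where \<open>b\<close> says whether \<open>p\<close>
  lies in the set, and with \<open>b = False\<close> the zero operator placed on an exceptional null
  set.\<close>

lemma restrict_id_or_zero_locally_bounded:
  assumes p: "p \<in> space \<mu>"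
  shows "(\<lambda>x\<in>carrier (\<D> p). if b then x else \<zero>\<^bsub>\<D> p\<^esub>)
    \<in> locally_bounded_operators (\<D> p) I (\<lambda>\<alpha>. \<H> \<alpha> p)"
proof -
  interpret D: complex_inner_product_space "\<D> p" by (rule cips[OF p])
  have sub: "x \<in> carrier (\<D> p)" if "x \<in> \<H> \<alpha> p" for x \<alpha> using \<H>_sub[OF p] that by blast
  show ?thesis
    unfolding locally_bounded_operators_def
  proof (intro CollectI conjI ballI allI)
    fix \<alpha>
    show "\<exists>c. \<forall>x\<in>\<H> \<alpha> p. ip_norm (\<D> p) ((\<lambda>x\<in>carrier (\<D> p). if b then x else \<zero>\<^bsub>\<D> p\<^esub>) x)
        \<le> c * ip_norm (\<D> p) x"
      by (rule exI[of _ 1]) (auto simp: sub)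
    show "(\<lambda>x\<in>carrier (\<D> p). if b then x else \<zero>\<^bsub>\<D> p\<^esub>) ` orth (\<D> p) (\<H> \<alpha> p)
        \<subseteq> orth (\<D> p) (\<H> \<alpha> p)"
      using sub by (auto simp: orth_def)
  qed (auto simp: sub zero_\<H>[OF p])
qed

lemma cut_op_diagonalizable:
  assumes E: "E \<in> sets \<mu>"
  shows "cut_op E \<in> diagonalizable_operators \<nu> \<mu> \<D> \<H> U"
proof -
  have "cut_op E \<in> decomposable_operators \<nu> \<mu> \<D> \<H> U"
    unfolding decomposable_operators_def
  proof (intro CollectI conjI cut_op_locally_bounded[OF E] exI ballI)
    show "(\<lambda>x\<in>carrier (\<D> p). if p \<in> E then x else \<zero>\<^bsub>\<D> p\<^esub>)
      \<in> locally_bounded_operators (\<D> p) {\<alpha>. p \<in> space (\<nu> \<alpha>)} (\<lambda>\<alpha>. \<H> \<alpha> p)" if "p \<in> space \<mu>" for p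
      by (rule restrict_id_or_zero_locally_bounded[OF that])
    fix u v assume u: "u \<in> U" and v: "v \<in> cut_op E (cls u)"
    then have "AE p in \<mu>. v p = cut E u p"
      using cls_iff[OF cut_U[OF u E]] by (simp add: cut_op_cls E)
    with AE_space show "AE p in \<mu>. v p = (\<lambda>x\<in>carrier (\<D> p). if p \<in> E then x else \<zero>\<^bsub>\<D> p\<^esub>) (u p)"
      by eventually_elim (simp add: cut_apply U_carrier[OF u])
  qed
  moreover have "\<exists>f\<in>borel_measurable \<mu>. \<forall>u\<in>U. \<forall>v\<in>cut_op E (cls u). AE p in \<mu>. v p = f p \<odot>\<^bsub>\<D> p\<^esub> u p"
  proof (intro bexI ballI)
    show "(indicator E :: 'x \<Rightarrow> complex) \<in> borel_measurable \<mu>" using E by simp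
    fix u v assume u: "u \<in> U" and v: "v \<in> cut_op E (cls u)"
    then have "AE p in \<mu>. v p = cut E u p"
      using cls_iff[OF cut_U[OF u E]] by (simp add: cut_op_cls E)
    with AE_space show "AE p in \<mu>. v p = indicator E p \<odot>\<^bsub>\<D> p\<^esub> u p"
    proof eventually_elim
      case (elim p)
      interpret D: complex_inner_product_space "\<D> p" by (rule cips[OF elim(1)])
      show ?case using elim U_carrier[OF u elim(1)] D.smult_zero_left D.smult_one
        by (simp add: cut_apply indicator_def)
    qed
  qed
  ultimately show ?thesis unfolding diagonalizable_operators_def by simp
qed

end

locale local_operator = local_direct_integral \<nu> \<mu> \<D> \<H> U
  for \<nu> :: "'i::order \<Rightarrow> 'x measure" and \<mu> :: "'x measure"
    and \<D> :: "'x \<Rightarrow> 'v inner_space" and \<H> :: "'i \<Rightarrow> 'x \<Rightarrow> 'v set" and U :: "('x \<Rightarrow> 'v) set" +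
  fixes T :: "('x \<Rightarrow> 'v) set \<Rightarrow> ('x \<Rightarrow> 'v) set"
  assumes T: "T \<in> locally_bounded_operators V UNIV level"
begin

text \<open>The action of \<open>T\<close> on sections rather than classes. The representative is
  chosen anew for each class, so identities for \<tau> are available only almost everywhere.\<close>

definition \<tau> :: "('x \<Rightarrow> 'v) \<Rightarrow> 'x \<Rightarrow> 'v" where "\<tau> u = rep (T (cls u))"

lemma T_carrier: "A \<in> carrier V \<Longrightarrow> T A \<in> carrier V"
  using T unfolding locally_bounded_operators_def by auto

lemma
  shows T_level: "A \<in> level \<alpha> \<Longrightarrow> T A \<in> level \<alpha>"
    and T_orth_level: "A \<in> orth V (level \<alpha>) \<Longrightarrow> T A \<in> orth V (level \<alpha>)"
    and T_bounded: "\<exists>c. \<forall>A\<in>level \<alpha>. ip_norm V (T A) \<le> c * ip_norm V A"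
proof -
  have *: "T ` level \<alpha> \<subseteq> level \<alpha> \<and> T ` orth V (level \<alpha>) \<subseteq> orth V (level \<alpha>) \<and>
      (\<exists>c. \<forall>A\<in>level \<alpha>. ip_norm V (T A) \<le> c * ip_norm V A)"
    using T unfolding locally_bounded_operators_def by simp
  then show "A \<in> level \<alpha> \<Longrightarrow> T A \<in> level \<alpha>" "A \<in> orth V (level \<alpha>) \<Longrightarrow> T A \<in> orth V (level \<alpha>)"
    by blast+
  show "\<exists>c. \<forall>A\<in>level \<alpha>. ip_norm V (T A) \<le> c * ip_norm V A" using * by (elim conjE)
qed

lemma
  assumes "u \<in> U"
  shows \<tau>_U: "\<tau> u \<in> U" and T_cls: "T (cls u) = cls (\<tau> u)"
  using carrier_rep[OF T_carrier, of "cls u"] assms by (auto simp: \<tau>_def carrier_V)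

lemma T_lincomb:
  assumes "A \<in> carrier V" "B \<in> carrier V"
  shows "T (a \<odot>\<^bsub>V\<^esub> A \<oplus>\<^bsub>V\<^esub> B) = a \<odot>\<^bsub>V\<^esub> T A \<oplus>\<^bsub>V\<^esub> T B"
  using T assms complex_inner_product_space.smult_carrier[OF cips_V]
  unfolding locally_bounded_operators_def by auto

lemma \<tau>_lincomb:
  assumes "u \<in> U" "v \<in> U"
  shows "AE p in \<mu>. \<tau> (lincomb a u v) p = lincomb a (\<tau> u) (\<tau> v) p"
proof -
  have "cls (\<tau> (lincomb a u v)) = cls (lincomb a (\<tau> u) (\<tau> v))"
    using T_lincomb[of "cls u" "cls v" a] assms
    by (simp add: carrier_V lincomb_V lincomb_U \<tau>_U flip: T_cls)
      (simp add: T_cls lincomb_V \<tau>_U)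
  then show ?thesis using assms by (simp add: cls_eq_iff lincomb_U \<tau>_U)
qed

lemma \<tau>_lev: "u \<in> lev \<alpha> \<Longrightarrow> \<tau> u \<in> lev \<alpha>"
  using T_level[of "cls u" \<alpha>] level_iff[of u \<alpha>] level_iff[of "\<tau> u" \<alpha>] levD(1)[of u \<alpha>]
  by (simp add: \<tau>_U T_cls)

text \<open>The squared form compares integrals of pointwise quantities and can be localized to
  subsets. The witness is an absolute value because the bound in the definition of local boundedness
  has no sign condition.\<close>

lemma \<tau>_bound: "\<exists>c\<ge>0. \<forall>u\<in>lev \<alpha>. (\<integral>p. norm2 (\<tau> u) p \<partial>completion \<mu>) \<le> c\<^sup>2 * (\<integral>p. norm2 u p \<partial>completion \<mu>)"
proof -
  obtain c where c: "\<forall>A\<in>level \<alpha>. ip_norm V (T A) \<le> c * ip_norm V A"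
    using T_bounded by blast
  show ?thesis
  proof (intro exI[of _ "\<bar>c\<bar>"] conjI ballI)
    fix u assume u: "u \<in> lev \<alpha>"
    note uU = levD(1)[OF u]
    have nn: "0 \<le> ip_norm V (cls v)" if "v \<in> U" for v
      using that by (intro complex_inner_product_space.ip_norm_nonneg[OF cips_V]) (simp add: carrier_V)
    have "ip_norm V (cls (\<tau> u)) \<le> c * ip_norm V (cls u)"
      using c u uU by (auto simp: level_eq simp flip: T_cls)
    also have "\<dots> \<le> \<bar>c\<bar> * ip_norm V (cls u)" using nn[OF uU] by (intro mult_right_mono) auto
    finally have "(ip_norm V (cls (\<tau> u)))\<^sup>2 \<le> (\<bar>c\<bar> * ip_norm V (cls u))\<^sup>2"
      using nn[OF \<tau>_U[OF uU]] by (intro power_mono)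
    then show "(\<integral>p. norm2 (\<tau> u) p \<partial>completion \<mu>) \<le> \<bar>c\<bar>\<^sup>2 * (\<integral>p. norm2 u p \<partial>completion \<mu>)"
      using uU \<tau>_U by (simp only: power_mult_distrib ip_norm_V)
  qed simp
qed

lemma \<tau>_orth:
  assumes "u \<in> U" "\<And>w. w \<in> lev \<alpha> \<Longrightarrow> (\<integral>p. ip (\<D> p) (u p) (w p) \<partial>completion \<mu>) = 0" "w \<in> lev \<alpha>"
  shows "(\<integral>p. ip (\<D> p) (\<tau> u p) (w p) \<partial>completion \<mu>) = 0"
proof -
  have "cls u \<in> orth V (level \<alpha>)" using assms by (simp add: ip_V_orth_iff)
  then have "T (cls u) \<in> orth V (level \<alpha>)" by (rule T_orth_level)
  then show ?thesis using assms by (simp add: T_cls ip_V_orth_iff \<tau>_U)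
qed

text \<open>Decomposability quantifies over all representatives of the image class; since these
  agree almost everywhere, one of them decides.\<close>

lemma AE_T_iff:
  assumes "u \<in> U"
  shows "(\<forall>v\<in>T (cls u). AE p in \<mu>. v p = F p (u p)) \<longleftrightarrow> (AE p in \<mu>. \<tau> u p = F p (u p))"
proof
  assume "\<forall>v\<in>T (cls u). AE p in \<mu>. v p = F p (u p)"
  then show "AE p in \<mu>. \<tau> u p = F p (u p)" using assms by (auto simp: T_cls cls_iff \<tau>_U)
next
  assume eq: "AE p in \<mu>. \<tau> u p = F p (u p)"
  show "\<forall>v\<in>T (cls u). AE p in \<mu>. v p = F p (u p)"
  proof
    fix v assume "v \<in> T (cls u)"
    then have "AE p in \<mu>. v p = \<tau> u p" using assms by (simp add: T_cls cls_iff \<tau>_U)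
    with eq show "AE p in \<mu>. v p = F p (u p)" by eventually_elim simp
  qed
qed

end

context local_direct_integral
begin

text \<open>At almost every point the diagonalizable operator is multiplication by a scalar, which
  the linear fibre operator respects.\<close>

lemma decomposable_subset_commutant:
  "decomposable_operators \<nu> \<mu> \<D> \<H> U \<subseteq> commutant V UNIV level (diagonalizable_operators \<nu> \<mu> \<D> \<H> U)"
proof
  fix T assume Tdec: "T \<in> decomposable_operators \<nu> \<mu> \<D> \<H> U"
  then have T: "T \<in> locally_bounded_operators V UNIV level" unfolding decomposable_operators_def by simp
  interpret T: local_operator \<nu> \<mu> \<D> \<H> U T by unfold_locales (rule T)
  obtain Tp where Tp: "\<And>p. p \<in> space \<mu> \<Longrightarrow>
      Tp p \<in> locally_bounded_operators (\<D> p) {\<alpha>. p \<in> space (\<nu> \<alpha>)} (\<lambda>\<alpha>. \<H> \<alpha> p)"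
    and Tu: "\<And>u. u \<in> U \<Longrightarrow> AE p in \<mu>. T.\<tau> u p = Tp p (u p)"
    using Tdec T.AE_T_iff[where F = "Tp" for Tp] unfolding decomposable_operators_def by blast
  have "T (S A) = S (T A)" if S: "S \<in> diagonalizable_operators \<nu> \<mu> \<D> \<H> U" and A: "A \<in> carrier V" for S A
  proof -
    have "S \<in> locally_bounded_operators V UNIV level"
      using S unfolding diagonalizable_operators_def decomposable_operators_def by simp
    then interpret S: local_operator \<nu> \<mu> \<D> \<H> U S by unfold_locales
    obtain f :: "'x \<Rightarrow> complex" where f: "\<And>u. u \<in> U \<Longrightarrow> AE p in \<mu>. S.\<tau> u p = f p \<odot>\<^bsub>\<D> p\<^esub> u p"
      using S S.AE_T_iff[where F = "\<lambda>p x. f p \<odot>\<^bsub>\<D> p\<^esub> x" for f] unfolding diagonalizable_operators_def by blast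
    obtain u where u: "u \<in> U" "A = cls u" using A by (auto simp: carrier_V)
    \<comment> \<open>The fibre descriptions of both operators are needed at \<open>u\<close> and at
      its image under the other operator, hence four exceptional null sets.\<close>
    from Tu[OF S.\<tau>_U[OF u(1)]] f[OF T.\<tau>_U[OF u(1)]] Tu[OF u(1)] f[OF u(1)] AE_space
    have "AE p in \<mu>. T.\<tau> (S.\<tau> u) p = S.\<tau> (T.\<tau> u) p"
    proof eventually_elim
      case (elim p)
      have "Tp p (f p \<odot>\<^bsub>\<D> p\<^esub> u p) = f p \<odot>\<^bsub>\<D> p\<^esub> Tp p (u p)"
        using Tp[OF elim(5)] U_carrier[OF u(1) elim(5)] unfolding locally_bounded_operators_def by blast
      then show ?case using elim by simp
    qed
    then show ?thesis using u by (simp add: T.T_cls S.T_cls T.\<tau>_U S.\<tau>_U cls_eq_iff)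
  qed
  then show "T \<in> commutant V UNIV level (diagonalizable_operators \<nu> \<mu> \<D> \<H> U)"
    using T unfolding commutant_def by blast
qed

end

locale commuting_operator = local_operator +
  assumes commutes: "\<And>E A. \<lbrakk>E \<in> sets \<mu>; A \<in> carrier V\<rbrakk> \<Longrightarrow> T (cut_op E A) = cut_op E (T A)"
begin

lemma \<tau>_cut:
  assumes "u \<in> U" "E \<in> sets \<mu>"
  shows "AE p in \<mu>. \<tau> (cut E u) p = cut E (\<tau> u) p"
proof -
  have "cls (\<tau> (cut E u)) = cls (cut E (\<tau> u))"
    using commutes[of E "cls u"] assms by (simp add: carrier_V cut_op_cls T_cls cut_U \<tau>_U)
  then show ?thesis using assms by (simp add: cls_eq_iff cut_U \<tau>_U)
qed

text \<open>The integral of \<open>norm2 (\<tau> u) - c\<^sup>2 * norm2 u\<close> over a measurable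
  \<open>E\<close> is nonpositive: by commutation it is the level bound for \<open>cut E u\<close>,
  which stays in the level. One constant serves all sections of the level.\<close>

lemma \<tau>_pointwise_bound:
  "\<exists>c\<ge>0. \<forall>u\<in>lev \<alpha>. AE p in \<mu>. ip_norm (\<D> p) (\<tau> u p) \<le> c * ip_norm (\<D> p) (u p)"
proof -
  obtain c where c: "c \<ge> 0" "\<And>u. u \<in> lev \<alpha> \<Longrightarrow>
      (\<integral>p. norm2 (\<tau> u) p \<partial>completion \<mu>) \<le> c\<^sup>2 * (\<integral>p. norm2 u p \<partial>completion \<mu>)"
    using \<tau>_bound by blast
  have "AE p in \<mu>. ip_norm (\<D> p) (\<tau> u p) \<le> c * ip_norm (\<D> p) (u p)" if u: "u \<in> lev \<alpha>" for u
  proof -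
    note uU = levD(1)[OF u]
    note int = integrable_norm2[OF uU] integrable_norm2[OF \<tau>_U[OF uU]]
    have "AE p in \<mu>. norm2 (\<tau> u) p - c\<^sup>2 * norm2 u p \<le> 0"
    proof (rule AE_nonpos_if_integrals_nonpos)
      show "integrable (completion \<mu>) (\<lambda>p. norm2 (\<tau> u) p - c\<^sup>2 * norm2 u p)" using int by simp
      fix E assume E: "E \<in> sets \<mu>"
      have "AE p in completion \<mu>. norm2 (cut E (\<tau> u)) p = norm2 (\<tau> (cut E u)) p"
        using \<tau>_cut[OF uU E] by (auto simp: AE_completion_iff norm2_def elim: eventually_mono)
      then have "(\<integral>p. norm2 (cut E (\<tau> u)) p \<partial>completion \<mu>) = (\<integral>p. norm2 (\<tau> (cut E u)) p \<partial>completion \<mu>)"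
        using uU E by (intro integral_cong_AE borel_measurable_integrable integrable_norm2) (auto intro: cut_U \<tau>_U)
      also have "\<dots> \<le> c\<^sup>2 * (\<integral>p. norm2 (cut E u) p \<partial>completion \<mu>)"
        by (rule c(2)[OF cut_lev[OF u E]])
      finally have "(\<integral>p. norm2 (cut E (\<tau> u)) p - c\<^sup>2 * norm2 (cut E u) p \<partial>completion \<mu>) \<le> 0"
        using uU E by (simp add: integrable_norm2 cut_U \<tau>_U)
      also have "(\<integral>p. norm2 (cut E (\<tau> u)) p - c\<^sup>2 * norm2 (cut E u) p \<partial>completion \<mu>)
          = (\<integral>p. indicator E p * (norm2 (\<tau> u) p - c\<^sup>2 * norm2 u p) \<partial>completion \<mu>)"
        by (rule Bochner_Integration.integral_cong) (auto simp: norm2_cut algebra_simps)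
      finally show "(\<integral>p. indicator E p * (norm2 (\<tau> u) p - c\<^sup>2 * norm2 u p) \<partial>completion \<mu>) \<le> 0" .
    qed
    with AE_space show ?thesis
    proof eventually_elim
      case (elim p)
      then have "(ip_norm (\<D> p) (\<tau> u p))\<^sup>2 \<le> (c * ip_norm (\<D> p) (u p))\<^sup>2"
        by (simp add: norm2_def power_mult_distrib)
      then show ?case
        by (rule power2_le_imp_le)
          (use c(1) complex_inner_product_space.ip_norm_nonneg[OF cips U_carrier[OF uU]] elim in simp)
    qed
  qed
  then show ?thesis using c(1) by blast
qed

end

section \<open>Counting measure\<close>

text \<open>Points are closed in a metric topology, so their complements are generators of the
  \<sigma>-algebra.\<close>

lemma singleton_in_standard_sets:
  assumes "standard_measure_space N" "p \<in> space N"
  shows "{p} \<in> sets N"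
proof -
  obtain d where d: "Metric_space (space N) d"
    and eq: "sets N = sigma_sets (space N) {G. openin (Metric_space.mtopology (space N) d) G}"
    using assms unfolding standard_measure_space_def by blast
  interpret Metric_space "space N" d by (rule d)
  have "openin mtopology (space N - {p})"
    using closedin_t1_singleton[OF t1_space_mtopology, of p] assms(2) by (simp add: closedin_def)
  then have "space N - {p} \<in> sets N" unfolding eq by (intro sigma_sets.Basic) simp
  then have "space N - (space N - {p}) \<in> sets N" by blast
  then show ?thesis using assms(2) by (simp add: Diff_Diff_Int)
qed

locale counting_operator = commuting_operator \<nu> \<mu> \<D> \<H> U T
  for \<nu> :: "'i::order \<Rightarrow> 'x measure" and \<mu> :: "'x measure"
    and \<D> :: "'x \<Rightarrow> 'v inner_space" and \<H> :: "'i \<Rightarrow> 'x \<Rightarrow> 'v set" and U :: "('x \<Rightarrow> 'v) set"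
    and T :: "('x \<Rightarrow> 'v) set \<Rightarrow> ('x \<Rightarrow> 'v) set" +
  assumes counting: "E \<in> sets \<mu> \<Longrightarrow> emeasure \<mu> E = emeasure (count_space (space \<mu>)) E"
begin

lemma singleton_sets:
  assumes "p \<in> space \<mu>"
  shows "{p} \<in> sets \<mu>"
proof -
  obtain \<alpha> where "p \<in> X \<alpha>" using assms space_eq by blast
  moreover have "standard_measure_space (\<nu> \<alpha>)"
    using measures[unfolded locally_standard_measure_space_def, THEN conjunct1] by (rule spec)
  ultimately show ?thesis by (intro sets_\<nu>_sub[of _ \<alpha>] singleton_in_standard_sets)
qed

text \<open>The empty set is the only null set of a counting measure.\<close>

lemma AE_everywhere:
  assumes "AE p in \<mu>. P p" "p \<in> space \<mu>"
  shows "P p"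
proof (rule ccontr)
  assume "\<not> P p"
  obtain N where N: "{p \<in> space \<mu>. \<not> P p} \<subseteq> N" "emeasure \<mu> N = 0" "N \<in> sets \<mu>"
    using AE_E[OF assms(1)] by blast
  then have "emeasure (count_space (space \<mu>)) N = 0" using counting by simp
  then have "N = {}"
    using sets.sets_into_space[OF N(3)] by (simp add: emeasure_count_space split: if_splits)
  then show False using N(1) assms(2) \<open>\<not> P p\<close> by blast
qed

definition point_section :: "'x \<Rightarrow> 'v \<Rightarrow> 'x \<Rightarrow> 'v" where
  "point_section p x = (\<lambda>q\<in>space \<mu>. if q = p then x else \<zero>\<^bsub>\<D> q\<^esub>)"

lemma point_section_apply: "q \<in> space \<mu> \<Longrightarrow> point_section p x q = (if q = p then x else \<zero>\<^bsub>\<D> q\<^esub>)"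
  by (simp add: point_section_def)

lemma ip_point_section:
  assumes "u \<in> U" "p \<in> space \<mu>" "q \<in> space \<mu>"
  shows "ip (\<D> q) (u q) (point_section p x q) = indicator {p} q *\<^sub>R ip (\<D> p) (u p) x"
  using assms complex_inner_product_space.ip_zero_right[OF cips U_carrier]
  by (simp add: point_section_apply indicator_def)

lemma measure_singleton: "p \<in> space \<mu> \<Longrightarrow> emeasure (completion \<mu>) {p} = 1"
  using counting[OF singleton_sets, of p] singleton_sets[of p] by simp

lemma integrable_point:
  fixes c :: complex
  shows "p \<in> space \<mu> \<Longrightarrow> integrable (completion \<mu>) (\<lambda>q. indicator {p} q *\<^sub>R c)"
  using measure_singleton[of p] singleton_sets[of p]
  by (intro integrable_scaleR_left integrable_real_indicator) auto

lemma integral_point: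
  fixes c :: complex
  assumes "p \<in> space \<mu>"
  shows "(\<integral>q. indicator {p} q *\<^sub>R c \<partial>completion \<mu>) = c"
proof -
  have "measure (completion \<mu>) {p} = 1" using measure_singleton[OF assms] by (simp add: measure_def)
  then show ?thesis
    using measure_singleton[OF assms] singleton_sets[OF assms] assms
    by (subst integral_scaleR_left) (auto intro!: integrable_real_indicator)
qed

text \<open>Pairing with any section gives a function carried by a single point of measure 1, so
  maximality puts every vector of every fibre into the direct integral as a one-point
  section.\<close>

lemma point_section_U:
  assumes p: "p \<in> space \<mu>" and x: "x \<in> carrier (\<D> p)"
  shows "point_section p x \<in> U"
proof -
  obtain \<alpha> where \<alpha>: "p \<in> X \<alpha>" "x \<in> \<H> \<alpha> p" using cofinal[OF p x] by blast
  show ?thesis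
  proof (rule U_memberI)
    show "point_section p x \<in> (\<Pi>\<^sub>E p\<in>space \<mu>. carrier (\<D> p))"
      using x zero_carrier unfolding point_section_def restrict_PiE_iff by auto
    show "supported_at_level \<nu> \<mu> \<D> \<H> \<alpha> (point_section p x)"
      using \<alpha> X_sub[of \<alpha>] zero_\<H>
      by (auto simp: supported_at_level_def point_section_apply subset_iff split: if_splits)
    fix u assume "u \<in> U"
    then show "integrable (completion \<mu>) (\<lambda>q. ip (\<D> q) (u q) (point_section p x q))"
      using integrable_point[OF p, of "ip (\<D> p) (u p) x"]
      by (subst Bochner_Integration.integrable_cong[OF refl, of _ _ "\<lambda>q. indicator {p} q *\<^sub>R ip (\<D> p) (u p) x"])
        (auto simp: ip_point_section[OF _ p])
  qed
qed

text \<open>Pairing with one-point sections reads off fibre inner products, which carries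
  orthogonality back from sections to fibres.\<close>

lemma integral_ip_point_section:
  assumes "u \<in> U" "p \<in> space \<mu>"
  shows "(\<integral>q. ip (\<D> q) (u q) (point_section p x q) \<partial>completion \<mu>) = ip (\<D> p) (u p) x"
  using integral_point[OF assms(2), of "ip (\<D> p) (u p) x"]
  by (subst Bochner_Integration.integral_cong[OF refl, of _ _ "\<lambda>q. indicator {p} q *\<^sub>R ip (\<D> p) (u p) x"])
    (auto simp: ip_point_section[OF assms])

lemma point_section_lev:
  assumes p: "p \<in> X \<alpha>" and x: "x \<in> \<H> \<alpha> p"
  shows "point_section p x \<in> lev \<alpha>"
proof -
  have "p \<in> space \<mu>" using p X_sub by blast
  then show ?thesis
    using assms point_section_U[of p x] \<H>_sub[of p \<alpha>] zero_\<H>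
    by (auto simp: lev_def point_section_apply)
qed

definition fibre_op :: "'x \<Rightarrow> 'v \<Rightarrow> 'v" where
  "fibre_op p = (\<lambda>x\<in>carrier (\<D> p). \<tau> (point_section p x) p)"

text \<open>Each property of \<tau> is evaluated on one-point sections; almost everywhere means
  everywhere here, so the relations hold at \<open>p\<close> itself.\<close>

lemma fibre_op_locally_bounded:
  assumes p: "p \<in> space \<mu>"
  shows "fibre_op p \<in> locally_bounded_operators (\<D> p) {\<alpha>. p \<in> X \<alpha>} (\<lambda>\<alpha>. \<H> \<alpha> p)"
proof -
  interpret D: complex_inner_product_space "\<D> p" by (rule cips[OF p])
  let ?L = "\<lambda>x. \<tau> (point_section p x) p"
  have L: "?L x \<in> carrier (\<D> p)" if "x \<in> carrier (\<D> p)" for x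
    by (rule U_carrier[OF \<tau>_U[OF point_section_U[OF p that]] p])
  have lin: "?L (a \<odot>\<^bsub>\<D> p\<^esub> x \<oplus>\<^bsub>\<D> p\<^esub> y) = a \<odot>\<^bsub>\<D> p\<^esub> ?L x \<oplus>\<^bsub>\<D> p\<^esub> ?L y"
    if xy: "x \<in> carrier (\<D> p)" "y \<in> carrier (\<D> p)" for a x y
  proof -
    have "point_section p (a \<odot>\<^bsub>\<D> p\<^esub> x \<oplus>\<^bsub>\<D> p\<^esub> y) = lincomb a (point_section p x) (point_section p y)"
      using xy p by (intro U_eqI)
        (auto simp: point_section_U lincomb_U point_section_apply lincomb_apply fibre_lincomb)
    then show ?thesis
      using AE_everywhere[OF \<tau>_lincomb[of "point_section p x" "point_section p y" a] p] xy p
      by (simp add: point_section_U lincomb_apply)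
  qed
  show ?thesis
    unfolding locally_bounded_operators_def
  proof (intro CollectI conjI ballI allI)
    show "fibre_op p \<in> carrier (\<D> p) \<rightarrow>\<^sub>E carrier (\<D> p)" using L by (simp add: fibre_op_def)
    show "fibre_op p (x \<oplus>\<^bsub>\<D> p\<^esub> y) = fibre_op p x \<oplus>\<^bsub>\<D> p\<^esub> fibre_op p y"
      if "x \<in> carrier (\<D> p)" "y \<in> carrier (\<D> p)" for x y
      using D.linear_if_lincomb(1)[of ?L, OF L lin that] that by (simp add: fibre_op_def)
    show "fibre_op p (a \<odot>\<^bsub>\<D> p\<^esub> x) = a \<odot>\<^bsub>\<D> p\<^esub> fibre_op p x" if "x \<in> carrier (\<D> p)" for a x
      using D.linear_if_lincomb(2)[of ?L, OF L lin that] that by (simp add: fibre_op_def)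
    fix \<alpha> assume "\<alpha> \<in> {\<alpha>. p \<in> X \<alpha>}"
    then have \<alpha>: "p \<in> X \<alpha>" by simp
    have sub: "x \<in> carrier (\<D> p)" if "x \<in> \<H> \<alpha> p" for x using \<H>_sub[OF p] that by blast
    show "fibre_op p ` \<H> \<alpha> p \<subseteq> \<H> \<alpha> p"
      using AE_everywhere[OF levD(2)[OF \<tau>_lev[OF point_section_lev[OF \<alpha>]]] p] \<alpha> sub
      by (auto simp: fibre_op_def)
    show "fibre_op p ` orth (\<D> p) (\<H> \<alpha> p) \<subseteq> orth (\<D> p) (\<H> \<alpha> p)"
    proof clarify
      fix x assume x: "x \<in> orth (\<D> p) (\<H> \<alpha> p)"
      then have xc: "x \<in> carrier (\<D> p)" by (simp add: orth_def)
      \<comment> \<open>Orthogonality of \<open>x\<close> to \<open>\<H> \<alpha> p\<close> makes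
        its one-point section orthogonal to the whole level, to which the invariance under
        \<open>T\<close> applies.\<close>
      have "(\<integral>q. ip (\<D> q) (point_section p x q) (w q) \<partial>completion \<mu>) = 0" if w: "w \<in> lev \<alpha>" for w
      proof -
        have "w p \<in> \<H> \<alpha> p" using AE_everywhere[OF levD(2)[OF w] p] \<alpha> by blast
        then have "ip (\<D> p) x (w p) = 0" using x by (simp add: orth_def)
        then have "ip (\<D> q) (point_section p x q) (w q) = 0" if "q \<in> space \<mu>" for q
          using that complex_inner_product_space.ip_zero_left[OF cips U_carrier[OF levD(1)[OF w]]]
          by (simp add: point_section_apply)
        then have "(\<integral>q. ip (\<D> q) (point_section p x q) (w q) \<partial>completion \<mu>) = (\<integral>q. 0 \<partial>completion \<mu>)"
          by (intro Bochner_Integration.integral_cong) auto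
        then show ?thesis by simp
      qed
      then have "(\<integral>q. ip (\<D> q) (\<tau> (point_section p x) q) (point_section p y q) \<partial>completion \<mu>) = 0"
        if "y \<in> \<H> \<alpha> p" for y
        using \<tau>_orth[OF point_section_U[OF p xc] _ point_section_lev[OF \<alpha> that]] by blast
      then have "ip (\<D> p) (?L x) y = 0" if "y \<in> \<H> \<alpha> p" for y
        using that by (simp add: integral_ip_point_section[OF \<tau>_U[OF point_section_U[OF p xc]] p])
      then show "fibre_op p x \<in> orth (\<D> p) (\<H> \<alpha> p)" using L xc by (simp add: orth_def fibre_op_def)
    qed
    obtain c where c: "\<forall>u\<in>lev \<alpha>. AE p in \<mu>. ip_norm (\<D> p) (\<tau> u p) \<le> c * ip_norm (\<D> p) (u p)"
      using \<tau>_pointwise_bound by blast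
    have "ip_norm (\<D> p) (fibre_op p x) \<le> c * ip_norm (\<D> p) x" if "x \<in> \<H> \<alpha> p" for x
      using AE_everywhere[OF bspec[OF c point_section_lev[OF \<alpha> that]] p] sub[OF that] p
      by (simp add: fibre_op_def point_section_apply)
    then show "\<exists>c. \<forall>x\<in>\<H> \<alpha> p. ip_norm (\<D> p) (fibre_op p x) \<le> c * ip_norm (\<D> p) x" by blast
  qed
qed

text \<open>Cutting \<open>u\<close> to \<open>{p}\<close> leaves the one-point section of
  \<open>u p\<close>, and \<tau> commutes with this cut.\<close>

lemma decomposable_if_counting: "T \<in> decomposable_operators \<nu> \<mu> \<D> \<H> U"
proof -
  have "AE p in \<mu>. \<tau> u p = fibre_op p (u p)" if u: "u \<in> U" for u
  proof (rule AE_I2)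
    fix p assume p: "p \<in> space \<mu>"
    have "cut {p} u = point_section p (u p)"
      by (auto simp: cut_def point_section_def restrict_def)
    then show "\<tau> u p = fibre_op p (u p)"
      using AE_everywhere[OF \<tau>_cut[OF u singleton_sets[OF p]] p] p U_carrier[OF u p]
      by (simp add: fibre_op_def cut_apply)
  qed
  then show ?thesis
    unfolding decomposable_operators_def
    using T fibre_op_locally_bounded AE_T_iff[where F = fibre_op] by blast
qed

end

section \<open>Countable index sets\<close>

locale countable_operator = commuting_operator \<nu> \<mu> \<D> \<H> U T
  for \<nu> :: "'i::order \<Rightarrow> 'x measure" and \<mu> :: "'x measure"
    and \<D> :: "'x \<Rightarrow> 'v inner_space" and \<H> :: "'i \<Rightarrow> 'x \<Rightarrow> 'v set" and U :: "('x \<Rightarrow> 'v) set"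
    and T :: "('x \<Rightarrow> 'v) set \<Rightarrow> ('x \<Rightarrow> 'v) set" +
  assumes countable_index: "countable (UNIV :: 'i set)"
    and classical: "level_is_classical_direct_integral \<nu> \<mu> \<D> \<H> U \<alpha>"
begin

section \<open>Countable dense families of sections\<close>

lemma countable_dense_family:
  "\<exists>S \<subseteq> lev \<alpha>. countable S \<and>
     (\<forall>u\<in>lev \<alpha>. \<forall>\<epsilon>>0. \<exists>s\<in>S. (\<integral>p. norm2 (lincomb (-1) s u) p \<partial>completion \<mu>) < \<epsilon>)"
proof -
  interpret V: complex_inner_product_space V by (rule cips_V)
  have sub: "level \<alpha> \<subseteq> carrier V" using levD(1) by (auto simp: level_eq carrier_V)
  interpret MS: Metric_space "level \<alpha>" "ip_dist V" by (rule V.Metric_space_ip_dist[OF sub])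
  have "separable_space MS.mtopology"
    using classical[of \<alpha>] unfolding level_is_classical_direct_integral_def separable_subset_def by simp
  then obtain C where C: "countable C" "C \<subseteq> level \<alpha>" "Abstract_Topology.closure_of MS.mtopology C = level \<alpha>"
    unfolding separable_space_def by auto
  have "\<forall>A\<in>C. \<exists>u. u \<in> lev \<alpha> \<and> cls u = A" using C(2) by (auto simp: level_eq)
  then obtain g where g: "\<And>A. A \<in> C \<Longrightarrow> g A \<in> lev \<alpha>" "\<And>A. A \<in> C \<Longrightarrow> cls (g A) = A" by metis
  show ?thesis
  proof (intro exI[of _ "g ` C"] conjI ballI allI impI)
    show "g ` C \<subseteq> lev \<alpha>" using g by blast
    show "countable (g ` C)" using C by simp
    fix u and \<epsilon> :: real assume u: "u \<in> lev \<alpha>" and "\<epsilon> > 0"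
    have "cls u \<in> Abstract_Topology.closure_of MS.mtopology C" using u C(3) level_eq by simp
    \<comment> \<open>The integral of \<open>norm2\<close> is the square of the distance, so the
      ball must have radius \<open>sqrt \<epsilon>\<close>.\<close>
    moreover have "sqrt \<epsilon> > 0" using \<open>\<epsilon> > 0\<close> by simp
    ultimately obtain A where "A \<in> C" "A \<in> MS.mball (cls u) (sqrt \<epsilon>)"
      unfolding MS.metric_closure_of by blast
    then have A: "A \<in> C" "ip_dist V (cls u) A < sqrt \<epsilon>" by simp_all
    let ?d = "lincomb (-1) (g A) u"
    have U: "u \<in> U" "g A \<in> U" using u g A levD(1) by blast+
    then have dU: "?d \<in> U" by (simp add: lincomb_U)
    have "ip_dist V (cls u) A = ip_norm V (cls ?d)"
      using g(2)[OF A(1)] minus_V[OF U] U by (auto simp: ip_dist_def carrier_V)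
    then have "ip_norm V (cls ?d) < sqrt \<epsilon>" using A(2) by simp
    then have "(ip_norm V (cls ?d))\<^sup>2 < (sqrt \<epsilon>)\<^sup>2"
      using dU by (intro power_strict_mono) (auto simp: carrier_V)
    then have "(\<integral>p. norm2 ?d p \<partial>completion \<mu>) < \<epsilon>" using dU \<open>\<epsilon> > 0\<close> by (simp add: ip_norm_V)
    then show "\<exists>s\<in>g ` C. (\<integral>p. norm2 (lincomb (-1) s u) p \<partial>completion \<mu>) < \<epsilon>" using A(1) by blast
  qed
qed

definition dense_family :: "'i \<Rightarrow> ('x \<Rightarrow> 'v) set" where
  "dense_family \<alpha> = (SOME S. S \<subseteq> lev \<alpha> \<and> countable S \<and>
     (\<forall>u\<in>lev \<alpha>. \<forall>\<epsilon>>0. \<exists>s\<in>S. (\<integral>p. norm2 (lincomb (-1) s u) p \<partial>completion \<mu>) < \<epsilon>))"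

lemma dense_family: "dense_family \<alpha> \<subseteq> lev \<alpha>" "countable (dense_family \<alpha>)"
  "\<lbrakk>u \<in> lev \<alpha>; \<epsilon> > 0\<rbrakk> \<Longrightarrow> \<exists>s\<in>dense_family \<alpha>. (\<integral>p. norm2 (lincomb (-1) s u) p \<partial>completion \<mu>) < \<epsilon>"
proof -
  have "dense_family \<alpha> \<subseteq> lev \<alpha> \<and> countable (dense_family \<alpha>) \<and>
     (\<forall>u\<in>lev \<alpha>. \<forall>\<epsilon>>0. \<exists>s\<in>dense_family \<alpha>. (\<integral>p. norm2 (lincomb (-1) s u) p \<partial>completion \<mu>) < \<epsilon>)"
    unfolding dense_family_def by (rule someI_ex[OF countable_dense_family])
  then show "dense_family \<alpha> \<subseteq> lev \<alpha>" "countable (dense_family \<alpha>)"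
    "\<lbrakk>u \<in> lev \<alpha>; \<epsilon> > 0\<rbrakk> \<Longrightarrow> \<exists>s\<in>dense_family \<alpha>. (\<integral>p. norm2 (lincomb (-1) s u) p \<partial>completion \<mu>) < \<epsilon>"
    by blast+
qed

text \<open>Making the dense families increase with the level lets the fibre operators of different
  levels be compared on a common dense set.\<close>

definition dense_sections :: "'i \<Rightarrow> ('x \<Rightarrow> 'v) set" where "dense_sections \<alpha> = (\<Union>\<beta>\<in>{..\<alpha>}. dense_family \<beta>)"

lemma dense_sections_lev: "s \<in> dense_sections \<alpha> \<Longrightarrow> s \<in> lev \<alpha>"
  unfolding dense_sections_def using dense_family(1) lev_mono by blast

lemma dense_sections_mono: "\<alpha> \<le> \<beta> \<Longrightarrow> dense_sections \<alpha> \<subseteq> dense_sections \<beta>"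
  unfolding dense_sections_def by force

lemma countable_dense_sections: "countable (dense_sections \<alpha>)"
  unfolding dense_sections_def using dense_family(2) countable_subset[OF subset_UNIV countable_index] by (intro countable_UN) auto

lemma dense_sections_U: "s \<in> dense_sections \<alpha> \<Longrightarrow> s \<in> U"
  using dense_sections_lev levD(1) by blast

abbreviation fibre_dense :: "'i \<Rightarrow> 'x \<Rightarrow> 'v set" where "fibre_dense \<alpha> p \<equiv> (\<lambda>s. s p) ` dense_sections \<alpha>"

abbreviation adh :: "'x \<Rightarrow> 'v set \<Rightarrow> 'v set" where
  "adh p \<equiv> complex_inner_product_space.adherence (\<D> p)"

text \<open>The exceptional null set depends on \<open>u\<close>, so this alone does not show that
  the values are dense in almost every fibre.\<close>

lemma AE_in_adherence:
  assumes u: "u \<in> lev \<alpha>"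
  shows "AE p in \<mu>. u p \<in> adh p (fibre_dense \<alpha> p)"
proof (rule AE_adherence)
  show "dense_sections \<alpha> \<subseteq> U" using dense_sections_U by blast
  show "u \<in> U" by (rule levD(1)[OF u])
  show "\<exists>s\<in>dense_sections \<alpha>. (\<integral>p. norm2 (lincomb (-1) s u) p \<partial>completion \<mu>) < \<epsilon>" if "\<epsilon> > 0" for \<epsilon>
    using dense_family(3)[OF u that] unfolding dense_sections_def by blast
qed

lemma dense_sections_nonempty: "dense_sections \<alpha> \<noteq> {}"
proof -
  have "zero_section \<in> lev \<alpha>"
    using zero_section_U zero_\<H> by (auto simp: lev_def zero_section_apply)
  then show ?thesis using dense_family(3)[of zero_section \<alpha> 1] unfolding dense_sections_def by auto
qed

section \<open>Density of the values in almost every fibre\<close>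

lemma fibre_dense_carrier: "p \<in> space \<mu> \<Longrightarrow> fibre_dense \<alpha> p \<subseteq> carrier (\<D> p)"
  using U_carrier dense_sections_U by blast

lemma AE_orth_trivial:
  "AE p in \<mu>. p \<in> X \<alpha> \<longrightarrow> (\<forall>x\<in>\<H> \<alpha> p. (\<forall>y\<in>fibre_dense \<alpha> p. ip (\<D> p) y x = 0) \<longrightarrow> x = \<zero>\<^bsub>\<D> p\<^esub>)"
proof -
  define P where "P p x \<longleftrightarrow> x \<in> \<H> \<alpha> p \<and> (\<forall>y\<in>fibre_dense \<alpha> p. ip (\<D> p) y x = 0)" for p x
  \<comment> \<open>A field that is nonzero at exactly those points of \<open>X \<alpha>\<close>
    where a nonzero orthogonal vector exists. It is an arbitrary choice; its measurability will come
    from maximality at level \<alpha>.\<close>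
  define v where "v = (\<lambda>p\<in>X \<alpha>. if \<exists>x. P p x \<and> x \<noteq> \<zero>\<^bsub>\<D> p\<^esub> then SOME x. P p x \<and> x \<noteq> \<zero>\<^bsub>\<D> p\<^esub> else \<zero>\<^bsub>\<D> p\<^esub>)"
  have v: "P p (v p)" "(\<exists>x. P p x \<and> x \<noteq> \<zero>\<^bsub>\<D> p\<^esub>) \<Longrightarrow> v p \<noteq> \<zero>\<^bsub>\<D> p\<^esub>" if p: "p \<in> X \<alpha>" for p
  proof -
    have pm: "p \<in> space \<mu>" using p X_sub by blast
    have P0: "P p \<zero>\<^bsub>\<D> p\<^esub>"
      using zero_\<H>[OF pm] complex_inner_product_space.ip_zero_right[OF cips[OF pm]]
        U_carrier[OF dense_sections_U pm] by (auto simp: P_def)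
    have *: "P p (v p) \<and> v p \<noteq> \<zero>\<^bsub>\<D> p\<^esub>" if ex: "\<exists>x. P p x \<and> x \<noteq> \<zero>\<^bsub>\<D> p\<^esub>"
      using someI_ex[OF ex] ex p by (simp add: v_def)
    then show "(\<exists>x. P p x \<and> x \<noteq> \<zero>\<^bsub>\<D> p\<^esub>) \<Longrightarrow> v p \<noteq> \<zero>\<^bsub>\<D> p\<^esub>" by blast
    show "P p (v p)"
    proof (cases "\<exists>x. P p x \<and> x \<noteq> \<zero>\<^bsub>\<D> p\<^esub>")
      case True
      then show ?thesis using * by blast
    next
      case False
      then have "v p = \<zero>\<^bsub>\<D> p\<^esub>" using p unfolding v_def by (simp only: restrict_apply if_True if_False)
      then show ?thesis using P0 by simp
    qed
  qed
  have vpi: "v \<in> (\<Pi>\<^sub>E p\<in>X \<alpha>. \<H> \<alpha> p)"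
  proof (rule PiE_I)
    show "v p \<in> \<H> \<alpha> p" if "p \<in> X \<alpha>" for p using v(1)[OF that] unfolding P_def by (rule conjunct1)
    show "v p = undefined" if "p \<notin> X \<alpha>" for p using that by (simp add: v_def)
  qed
  have orth: "AE p in \<mu>. p \<in> X \<alpha> \<longrightarrow> ip (\<D> p) (u p) (v p) = 0" if u: "u \<in> lev \<alpha>" for u
    using AE_in_adherence[OF u] AE_space
  proof eventually_elim
    case (elim p)
    show ?case
    proof
      assume p: "p \<in> X \<alpha>"
      show "ip (\<D> p) (u p) (v p) = 0"
        by (rule complex_inner_product_space.ip_eq_zero_adherence[OF cips[OF elim(2)] elim(1) fibre_dense_carrier[OF elim(2)]])
          (use v(1)[OF p] \<H>_sub[OF elim(2)] in \<open>auto simp: P_def\<close>)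
    qed
  qed
  have "integrable (completion (\<nu> \<alpha>)) (\<lambda>p. ip (\<D> p) (u p) (v p))"
    if u: "u \<in> U" "supported_at_level \<nu> \<mu> \<D> \<H> \<alpha> u" for u
  proof (rule integrable_completion_AE_cong[of _ "\<lambda>_. 0"])
    have "AE p in \<nu> \<alpha>. ip (\<D> p) (u p) (v p) = 0"
      using orth[OF supported_lev[OF u]] by (simp only: AE_\<nu>_iff)
    then show "AE p in \<nu> \<alpha>. 0 = ip (\<D> p) (u p) (v p)" by (rule eventually_mono) simp
  qed simp
  then obtain w where w: "w \<in> U" "supported_at_level \<nu> \<mu> \<D> \<H> \<alpha> w" "AE p in \<nu> \<alpha>. w p = v p"
    using classical[of \<alpha>] vpi unfolding level_is_classical_direct_integral_def by blast
  have "AE p in \<mu>. p \<in> X \<alpha> \<longrightarrow> w p = v p" using w(3) by (simp add: AE_\<nu>_iff)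
  \<comment> \<open>The field is orthogonal to every section of the level, in particular to its own
    representative \<open>w\<close>, so it has norm zero almost everywhere.\<close>
  with orth[OF supported_lev[OF w(1,2)]] AE_space show ?thesis
  proof eventually_elim
    case (elim p)
    show ?case
    proof (intro impI ballI)
      fix x assume p: "p \<in> X \<alpha>" and x: "x \<in> \<H> \<alpha> p" "\<forall>y\<in>fibre_dense \<alpha> p. ip (\<D> p) y x = 0"
      have "v p \<in> carrier (\<D> p)" using v(1)[OF p] \<H>_sub[OF elim(2)] by (auto simp: P_def)
      then have "v p = \<zero>\<^bsub>\<D> p\<^esub>"
        using elim p complex_inner_product_space.ip_definite[OF cips[OF elim(2)], of "v p"] by simp
      then show "x = \<zero>\<^bsub>\<D> p\<^esub>" using v(2)[OF p] x by (auto simp: P_def)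
    qed
  qed
qed

text \<open>Countable, so that conditions for all these scalars share one null set; dense, so that
  limits reach every complex number; and containing 0, as the extension of operators
  requires.\<close>

definition scalars :: "complex set" where
  "scalars = insert 0 (SOME D. countable D \<and> closure D = UNIV)"

lemma scalars: "countable scalars" "closure scalars = UNIV" "0 \<in> scalars"
proof -
  obtain D :: "complex set" where "countable D" "closure D = UNIV"
  proof -
    obtain D :: "complex set" where D: "countable D" "\<And>Y. \<lbrakk>open Y; Y \<noteq> {}\<rbrakk> \<Longrightarrow> \<exists>d\<in>D. d \<in> Y"
      using countable_dense_exists by metis
    then have "closure D = UNIV"
      by (metis (no_types, lifting) Compl_iff UNIV_eq_I closed_closure closure_subset double_complement open_Compl
          subsetD empty_iff)
    then show thesis using that D by blast
  qed
  then have "countable (SOME D :: complex set. countable D \<and> closure D = UNIV) \<and>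
      closure (SOME D :: complex set. countable D \<and> closure D = UNIV) = UNIV"
    by (intro someI[where P = "\<lambda>D. countable D \<and> closure D = UNIV"]) blast
  then show "countable scalars" "closure scalars = UNIV" "0 \<in> scalars"
    by (auto simp: scalars_def closure_insert)
qed

lemma AE_dense_sections_in_\<H>: "AE p in \<mu>. p \<in> X \<alpha> \<longrightarrow> (\<forall>s\<in>dense_sections \<alpha>. s p \<in> \<H> \<alpha> p \<and> \<tau> s p \<in> \<H> \<alpha> p)"
proof -
  have "AE p in \<mu>. p \<in> X \<alpha> \<longrightarrow> s p \<in> \<H> \<alpha> p \<and> \<tau> s p \<in> \<H> \<alpha> p" if "s \<in> dense_sections \<alpha>" for s
    using levD(2)[OF dense_sections_lev[OF that]] levD(2)[OF \<tau>_lev[OF dense_sections_lev[OF that]]] by eventually_elim blast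
  then have "AE p in \<mu>. \<forall>s\<in>dense_sections \<alpha>. p \<in> X \<alpha> \<longrightarrow> s p \<in> \<H> \<alpha> p \<and> \<tau> s p \<in> \<H> \<alpha> p"
    unfolding AE_ball_countable[OF countable_dense_sections] by (rule ballI)
  then show ?thesis by (rule eventually_mono) blast
qed

text \<open>The dense sections need not be closed under combinations, but each combination is a
  section of the level and hence takes values in the adherence almost everywhere. Only countably
  many combinations have to be considered.\<close>

lemma AE_adherence_eq: "AE p in \<mu>. p \<in> X \<alpha> \<longrightarrow> adh p (fibre_dense \<alpha> p) = \<H> \<alpha> p"
proof -
  have "AE p in \<mu>. lincomb q s t p \<in> adh p (fibre_dense \<alpha> p)" if "s \<in> dense_sections \<alpha>" "t \<in> dense_sections \<alpha>" for q s t
    using that by (intro AE_in_adherence lincomb_lev dense_sections_lev)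
  then have "AE p in \<mu>. \<forall>q\<in>scalars. \<forall>s\<in>dense_sections \<alpha>. \<forall>t\<in>dense_sections \<alpha>. lincomb q s t p \<in> adh p (fibre_dense \<alpha> p)"
    by (auto simp: AE_ball_countable countable_dense_sections scalars(1))
  with AE_dense_sections_in_\<H>[of \<alpha>] AE_orth_trivial[of \<alpha>] AE_space show ?thesis
  proof eventually_elim
    case (elim p)
    interpret D: complex_inner_product_space "\<D> p" by (rule cips[OF elim(3)])
    show ?case
    proof
      assume p: "p \<in> X \<alpha>"
      show "adh p (fibre_dense \<alpha> p) = \<H> \<alpha> p"
        by (rule D.adherence_eq_if_orth_trivial[OF closed_subspace_\<H>[OF elim(3)] _ _ scalars(2)])
          (use elim p dense_sections_nonempty in \<open>auto simp: lincomb_apply\<close>)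
    qed
  qed
qed

section \<open>Fibre operators at each level and their gluing\<close>

definition level_bound :: "'i \<Rightarrow> real" where
  "level_bound \<alpha> = (SOME c. c \<ge> 0 \<and> (\<forall>u\<in>lev \<alpha>. AE p in \<mu>. ip_norm (\<D> p) (\<tau> u p) \<le> c * ip_norm (\<D> p) (u p)))"

text \<open>The constant depends on the level alone, which makes it usable for all dense sections
  and all points simultaneously.\<close>

lemma level_bound: "u \<in> lev \<alpha> \<Longrightarrow> AE p in \<mu>. ip_norm (\<D> p) (\<tau> u p) \<le> level_bound \<alpha> * ip_norm (\<D> p) (u p)"
  using someI_ex[OF \<tau>_pointwise_bound[of \<alpha>]] unfolding level_bound_def[symmetric] by blast

text \<open>The level bound for the section \<open>k - (q i + j)\<close>, combined with linearity of
  \<tau> almost everywhere. This is the inequality from which the fibre operator is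
  extended.\<close>

lemma AE_bound:
  assumes "i \<in> lev \<alpha>" "j \<in> lev \<alpha>" "k \<in> lev \<alpha>"
  shows "AE p in \<mu>. ip_norm (\<D> p) (\<tau> k p \<ominus>\<^bsub>\<D> p\<^esub> (q \<odot>\<^bsub>\<D> p\<^esub> \<tau> i p \<oplus>\<^bsub>\<D> p\<^esub> \<tau> j p))
    \<le> level_bound \<alpha> * ip_norm (\<D> p) (k p \<ominus>\<^bsub>\<D> p\<^esub> (q \<odot>\<^bsub>\<D> p\<^esub> i p \<oplus>\<^bsub>\<D> p\<^esub> j p))"
proof -
  note U = assms[THEN levD(1)]
  let ?l = "lincomb q i j"
  have l: "?l \<in> U" using U by (simp add: lincomb_U)
  from \<tau>_lincomb[OF l U(3), of "-1"] \<tau>_lincomb[OF U(1,2), of q]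
    level_bound[OF lincomb_lev[OF lincomb_lev[OF assms(1,2)] assms(3)], of "-1" q] AE_space
  show ?thesis
  proof eventually_elim
    case (elim p)
    have c: "i p \<in> carrier (\<D> p)" "j p \<in> carrier (\<D> p)" "k p \<in> carrier (\<D> p)"
      "\<tau> i p \<in> carrier (\<D> p)" "\<tau> j p \<in> carrier (\<D> p)" "\<tau> k p \<in> carrier (\<D> p)"
      using U \<tau>_U U_carrier elim(4) by blast+
    have "lincomb (-1) ?l k p = k p \<ominus>\<^bsub>\<D> p\<^esub> (q \<odot>\<^bsub>\<D> p\<^esub> i p \<oplus>\<^bsub>\<D> p\<^esub> j p)"
      using c elim(4) by (simp add: lincomb_apply minus_fibre fibre_lincomb)
    moreover have "\<tau> (lincomb (-1) ?l k) p = \<tau> k p \<ominus>\<^bsub>\<D> p\<^esub> (q \<odot>\<^bsub>\<D> p\<^esub> \<tau> i p \<oplus>\<^bsub>\<D> p\<^esub> \<tau> j p)"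
      using c elim by (simp add: lincomb_apply minus_fibre fibre_lincomb)
    ultimately show ?case using elim(3) by simp
  qed
qed

definition fibre_extension :: "'i \<Rightarrow> 'x \<Rightarrow> ('v \<Rightarrow> 'v) \<Rightarrow> bool" where
  "fibre_extension \<alpha> p L \<longleftrightarrow> complex_inner_product_space.bounded_op (\<D> p) (\<H> \<alpha> p) L (level_bound \<alpha>) \<and>
     (\<forall>s\<in>dense_sections \<alpha>. s p \<in> \<H> \<alpha> p \<and> L (s p) = \<tau> s p) \<and> adh p (fibre_dense \<alpha> p) = \<H> \<alpha> p"

text \<open>For each level finitely many countable quantifiers are moved inside; countability of the
  index set then places all levels under one null set.\<close>

lemma AE_fibre_extension: "AE p in \<mu>. \<forall>\<alpha>. p \<in> X \<alpha> \<longrightarrow> (\<exists>L. fibre_extension \<alpha> p L)"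
proof -
  have "AE p in \<mu>. p \<in> X \<alpha> \<longrightarrow> (\<exists>L. fibre_extension \<alpha> p L)" for \<alpha>
  proof -
    have "AE p in \<mu>. \<forall>q\<in>scalars. \<forall>i\<in>dense_sections \<alpha>. \<forall>j\<in>dense_sections \<alpha>. \<forall>k\<in>dense_sections \<alpha>.
        ip_norm (\<D> p) (\<tau> k p \<ominus>\<^bsub>\<D> p\<^esub> (q \<odot>\<^bsub>\<D> p\<^esub> \<tau> i p \<oplus>\<^bsub>\<D> p\<^esub> \<tau> j p))
        \<le> level_bound \<alpha> * ip_norm (\<D> p) (k p \<ominus>\<^bsub>\<D> p\<^esub> (q \<odot>\<^bsub>\<D> p\<^esub> i p \<oplus>\<^bsub>\<D> p\<^esub> j p))"
      by (simp add: AE_ball_countable countable_dense_sections scalars(1) AE_bound dense_sections_lev)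
    with AE_dense_sections_in_\<H>[of \<alpha>] AE_adherence_eq[of \<alpha>] AE_space show ?thesis
    proof eventually_elim
      case (elim p)
      interpret D: complex_inner_product_space "\<D> p" by (rule cips[OF elim(3)])
      show ?case
      proof
        assume p: "p \<in> X \<alpha>"
        have "\<exists>L. D.bounded_op (\<H> \<alpha> p) L (level_bound \<alpha>) \<and> (\<forall>s\<in>dense_sections \<alpha>. L (s p) = \<tau> s p)"
          by (rule D.bounded_op_extension[OF closed_subspace_\<H>[OF elim(3)] _ _ _ scalars(2,3)])
            (use elim p in auto)
        then show "\<exists>L. fibre_extension \<alpha> p L" using elim p unfolding fibre_extension_def by blast
      qed
    qed
  qed
  then have "AE p in \<mu>. \<forall>\<alpha>\<in>UNIV. p \<in> X \<alpha> \<longrightarrow> (\<exists>L. fibre_extension \<alpha> p L)"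
    unfolding AE_ball_countable[OF countable_index] by (rule ballI)
  then show ?thesis by simp
qed

definition extendable :: "'x \<Rightarrow> bool" where
  "extendable p \<longleftrightarrow> p \<in> space \<mu> \<and> (\<forall>\<alpha>. p \<in> X \<alpha> \<longrightarrow> (\<exists>L. fibre_extension \<alpha> p L))"

lemma AE_extendable: "AE p in \<mu>. extendable p"
  using AE_fibre_extension AE_space by eventually_elim (simp add: extendable_def)

definition level_op :: "'i \<Rightarrow> 'x \<Rightarrow> 'v \<Rightarrow> 'v" where
  "level_op \<alpha> p = (SOME L. fibre_extension \<alpha> p L)"

lemma
  assumes "extendable p" "p \<in> X \<alpha>"
  shows level_op_bounded: "complex_inner_product_space.bounded_op (\<D> p) (\<H> \<alpha> p) (level_op \<alpha> p) (level_bound \<alpha>)"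
    and level_op_dense_sections: "s \<in> dense_sections \<alpha> \<Longrightarrow> level_op \<alpha> p (s p) = \<tau> s p"
    and dense_sections_\<H>: "s \<in> dense_sections \<alpha> \<Longrightarrow> s p \<in> \<H> \<alpha> p"
    and adh_fibre_dense: "adh p (fibre_dense \<alpha> p) = \<H> \<alpha> p"
proof -
  have "\<exists>L. fibre_extension \<alpha> p L" using assms unfolding extendable_def by blast
  then have "fibre_extension \<alpha> p (level_op \<alpha> p)" unfolding level_op_def by (rule someI_ex)
  then show "complex_inner_product_space.bounded_op (\<D> p) (\<H> \<alpha> p) (level_op \<alpha> p) (level_bound \<alpha>)"
    "s \<in> dense_sections \<alpha> \<Longrightarrow> level_op \<alpha> p (s p) = \<tau> s p" "s \<in> dense_sections \<alpha> \<Longrightarrow> s p \<in> \<H> \<alpha> p" "adh p (fibre_dense \<alpha> p) = \<H> \<alpha> p"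
    unfolding fibre_extension_def by simp_all
qed

text \<open>The dense sections increase with the level, so both operators send \<open>s p\<close> to
  \<open>\<tau> s p\<close> on a subset dense in the smaller space.\<close>

lemma level_op_agree:
  assumes p: "extendable p" "p \<in> X \<alpha>" and le: "\<alpha> \<le> \<beta>" and x: "x \<in> \<H> \<alpha> p"
  shows "level_op \<alpha> p x = level_op \<beta> p x"
proof -
  have pm: "p \<in> space \<mu>" using p unfolding extendable_def by blast
  have p\<beta>: "p \<in> X \<beta>" using p X_mono[OF le] by blast
  have "level_op \<alpha> p y = level_op \<beta> p y" if "y \<in> fibre_dense \<alpha> p" for y
    using that dense_sections_mono[OF le] level_op_dense_sections[OF p] level_op_dense_sections[OF p(1) p\<beta>] by auto
  moreover have "fibre_dense \<alpha> p \<subseteq> \<H> \<alpha> p" using dense_sections_\<H>[OF p] by blast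
  ultimately show ?thesis
    using complex_inner_product_space.bounded_op_agree[OF cips[OF pm] closed_subspace_\<H>[OF pm]
        closed_subspace_\<H>[OF pm] \<H>_mono[OF pm le] level_op_bounded[OF p] level_op_bounded[OF p(1) p\<beta>]
        _ adh_fibre_dense[OF p] _ x] by blast
qed

text \<open>The level is an arbitrary one containing the point and the vector; at extendable points
  the choice does not affect the value.\<close>

definition glued_op :: "'x \<Rightarrow> 'v \<Rightarrow> 'v" where
  "glued_op p x = level_op (SOME \<alpha>. p \<in> X \<alpha> \<and> x \<in> \<H> \<alpha> p) p x"

lemma glued_op_eq:
  assumes p: "extendable p" "p \<in> X \<alpha>" and x: "x \<in> \<H> \<alpha> p"
  shows "glued_op p x = level_op \<alpha> p x"
proof -
  let ?\<beta> = "SOME \<alpha>. p \<in> X \<alpha> \<and> x \<in> \<H> \<alpha> p"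
  have "p \<in> X ?\<beta> \<and> x \<in> \<H> ?\<beta> p"
    by (rule someI[where P = "\<lambda>\<alpha>. p \<in> X \<alpha> \<and> x \<in> \<H> \<alpha> p", of \<alpha>]) (use p x in blast)
  moreover obtain \<gamma> where "?\<beta> \<le> \<gamma>" "\<alpha> \<le> \<gamma>" using directed by blast
  ultimately show ?thesis
    using level_op_agree[OF p(1), of ?\<beta> \<gamma> x] level_op_agree[OF p, of \<gamma> x] x unfolding glued_op_def by simp
qed

text \<open>At \<open>p\<close> approximate \<open>u p\<close> by values \<open>s n p\<close> of
  dense sections. Then \<open>\<tau> (s n) p\<close> tends to the fibre operator applied to
  \<open>u p\<close>, by continuity, and to \<open>\<tau> u p\<close>, by the level bound for
  \<open>u - s n\<close>; limits are unique.\<close>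

lemma AE_glued_op:
  assumes u: "u \<in> U"
  shows "AE p in \<mu>. \<tau> u p = glued_op p (u p)"
proof -
  obtain \<alpha> where \<alpha>: "u \<in> lev \<alpha>" using U_lev[OF u] by blast
  have "AE p in \<mu>. p \<in> X \<beta> \<longrightarrow> \<tau> u p = glued_op p (u p)" if u\<beta>: "u \<in> lev \<beta>" for \<beta>
  proof -
    have "AE p in \<mu>. ip_norm (\<D> p) (\<tau> u p \<ominus>\<^bsub>\<D> p\<^esub> \<tau> s p) \<le> level_bound \<beta> * ip_norm (\<D> p) (u p \<ominus>\<^bsub>\<D> p\<^esub> s p)"
      if s: "s \<in> dense_sections \<beta>" for s
      using level_bound[OF lincomb_lev[OF dense_sections_lev[OF s] u\<beta>, of "-1"]] \<tau>_lincomb[OF dense_sections_U[OF s] u, of "-1"] AE_space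
    proof eventually_elim
      case (elim p)
      then show ?case
        using minus_fibre[OF elim(3)] U_carrier[OF _ elim(3)] \<tau>_U dense_sections_U[OF s] u
        by (simp add: lincomb_apply)
    qed
    then have "AE p in \<mu>. \<forall>s\<in>dense_sections \<beta>. ip_norm (\<D> p) (\<tau> u p \<ominus>\<^bsub>\<D> p\<^esub> \<tau> s p)
        \<le> level_bound \<beta> * ip_norm (\<D> p) (u p \<ominus>\<^bsub>\<D> p\<^esub> s p)"
      unfolding AE_ball_countable[OF countable_dense_sections] by (rule ballI)
    with AE_extendable AE_in_adherence[OF u\<beta>] levD(2)[OF u\<beta>] AE_space show ?thesis
    proof eventually_elim
      case (elim p)
      interpret D: complex_inner_product_space "\<D> p" by (rule cips[OF elim(4)])
      show ?case
      proof
        assume p: "p \<in> X \<beta>"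
        have uH: "u p \<in> \<H> \<beta> p" using elim p by blast
        obtain \<sigma> where \<sigma>: "\<And>n. \<sigma> n \<in> fibre_dense \<beta> p" "D.converges \<sigma> (u p)"
          using D.adherence_seq[OF elim(2) fibre_dense_carrier[OF elim(4)]] by blast
        have "\<forall>n. \<exists>s. s \<in> dense_sections \<beta> \<and> \<sigma> n = s p" using \<sigma>(1) by blast
        then obtain s where s: "\<And>n. s n \<in> dense_sections \<beta>" "\<And>n. \<sigma> n = s n p" by metis
        then have \<sigma>_eq: "\<sigma> = (\<lambda>n. s n p)" by blast
        have car: "u p \<in> carrier (\<D> p)" "\<tau> u p \<in> carrier (\<D> p)"
          "s n p \<in> carrier (\<D> p)" "\<tau> (s n) p \<in> carrier (\<D> p)" for n
          using U_carrier[OF _ elim(4)] \<tau>_U u dense_sections_U[OF s(1)] by auto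
        have "D.converges (\<lambda>n. level_op \<beta> p (s n p)) (level_op \<beta> p (u p))"
          by (rule D.bounded_op_converges[OF closed_subspace_\<H>[OF elim(4)] level_op_bounded[OF elim(1) p]])
            (use \<sigma>(2) \<sigma>_eq dense_sections_\<H>[OF elim(1) p s(1)] uH in auto)
        then have 1: "D.converges (\<lambda>n. \<tau> (s n) p) (level_op \<beta> p (u p))"
          using level_op_dense_sections[OF elim(1) p s(1)] by simp
        have 2: "D.converges (\<lambda>n. \<tau> (s n) p) (\<tau> u p)"
          unfolding D.converges_def
        proof (rule real_tendsto_sandwich[where f = "\<lambda>_. 0"])
          show "\<forall>\<^sub>F n in sequentially. ip_norm (\<D> p) (\<tau> (s n) p \<ominus>\<^bsub>\<D> p\<^esub> \<tau> u p)
              \<le> level_bound \<beta> * ip_norm (\<D> p) (s n p \<ominus>\<^bsub>\<D> p\<^esub> u p)"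
          proof (rule always_eventually, rule allI)
            fix n
            show "ip_norm (\<D> p) (\<tau> (s n) p \<ominus>\<^bsub>\<D> p\<^esub> \<tau> u p) \<le> level_bound \<beta> * ip_norm (\<D> p) (s n p \<ominus>\<^bsub>\<D> p\<^esub> u p)"
              using bspec[OF elim(5) s(1)[of n]] D.ip_norm_minus_commute[OF car(3) car(1), of n]
                D.ip_norm_minus_commute[OF car(4) car(2), of n] by simp
          qed
          have "(\<lambda>n. level_bound \<beta> * ip_norm (\<D> p) (s n p \<ominus>\<^bsub>\<D> p\<^esub> u p)) \<longlonglongrightarrow> level_bound \<beta> * 0"
            using \<sigma>(2) unfolding \<sigma>_eq D.converges_def by (intro tendsto_intros)
          then show "(\<lambda>n. level_bound \<beta> * ip_norm (\<D> p) (s n p \<ominus>\<^bsub>\<D> p\<^esub> u p)) \<longlonglongrightarrow> 0" by simp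
        qed (use car in simp_all)
        have "level_op \<beta> p (u p) \<in> \<H> \<beta> p"
          using level_op_bounded[OF elim(1) p] uH unfolding D.bounded_op_def by blast
        then have "level_op \<beta> p (u p) \<in> carrier (\<D> p)" using \<H>_sub[OF elim(4)] by blast
        then have "\<tau> u p = level_op \<beta> p (u p)"
          using D.converges_unique[OF car(4) car(2) _ 2 1] by blast
        then show "\<tau> u p = glued_op p (u p)" using glued_op_eq[OF elim(1) p uH] by simp
      qed
    qed
  qed
  \<comment> \<open>Points outside \<open>X \<alpha>\<close> are covered by higher levels, to which
    \<open>u\<close> also belongs; there are countably many of them.\<close>
  then have "AE p in \<mu>. \<forall>\<beta>\<in>{\<alpha>..}. p \<in> X \<beta> \<longrightarrow> \<tau> u p = glued_op p (u p)"
    unfolding AE_ball_countable[OF countable_subset[OF subset_UNIV countable_index]]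
    using lev_mono[OF \<alpha>] by simp
  with AE_space show ?thesis
  proof eventually_elim
    case (elim p)
    obtain \<beta> where "\<alpha> \<le> \<beta>" "p \<in> X \<beta>" using cofinal[OF elim(1) zero_carrier[OF elim(1)]] by blast
    then show ?case using elim(2) by blast
  qed
qed

section \<open>Transfer of orthogonal complements to the fibres\<close>

lemma projected_section:
  assumes u: "u \<in> U"
  shows "\<exists>w\<in>lev \<alpha>. AE p in \<mu>. p \<in> X \<alpha> \<longrightarrow>
    w p = complex_inner_product_space.orth_proj (\<D> p) (\<H> \<alpha> p) (u p)"
proof -
  let ?P = "\<lambda>p. complex_inner_product_space.orth_proj (\<D> p) (\<H> \<alpha> p)"
  define v where "v = (\<lambda>p\<in>X \<alpha>. ?P p (u p))"
  \<comment> \<open>Against vectors of \<open>\<H> \<alpha> p\<close> the projection pairs exactly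
    as \<open>u p\<close> does. The integrability demanded by maximality is thus inherited from
    \<open>u\<close>.\<close>
  have P: "?P p (u p) \<in> \<H> \<alpha> p" "y \<in> \<H> \<alpha> p \<Longrightarrow> ip (\<D> p) y (?P p (u p)) = ip (\<D> p) y (u p)"
    if p: "p \<in> space \<mu>" for p y
  proof -
    interpret D: complex_inner_product_space "\<D> p" by (rule cips[OF p])
    note H = closed_subspace_\<H>[OF p, of \<alpha>] and up = U_carrier[OF u p]
    show PH: "?P p (u p) \<in> \<H> \<alpha> p" by (rule D.orth_proj_in[OF H up])
    show "ip (\<D> p) y (?P p (u p)) = ip (\<D> p) y (u p)" if y: "y \<in> \<H> \<alpha> p"
    proof -
      have yc: "y \<in> carrier (\<D> p)" "?P p (u p) \<in> carrier (\<D> p)" using y PH \<H>_sub[OF p] by auto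
      have "ip (\<D> p) (u p \<ominus>\<^bsub>\<D> p\<^esub> ?P p (u p)) y = 0" by (rule D.orth_proj_orth[OF H up y])
      then have "ip (\<D> p) y (u p \<ominus>\<^bsub>\<D> p\<^esub> ?P p (u p)) = 0"
        using D.ip_commute[of "u p \<ominus>\<^bsub>\<D> p\<^esub> ?P p (u p)" y] yc up by simp
      then show ?thesis using yc up by (simp add: D.ip_diff_right)
    qed
  qed
  have vpi: "v \<in> (\<Pi>\<^sub>E p\<in>X \<alpha>. \<H> \<alpha> p)"
    unfolding v_def restrict_PiE_iff using P(1) X_sub by blast
  have "integrable (completion (\<nu> \<alpha>)) (\<lambda>p. ip (\<D> p) (w p) (v p))"
    if w: "w \<in> U" "supported_at_level \<nu> \<mu> \<D> \<H> \<alpha> w" for w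
  proof (rule integrable_completion_AE_cong)
    show "integrable (completion (\<nu> \<alpha>)) (\<lambda>p. ip (\<D> p) (w p) (u p))"
      by (subst \<nu>_eq_restrict) (rule integrable_completion_restrict_space[OF U_integrable[OF w(1) u] X_sets])
    have "AE p in \<mu>. p \<in> X \<alpha> \<longrightarrow> w p \<in> \<H> \<alpha> p" using w(2) unfolding supported_at_level_def by blast
    with AE_space have "AE p in \<mu>. p \<in> X \<alpha> \<longrightarrow> ip (\<D> p) (w p) (u p) = ip (\<D> p) (w p) (v p)"
      by eventually_elim (simp add: v_def P(2))
    then show "AE p in \<nu> \<alpha>. ip (\<D> p) (w p) (u p) = ip (\<D> p) (w p) (v p)"
      by (simp only: AE_\<nu>_iff)
  qed
  then obtain w where w: "w \<in> U" "supported_at_level \<nu> \<mu> \<D> \<H> \<alpha> w" "AE p in \<nu> \<alpha>. w p = v p"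
    using classical[of \<alpha>] vpi unfolding level_is_classical_direct_integral_def by blast
  have "AE p in \<mu>. p \<in> X \<alpha> \<longrightarrow> w p = v p" using w(3) by (simp only: AE_\<nu>_iff)
  then have "AE p in \<mu>. p \<in> X \<alpha> \<longrightarrow> w p = ?P p (u p)"
    by (rule eventually_mono) (simp add: v_def)
  then show ?thesis using supported_lev[OF w(1,2)] by blast
qed

abbreviation proj :: "'i \<Rightarrow> 'x \<Rightarrow> 'v \<Rightarrow> 'v" where
  "proj \<alpha> p \<equiv> complex_inner_product_space.orth_proj (\<D> p) (\<H> \<alpha> p)"

text \<open>Test with the projected section \<open>w\<close> of \<open>z\<close>: pointwise
  \<open><z, w>\<close> equals the squared norm of \<open>w\<close>, so the vanishing integral
  forces the projection of \<open>z\<close> to be zero almost everywhere. Integrated orthogonality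
  thereby becomes fibrewise.\<close>

lemma AE_orth_if_integral_orth:
  assumes z: "z \<in> U" and orth: "\<And>w. w \<in> lev \<alpha> \<Longrightarrow> (\<integral>p. ip (\<D> p) (z p) (w p) \<partial>completion \<mu>) = 0"
  shows "AE p in \<mu>. p \<in> X \<alpha> \<longrightarrow> (\<forall>y\<in>\<H> \<alpha> p. ip (\<D> p) (z p) y = 0)"
proof -
  obtain w where w: "w \<in> lev \<alpha>" "AE p in \<mu>. p \<in> X \<alpha> \<longrightarrow> w p = proj \<alpha> p (z p)"
    using projected_section[OF z] by blast
  note wU = levD(1)[OF w(1)]
  have "AE p in \<mu>. ip (\<D> p) (z p) (w p) = of_real (norm2 w p)"
    using w(2) levD(3)[OF w(1)] AE_space
  proof eventually_elim
    case (elim p)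
    interpret D: complex_inner_product_space "\<D> p" by (rule cips[OF elim(3)])
    have c: "z p \<in> carrier (\<D> p)" "w p \<in> carrier (\<D> p)" using U_carrier z wU elim(3) by blast+
    have "ip (\<D> p) (z p \<ominus>\<^bsub>\<D> p\<^esub> w p) (w p) = 0"
    proof (cases "p \<in> X \<alpha>")
      case True
      then show ?thesis
        using elim(1) D.orth_proj[OF closed_subspace_\<H>[OF elim(3), of \<alpha>] c(1)] by simp
    qed (use elim c in simp)
    then have "ip (\<D> p) (z p) (w p) = ip (\<D> p) (w p) (w p)" using c by (simp add: D.ip_diff_left)
    then show ?case using ip_self_norm2[OF wU elim(3)] by simp
  qed
  then have "(\<integral>p. ip (\<D> p) (z p) (w p) \<partial>completion \<mu>) = (\<integral>p. of_real (norm2 w p) \<partial>completion \<mu>)"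
    by (intro integral_cong_AE borel_measurable_integrable U_integrable z wU integrable_of_real integrable_norm2)
      (simp add: AE_completion_iff)
  then have "(\<integral>p. norm2 w p \<partial>completion \<mu>) = 0" using orth[OF w(1)] by simp
  from norm2_eq_zero_AE[OF wU this] w(2) AE_space show ?thesis
  proof eventually_elim
    case (elim p)
    interpret D: complex_inner_product_space "\<D> p" by (rule cips[OF elim(3)])
    have c: "z p \<in> carrier (\<D> p)" using U_carrier[OF z elim(3)] .
    show ?case
    proof (intro impI ballI)
      fix y assume p: "p \<in> X \<alpha>" and y: "y \<in> \<H> \<alpha> p"
      have yc: "y \<in> carrier (\<D> p)" using y \<H>_sub[OF elim(3)] by blast
      have "ip (\<D> p) (z p \<ominus>\<^bsub>\<D> p\<^esub> \<zero>\<^bsub>\<D> p\<^esub>) y = 0"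
        using D.orth_proj_orth[OF closed_subspace_\<H>[OF elim(3), of \<alpha>] c y] elim p by simp
      then show "ip (\<D> p) (z p) y = 0" using c yc by (simp add: D.ip_diff_left)
    qed
  qed
qed

text \<open>Subtracting the projected section from \<open>u\<close> gives a section orthogonal to
  level \<alpha>. Its image under \<tau> is again orthogonal, and integrated orthogonality can be
  read in the fibres.\<close>

lemma AE_glued_op_orth:
  assumes u: "u \<in> U"
  shows "AE p in \<mu>. p \<in> X \<alpha> \<longrightarrow> (\<forall>y\<in>\<H> \<alpha> p. ip (\<D> p) (glued_op p (u p \<ominus>\<^bsub>\<D> p\<^esub> proj \<alpha> p (u p))) y = 0)"
proof -
  obtain w where w: "w \<in> lev \<alpha>" "AE p in \<mu>. p \<in> X \<alpha> \<longrightarrow> w p = proj \<alpha> p (u p)"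
    using projected_section[OF u] by blast
  note wU = levD(1)[OF w(1)]
  define z where "z = lincomb (-1) w u"
  have z: "z \<in> U" unfolding z_def by (rule lincomb_U[OF wU u])
  have z_eq: "AE p in \<mu>. p \<in> X \<alpha> \<longrightarrow> z p = u p \<ominus>\<^bsub>\<D> p\<^esub> proj \<alpha> p (u p)"
    using w(2) AE_space
  proof eventually_elim
    case (elim p)
    then have "z p = u p \<ominus>\<^bsub>\<D> p\<^esub> w p"
      using minus_fibre[OF elim(2) U_carrier[OF u elim(2)] U_carrier[OF wU elim(2)]]
      by (simp only: z_def lincomb_apply)
    then show ?case using elim(1) by simp
  qed
  have "(\<integral>p. ip (\<D> p) (z p) (w' p) \<partial>completion \<mu>) = 0" if w': "w' \<in> lev \<alpha>" for w'
  proof -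
    have "AE p in \<mu>. ip (\<D> p) (z p) (w' p) = 0"
      using z_eq levD(2,3)[OF w'] AE_space
    proof eventually_elim
      case (elim p)
      interpret D: complex_inner_product_space "\<D> p" by (rule cips[OF elim(4)])
      show ?case
      proof (cases "p \<in> X \<alpha>")
        case True
        then show ?thesis
          using elim D.orth_proj_orth[OF closed_subspace_\<H>[OF elim(4)] U_carrier[OF u elim(4)]] by simp
      \<comment> \<open>Outside \<open>X \<alpha>\<close> nothing is known about \<open>z\<close>,
        but the test section vanishes there.\<close>
      next
        case False
        then show ?thesis using elim U_carrier[OF z elim(4)] by simp
      qed
    qed
    then have "(\<integral>p. ip (\<D> p) (z p) (w' p) \<partial>completion \<mu>) = (\<integral>p. 0 \<partial>completion \<mu>)"
      by (intro integral_cong_AE borel_measurable_integrable U_integrable z levD(1)[OF w'])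
        (simp_all add: AE_completion_iff)
    then show ?thesis by simp
  qed
  then have "AE p in \<mu>. p \<in> X \<alpha> \<longrightarrow> (\<forall>y\<in>\<H> \<alpha> p. ip (\<D> p) (\<tau> z p) y = 0)"
    by (intro AE_orth_if_integral_orth \<tau>_U z \<tau>_orth)
  with AE_glued_op[OF z] z_eq show ?thesis by eventually_elim simp
qed

text \<open>Orthogonality is recorded only for dense sections, since one null set cannot be expected
  to serve all sections. General vectors of the complement follow by approximation.\<close>

definition regular :: "'x \<Rightarrow> bool" where
  "regular p \<longleftrightarrow> extendable p \<and> (\<forall>\<alpha> \<beta>. \<forall>s\<in>dense_sections \<beta>. p \<in> X \<alpha> \<longrightarrow>
     (\<forall>y\<in>\<H> \<alpha> p. ip (\<D> p) (glued_op p (s p \<ominus>\<^bsub>\<D> p\<^esub> proj \<alpha> p (s p))) y = 0))"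

lemma AE_regular: "AE p in \<mu>. regular p"
proof -
  have "AE p in \<mu>. \<forall>\<alpha>\<in>UNIV. \<forall>\<beta>\<in>UNIV. \<forall>s\<in>dense_sections \<beta>. p \<in> X \<alpha> \<longrightarrow>
     (\<forall>y\<in>\<H> \<alpha> p. ip (\<D> p) (glued_op p (s p \<ominus>\<^bsub>\<D> p\<^esub> proj \<alpha> p (s p))) y = 0)"
    unfolding AE_ball_countable[OF countable_index] AE_ball_countable[OF countable_dense_sections]
    by (intro ballI AE_glued_op_orth dense_sections_U)
  with AE_extendable show ?thesis by eventually_elim (simp add: regular_def)
qed

text \<open>Approximate \<open>x\<close> by dense values and subtract their projections onto
  \<open>\<H> \<alpha> p\<close>. The results still converge to \<open>x\<close>, their images are
  orthogonal to \<open>y\<close> by regularity, and continuity passes this to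
  \<open>x\<close>.\<close>

lemma glued_op_orth:
  assumes p: "regular p" "p \<in> X \<alpha>" and x: "x \<in> orth (\<D> p) (\<H> \<alpha> p)" and y: "y \<in> \<H> \<alpha> p"
  shows "ip (\<D> p) (glued_op p x) y = 0"
proof -
  have g: "extendable p" and pm: "p \<in> space \<mu>" using p unfolding regular_def extendable_def by blast+
  interpret D: complex_inner_product_space "\<D> p" by (rule cips[OF pm])
  have xc: "x \<in> carrier (\<D> p)" using x by (simp add: orth_def)
  \<comment> \<open>A level above \<alpha> contains both \<open>x\<close> and all the projections,
    so one bounded operator handles the whole sequence.\<close>
  obtain \<beta> where \<beta>: "\<alpha> \<le> \<beta>" "p \<in> X \<beta>" "x \<in> \<H> \<beta> p" using cofinal[OF pm xc] by blast
  note H = closed_subspace_\<H>[OF pm] and L = level_op_bounded[OF g \<beta>(2)]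
  have "x \<in> adh p (fibre_dense \<beta> p)" using \<beta>(3) adh_fibre_dense[OF g \<beta>(2)] by simp
  then obtain \<sigma> where \<sigma>: "\<And>n. \<sigma> n \<in> fibre_dense \<beta> p" "D.converges \<sigma> x"
    using D.adherence_seq fibre_dense_carrier[OF pm] by blast
  have \<sigma>H: "\<sigma> n \<in> \<H> \<beta> p" for n using \<sigma>(1)[of n] dense_sections_\<H>[OF g \<beta>(2)] by auto
  have \<sigma>c: "\<sigma> n \<in> carrier (\<D> p)" for n using \<sigma>H \<H>_sub[OF pm] by blast
  have PH: "proj \<alpha> p (\<sigma> n) \<in> \<H> \<alpha> p" for n by (rule D.orth_proj_in[OF H \<sigma>c])
  then have Pc: "proj \<alpha> p (\<sigma> n) \<in> carrier (\<D> p)" and P\<beta>: "proj \<alpha> p (\<sigma> n) \<in> \<H> \<beta> p" for n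
    using \<H>_sub[OF pm] \<H>_mono[OF pm \<beta>(1)] by blast+
  define \<zeta> where "\<zeta> n = \<sigma> n \<ominus>\<^bsub>\<D> p\<^esub> proj \<alpha> p (\<sigma> n)" for n
  have \<zeta>H: "\<zeta> n \<in> \<H> \<beta> p" for n unfolding \<zeta>_def by (rule D.closed_subspace_diff[OF H \<sigma>H P\<beta>])
  then have \<zeta>c: "\<zeta> n \<in> carrier (\<D> p)" for n using \<H>_sub[OF pm] by blast
  \<comment> \<open>Both \<open>\<zeta> n\<close> and \<open>x\<close> are orthogonal to the
    discarded projection, and adding it to their difference gives \<open>\<sigma> n - x\<close>;
    Pythagoras compares the norms.\<close>
  have "ip_norm (\<D> p) (\<zeta> n \<ominus>\<^bsub>\<D> p\<^esub> x) \<le> ip_norm (\<D> p) (\<sigma> n \<ominus>\<^bsub>\<D> p\<^esub> x)" for n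
  proof -
    have "ip (\<D> p) (\<zeta> n) (proj \<alpha> p (\<sigma> n)) = 0"
      unfolding \<zeta>_def by (rule D.orth_proj_orth[OF H \<sigma>c PH])
    moreover have "ip (\<D> p) x (proj \<alpha> p (\<sigma> n)) = 0" using x PH by (simp add: orth_def)
    ultimately have "ip (\<D> p) (\<zeta> n \<ominus>\<^bsub>\<D> p\<^esub> x) (proj \<alpha> p (\<sigma> n)) = 0"
      using \<zeta>c xc Pc by (simp add: D.ip_diff_left)
    then have "ip_norm (\<D> p) (\<zeta> n \<ominus>\<^bsub>\<D> p\<^esub> x) \<le> ip_norm (\<D> p) ((\<zeta> n \<ominus>\<^bsub>\<D> p\<^esub> x) \<oplus>\<^bsub>\<D> p\<^esub> proj \<alpha> p (\<sigma> n))"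
      using \<zeta>c xc Pc by (intro D.ip_norm_pythagoras_le) auto
    also have "(\<zeta> n \<ominus>\<^bsub>\<D> p\<^esub> x) \<oplus>\<^bsub>\<D> p\<^esub> proj \<alpha> p (\<sigma> n) = \<sigma> n \<ominus>\<^bsub>\<D> p\<^esub> x"
      unfolding \<zeta>_def using \<sigma>c Pc xc by (intro D.ip_eqI) (auto simp: D.ip_simps)
    finally show ?thesis .
  qed
  then have "D.converges \<zeta> x"
    unfolding D.converges_def
    by (intro real_tendsto_sandwich[OF _ _ tendsto_const \<sigma>(2)[unfolded D.converges_def]] always_eventually allI)
      (use \<zeta>c xc in auto)
  then have lim: "D.converges (\<lambda>n. level_op \<beta> p (\<zeta> n)) (level_op \<beta> p x)"
    by (rule D.bounded_op_converges[OF H L \<zeta>H \<beta>(3)])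
  have LH: "level_op \<beta> p v \<in> carrier (\<D> p)" if "v \<in> \<H> \<beta> p" for v
    using L that \<H>_sub[OF pm] unfolding D.bounded_op_def by blast
  have "ip (\<D> p) (level_op \<beta> p x) y = 0"
  proof (rule D.ip_eq_zero_limit[OF LH[OF \<zeta>H] LH[OF \<beta>(3)] _ lim])
    show "y \<in> carrier (\<D> p)" using y \<H>_sub[OF pm] by blast
    fix n
    obtain s where s: "s \<in> dense_sections \<beta>" "\<sigma> n = s p" using \<sigma>(1)[of n] by blast
    have "ip (\<D> p) (glued_op p (\<zeta> n)) y = 0"
      using p s y unfolding regular_def \<zeta>_def by simp
    then show "ip (\<D> p) (level_op \<beta> p (\<zeta> n)) y = 0" using glued_op_eq[OF g \<beta>(2) \<zeta>H] by simp
  qed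
  then show ?thesis using glued_op_eq[OF g \<beta>(2,3)] by simp
qed

text \<open>Local boundedness is required in every fibre, so the zero operator fills in at points
  that are not regular.\<close>

definition fibre_op :: "'x \<Rightarrow> 'v \<Rightarrow> 'v" where
  "fibre_op p = (\<lambda>x\<in>carrier (\<D> p). if regular p then glued_op p x else \<zero>\<^bsub>\<D> p\<^esub>)"

lemma glued_op_locally_bounded:
  assumes p: "regular p"
  shows "(\<lambda>x\<in>carrier (\<D> p). glued_op p x) \<in> locally_bounded_operators (\<D> p) {\<alpha>. p \<in> X \<alpha>} (\<lambda>\<alpha>. \<H> \<alpha> p)"
proof -
  have g: "extendable p" and pm: "p \<in> space \<mu>" using p unfolding regular_def extendable_def by blast+
  interpret D: complex_inner_product_space "\<D> p" by (rule cips[OF pm])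
  have glued_H: "glued_op p x \<in> \<H> \<alpha> p" "ip_norm (\<D> p) (glued_op p x) \<le> level_bound \<alpha> * ip_norm (\<D> p) x"
    if "p \<in> X \<alpha>" "x \<in> \<H> \<alpha> p" for \<alpha> x
    using level_op_bounded[OF g that(1)] that glued_op_eq[OF g that] unfolding D.bounded_op_def by auto
  have L: "glued_op p x \<in> carrier (\<D> p)" if x: "x \<in> carrier (\<D> p)" for x
  proof -
    obtain \<alpha> where "p \<in> X \<alpha>" "x \<in> \<H> \<alpha> p" using cofinal[OF pm x] by blast
    then show ?thesis using glued_H(1) \<H>_sub[OF pm] by blast
  qed
  have lin: "glued_op p (a \<odot>\<^bsub>\<D> p\<^esub> x \<oplus>\<^bsub>\<D> p\<^esub> y) = a \<odot>\<^bsub>\<D> p\<^esub> glued_op p x \<oplus>\<^bsub>\<D> p\<^esub> glued_op p y"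
    if xy: "x \<in> carrier (\<D> p)" "y \<in> carrier (\<D> p)" for a x y
  proof -
    \<comment> \<open>Linearity is known only within a single level, so both vectors are first moved
      to a common one that contains \<open>p\<close>.\<close>
    obtain \<alpha>0 where x0: "x \<in> \<H> \<alpha>0 p" using xy carrier_fibre[OF pm] by blast
    obtain \<alpha> where \<alpha>: "\<alpha>0 \<le> \<alpha>" "p \<in> X \<alpha>" "y \<in> \<H> \<alpha> p" using cofinal[OF pm xy(2)] by blast
    have x: "x \<in> \<H> \<alpha> p" using x0 \<H>_mono[OF pm \<alpha>(1)] by blast
    show ?thesis
      using level_op_bounded[OF g \<alpha>(2)] x \<alpha>(3) fibre_lincomb(2)[OF pm x \<alpha>(3)]
      unfolding D.bounded_op_def by (simp add: glued_op_eq[OF g \<alpha>(2)])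
  qed
  show ?thesis
    unfolding locally_bounded_operators_def
  proof (intro CollectI conjI ballI allI)
    let ?T = "\<lambda>x\<in>carrier (\<D> p). glued_op p x"
    show "?T \<in> carrier (\<D> p) \<rightarrow>\<^sub>E carrier (\<D> p)" using L by simp
    show "?T (x \<oplus>\<^bsub>\<D> p\<^esub> y) = ?T x \<oplus>\<^bsub>\<D> p\<^esub> ?T y" if "x \<in> carrier (\<D> p)" "y \<in> carrier (\<D> p)" for x y
      using D.linear_if_lincomb(1)[of "glued_op p", OF L lin that] that by simp
    show "?T (a \<odot>\<^bsub>\<D> p\<^esub> x) = a \<odot>\<^bsub>\<D> p\<^esub> ?T x" if "x \<in> carrier (\<D> p)" for a x
      using D.linear_if_lincomb(2)[of "glued_op p", OF L lin that] that by simp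
    fix \<alpha> assume "\<alpha> \<in> {\<alpha>. p \<in> X \<alpha>}"
    then have \<alpha>: "p \<in> X \<alpha>" by simp
    have sub: "x \<in> carrier (\<D> p)" if "x \<in> \<H> \<alpha> p" for x using \<H>_sub[OF pm] that by blast
    show "?T ` \<H> \<alpha> p \<subseteq> \<H> \<alpha> p" using glued_H(1)[OF \<alpha>] sub by auto
    show "?T ` orth (\<D> p) (\<H> \<alpha> p) \<subseteq> orth (\<D> p) (\<H> \<alpha> p)"
    proof clarify
      fix x assume x: "x \<in> orth (\<D> p) (\<H> \<alpha> p)"
      then show "?T x \<in> orth (\<D> p) (\<H> \<alpha> p)"
        using glued_op_orth[OF p \<alpha> x] L by (simp add: orth_def)
    qed
    have "\<forall>x\<in>\<H> \<alpha> p. ip_norm (\<D> p) (?T x) \<le> level_bound \<alpha> * ip_norm (\<D> p) x"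
      using glued_H(2)[OF \<alpha>] sub by simp
    then show "\<exists>c. \<forall>x\<in>\<H> \<alpha> p. ip_norm (\<D> p) (?T x) \<le> c * ip_norm (\<D> p) x" by (rule exI)
  qed
qed

lemma fibre_op_locally_bounded:
  assumes "p \<in> space \<mu>"
  shows "fibre_op p \<in> locally_bounded_operators (\<D> p) {\<alpha>. p \<in> X \<alpha>} (\<lambda>\<alpha>. \<H> \<alpha> p)"
proof (cases "regular p")
  case True
  then show ?thesis using glued_op_locally_bounded[OF True] by (simp add: fibre_op_def)
next
  case False
  then show ?thesis
    using restrict_id_or_zero_locally_bounded[OF assms, of False] by (simp add: fibre_op_def)
qed

lemma decomposable_if_countable: "T \<in> decomposable_operators \<nu> \<mu> \<D> \<H> U"
proof -
  have "AE p in \<mu>. \<tau> u p = fibre_op p (u p)" if u: "u \<in> U" for u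
    using AE_regular AE_glued_op[OF u] AE_space
    by eventually_elim (simp add: fibre_op_def U_carrier[OF u])
  then have "\<forall>u\<in>U. \<forall>v\<in>T (cls u). AE p in \<mu>. v p = fibre_op p (u p)"
    using AE_T_iff[where F = fibre_op] by blast
  then show ?thesis
    unfolding decomposable_operators_def
    using T fibre_op_locally_bounded by blast
qed

end

section \<open>Decomposable operators as a commutant\<close>

theorem theorem2p23:
  fixes \<nu> :: "'i::order \<Rightarrow> 'x measure" and \<mu> :: "'x measure"
    and \<D> :: "'x \<Rightarrow> 'v inner_space" and \<H> :: "'i \<Rightarrow> 'x \<Rightarrow> 'v set"
    and U :: "('x \<Rightarrow> 'v) set"
  assumes "\<forall>\<alpha> \<beta> :: 'i. \<exists>\<gamma>. \<alpha> \<le> \<gamma> \<and> \<beta> \<le> \<gamma>"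
    and "locally_standard_measure_space \<nu> \<mu>"
    and "\<forall>p\<in>space \<mu>. locally_hilbert_space (\<D> p) (\<lambda>\<alpha>. \<H> \<alpha> p) \<and>
                    (\<forall>\<alpha>. separable_subset (\<D> p) (\<H> \<alpha> p))"
    and "is_direct_integral \<nu> \<mu> \<D> \<H> U"
    and "(countable (UNIV :: 'i set) \<and>
            (\<forall>\<alpha>. level_is_classical_direct_integral \<nu> \<mu> \<D> \<H> U \<alpha>)) \<or>
         (\<forall>E\<in>sets \<mu>. emeasure \<mu> E = emeasure (count_space (space \<mu>)) E)"
  shows "decomposable_operators \<nu> \<mu> \<D> \<H> U =
         commutant (direct_integral \<mu> \<D> U) UNIV (direct_integral_level \<nu> \<mu> \<D> \<H> U)
           (diagonalizable_operators \<nu> \<mu> \<D> \<H> U)"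
proof
  interpret local_direct_integral \<nu> \<mu> \<D> \<H> U
    using assms(1-4) by unfold_locales blast+
  show "decomposable_operators \<nu> \<mu> \<D> \<H> U \<subseteq>
      commutant V UNIV level (diagonalizable_operators \<nu> \<mu> \<D> \<H> U)"
    by (rule decomposable_subset_commutant)
  show "commutant V UNIV level (diagonalizable_operators \<nu> \<mu> \<D> \<H> U) \<subseteq>
      decomposable_operators \<nu> \<mu> \<D> \<H> U"
  proof
    fix T assume T: "T \<in> commutant V UNIV level (diagonalizable_operators \<nu> \<mu> \<D> \<H> U)"
    have "commuting_operator \<nu> \<mu> \<D> \<H> U T"
    proof
      show "T \<in> locally_bounded_operators V UNIV level" using T unfolding commutant_def by simp
      show "T (cut_op E A) = cut_op E (T A)" if "E \<in> sets \<mu>" "A \<in> carrier V" for E A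
        using T cut_op_diagonalizable[OF that(1)] that(2) unfolding commutant_def by simp
    qed
    then interpret commuting_operator \<nu> \<mu> \<D> \<H> U T .
    from assms(5) show "T \<in> decomposable_operators \<nu> \<mu> \<D> \<H> U"
    proof
      assume "countable (UNIV :: 'i set) \<and> (\<forall>\<alpha>. level_is_classical_direct_integral \<nu> \<mu> \<D> \<H> U \<alpha>)"
      then interpret countable_operator \<nu> \<mu> \<D> \<H> U T by unfold_locales blast+
      show ?thesis by (rule decomposable_if_countable)
    next
      assume "\<forall>E\<in>sets \<mu>. emeasure \<mu> E = emeasure (count_space (space \<mu>)) E"
      then interpret counting_operator \<nu> \<mu> \<D> \<H> U T by unfold_locales blast
      show ?thesis by (rule decomposable_if_counting)
    qed
  qed
qed

end
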